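(* (Over $\mathrm{RCA}_0$.) Consider some well-order $X$. Then, the following are equivalent: a) $\mathrm{WETR}_X$; b) The disjunction of $\mathrm{WKL}$ and $\mathrm{SETR}_X$.
   Context: Work in the base system $\mathrm{RCA}_0$; $\mathrm{WKL}$ denotes Weak K\H{o}nig's Lemma. For a well-order $X$ and a formula $\varphi(n,x,Z)$, write $H_\varphi(X,Y)$ for the statement $Y = \{(x,n) \mid x \in X \text{ and } \varphi(n,x,Y^x)\}$, where $Y^x$ is the restriction of $Y$ to pairs $(x',n)$ with $x' <_X x$; and write $X|_x$ for the suborder $\{x' \in X \mid x' <_X x\}$. $\mathrm{SETR}_X$ (Strong Effective Transfinite Recursion along $X$) is the principle: for all $\Sigma^0_1$-formulas $\varphi(n,x,Z)$ and $\psi(n,x,Z)$, if $\forall n \in \mathbb{N}\ \forall x \in X\ \forall Z \subseteq \mathbb{N}\ (H_\varphi(X|_x, Z) \to (\varphi(n,x,Z) \leftrightarrow \lnot\psi(n,x,Z)))$, then there exists a set $Y$ with $H_\varphi(X,Y)$. $\mathrm{WETR}_X$ (Weak Effective Transfinite Recursion along $X$) is the principle: for all $\Sigma^0_1$-formulas $\varphi(n,x,Z)$ and $\psi(n,x,Z)$, if $\forall n \in \mathbb{N}\ \forall x \in X\ \forall Z \subseteq \mathbb{N}\ (\varphi(n,x,Z) \leftrightarrow \lnot\psi(n,x,Z))$, then there exists a set $Y$ with $H_\varphi(X,Y)$. *)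

theory Defs
  imports Main
begin

section \<open>The language of second-order arithmetic\<close>

text \<open>Number variables and set variables are indexed separately by natural numbers.\<close>

datatype tm = Var nat | Zero | One | Plus tm tm | Times tm tm

datatype fm =
    Eq tm tm | Less tm tm | Mem tm nat
  | Neg fm | Conj fm fm | Disj fm fm | Imp fm fm
  | AllN nat fm | ExN nat fm
  | AllS nat fm | ExS nat fm

fun tm_vars :: "tm \<Rightarrow> nat set" where
  "tm_vars (Var i) = {i}"
| "tm_vars Zero = {}"
| "tm_vars One = {}"
| "tm_vars (Plus t u) = tm_vars t \<union> tm_vars u"
| "tm_vars (Times t u) = tm_vars t \<union> tm_vars u"

text \<open>Bounded quantifiers are abbreviations, and the bounding term must not contain the
  bound variable.\<close>

inductive bounded_fm :: "fm \<Rightarrow> bool" where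
  "bounded_fm (Eq t u)"
| "bounded_fm (Less t u)"
| "bounded_fm (Mem t k)"
| "bounded_fm p \<Longrightarrow> bounded_fm (Neg p)"
| "bounded_fm p \<Longrightarrow> bounded_fm q \<Longrightarrow> bounded_fm (Conj p q)"
| "bounded_fm p \<Longrightarrow> bounded_fm q \<Longrightarrow> bounded_fm (Disj p q)"
| "bounded_fm p \<Longrightarrow> bounded_fm q \<Longrightarrow> bounded_fm (Imp p q)"
| "bounded_fm p \<Longrightarrow> i \<notin> tm_vars t \<Longrightarrow> bounded_fm (AllN i (Imp (Less (Var i) t) p))"
| "bounded_fm p \<Longrightarrow> i \<notin> tm_vars t \<Longrightarrow> bounded_fm (ExN i (Conj (Less (Var i) t) p))"

definition Sigma01 :: "fm \<Rightarrow> bool" where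
  "Sigma01 p \<longleftrightarrow> (\<exists>i q. bounded_fm q \<and> p = ExN i q)"

definition Pi01 :: "fm \<Rightarrow> bool" where
  "Pi01 p \<longleftrightarrow> (\<exists>i q. bounded_fm q \<and> p = AllN i q)"

section \<open>Structures and satisfaction\<close>

text \<open>The first-order part is the whole type, so it may be nonstandard; the set variables range
  over \<open>SetsOf M\<close> only. Provability in a theory is rendered as truth in all of its models.\<close>

record 'm l2_structure =
  zeroM :: 'm
  oneM :: 'm
  addM :: "'m \<Rightarrow> 'm \<Rightarrow> 'm"
  mulM :: "'m \<Rightarrow> 'm \<Rightarrow> 'm"
  lessM :: "'m \<Rightarrow> 'm \<Rightarrow> bool"
  SetsOf :: "'m set set"

fun tm_val :: "'m l2_structure \<Rightarrow> (nat \<Rightarrow> 'm) \<Rightarrow> tm \<Rightarrow> 'm" where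
  "tm_val M e (Var i) = e i"
| "tm_val M e Zero = zeroM M"
| "tm_val M e One = oneM M"
| "tm_val M e (Plus t u) = addM M (tm_val M e t) (tm_val M e u)"
| "tm_val M e (Times t u) = mulM M (tm_val M e t) (tm_val M e u)"

fun sat :: "'m l2_structure \<Rightarrow> (nat \<Rightarrow> 'm) \<Rightarrow> (nat \<Rightarrow> 'm set) \<Rightarrow> fm \<Rightarrow> bool" where
  "sat M e s (Eq t u) \<longleftrightarrow> tm_val M e t = tm_val M e u"
| "sat M e s (Less t u) \<longleftrightarrow> lessM M (tm_val M e t) (tm_val M e u)"
| "sat M e s (Mem t k) \<longleftrightarrow> tm_val M e t \<in> s k"
| "sat M e s (Neg p) \<longleftrightarrow> \<not> sat M e s p"
| "sat M e s (Conj p q) \<longleftrightarrow> sat M e s p \<and> sat M e s q"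
| "sat M e s (Disj p q) \<longleftrightarrow> sat M e s p \<or> sat M e s q"
| "sat M e s (Imp p q) \<longleftrightarrow> (sat M e s p \<longrightarrow> sat M e s q)"
| "sat M e s (AllN i p) \<longleftrightarrow> (\<forall>a. sat M (e(i := a)) s p)"
| "sat M e s (ExN i p) \<longleftrightarrow> (\<exists>a. sat M (e(i := a)) s p)"
| "sat M e s (AllS k p) \<longleftrightarrow> (\<forall>A\<in>SetsOf M. sat M e (s(k := A)) p)"
| "sat M e s (ExS k p) \<longleftrightarrow> (\<exists>A\<in>SetsOf M. sat M e (s(k := A)) p)"

section \<open>The base theory\<close>

definition basic_axioms :: "'m l2_structure \<Rightarrow> bool" where
  "basic_axioms M \<longleftrightarrow>
     (\<forall>m. addM M m (oneM M) \<noteq> zeroM M) \<and>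
     (\<forall>m n. addM M m (oneM M) = addM M n (oneM M) \<longrightarrow> m = n) \<and>
     (\<forall>m. addM M m (zeroM M) = m) \<and>
     (\<forall>m n. addM M m (addM M n (oneM M)) = addM M (addM M m n) (oneM M)) \<and>
     (\<forall>m. mulM M m (zeroM M) = zeroM M) \<and>
     (\<forall>m n. mulM M m (addM M n (oneM M)) = addM M (mulM M m n) m) \<and>
     (\<forall>m. \<not> lessM M m (zeroM M)) \<and>
     (\<forall>m n. lessM M m (addM M n (oneM M)) \<longleftrightarrow> lessM M m n \<or> m = n)"

text \<open>In both schemes the remaining variables of the formulas act as number and set
  parameters, supplied by the valuations \<open>e\<close> and \<open>s\<close>.\<close>

definition Sigma01_induction :: "'m l2_structure \<Rightarrow> bool" where
  "Sigma01_induction M \<longleftrightarrow>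
     (\<forall>p i e s. Sigma01 p \<and> range s \<subseteq> SetsOf M \<longrightarrow>
        sat M (e(i := zeroM M)) s p \<longrightarrow>
        (\<forall>n. sat M (e(i := n)) s p \<longrightarrow> sat M (e(i := addM M n (oneM M))) s p) \<longrightarrow>
        (\<forall>n. sat M (e(i := n)) s p))"

definition Delta01_comprehension :: "'m l2_structure \<Rightarrow> bool" where
  "Delta01_comprehension M \<longleftrightarrow>
     (\<forall>p q i e s. Sigma01 p \<and> Pi01 q \<and> range s \<subseteq> SetsOf M \<longrightarrow>
        (\<forall>n. sat M (e(i := n)) s p \<longleftrightarrow> sat M (e(i := n)) s q) \<longrightarrow>
        {n. sat M (e(i := n)) s p} \<in> SetsOf M)"

text \<open>Nonemptiness of the second-order domain is part of the notion of a structure; without it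
  the two schemes would hold vacuously, as there would be no valuation \<open>s\<close>.\<close>

definition RCA0 :: "'m l2_structure \<Rightarrow> bool" where
  "RCA0 M \<longleftrightarrow> SetsOf M \<noteq> {} \<and> basic_axioms M \<and> Sigma01_induction M \<and> Delta01_comprehension M"

section \<open>Pairs, functions and finite sequences\<close>

definition pairM :: "'m l2_structure \<Rightarrow> 'm \<Rightarrow> 'm \<Rightarrow> 'm" where
  "pairM M i j = addM M (mulM M (addM M i j) (addM M i j)) i"

definition internal_fun :: "'m l2_structure \<Rightarrow> ('m \<Rightarrow> 'm) \<Rightarrow> bool" where
  "internal_fun M f \<longleftrightarrow> {pairM M n (f n) | n. True} \<in> SetsOf M"

text \<open>The triple \<open>(k, (m, n))\<close> represents the finite set of all \<open>i < k\<close> such that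
  \<open>m * (i + 1) + 1\<close> divides \<open>n\<close> (Goedel's beta function). The code of a finite set is its least
  representative.\<close>

definition represents_finite :: "'m l2_structure \<Rightarrow> 'm \<Rightarrow> 'm set \<Rightarrow> bool" where
  "represents_finite M c A \<longleftrightarrow>
     (\<exists>k m n. c = pairM M k (pairM M m n) \<and>
        A = {i. lessM M i k \<and>
                (\<exists>d. n = mulM M (addM M (mulM M m (addM M i (oneM M))) (oneM M)) d)})"

definition codes_finite :: "'m l2_structure \<Rightarrow> 'm \<Rightarrow> 'm set \<Rightarrow> bool" where
  "codes_finite M c A \<longleftrightarrow>
     represents_finite M c A \<and> (\<forall>c'. represents_finite M c' A \<longrightarrow> \<not> lessM M c' c)"

text \<open>\<open>codes_seq M c l A\<close>: the number \<open>c\<close> codes a finite sequence of length \<open>l\<close>,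
  identified with its graph \<open>A\<close>.\<close>

definition codes_seq :: "'m l2_structure \<Rightarrow> 'm \<Rightarrow> 'm \<Rightarrow> 'm set \<Rightarrow> bool" where
  "codes_seq M c l A \<longleftrightarrow>
     codes_finite M c A \<and>
     (\<forall>a\<in>A. \<exists>i j. a = pairM M i j) \<and>
     (\<forall>i j k. pairM M i j \<in> A \<and> pairM M i k \<in> A \<longrightarrow> j = k) \<and>
     (\<forall>i. lessM M i l \<longleftrightarrow> (\<exists>j. pairM M i j \<in> A))"

definition codes_binseq :: "'m l2_structure \<Rightarrow> 'm \<Rightarrow> 'm \<Rightarrow> 'm set \<Rightarrow> bool" where
  "codes_binseq M c l A \<longleftrightarrow>
     codes_seq M c l A \<and> (\<forall>i j. pairM M i j \<in> A \<longrightarrow> j = zeroM M \<or> j = oneM M)"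

section \<open>Weak Koenig's Lemma\<close>

definition binary_tree :: "'m l2_structure \<Rightarrow> 'm set \<Rightarrow> bool" where
  "binary_tree M T \<longleftrightarrow>
     (\<forall>c\<in>T. \<exists>l A. codes_binseq M c l A) \<and>
     (\<forall>c\<in>T. \<forall>l A c' l' A'. codes_binseq M c l A \<and> codes_binseq M c' l' A' \<and> A' \<subseteq> A \<longrightarrow> c' \<in> T)"

definition infiniteM :: "'m l2_structure \<Rightarrow> 'm set \<Rightarrow> bool" where
  "infiniteM M A \<longleftrightarrow> (\<forall>m. \<exists>n\<in>A. lessM M m n)"

definition is_path :: "'m l2_structure \<Rightarrow> 'm set \<Rightarrow> ('m \<Rightarrow> 'm) \<Rightarrow> bool" where
  "is_path M T g \<longleftrightarrow>
     internal_fun M g \<and> (\<forall>l. \<exists>c\<in>T. codes_seq M c l {pairM M i (g i) | i. lessM M i l})"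

definition WKL :: "'m l2_structure \<Rightarrow> bool" where
  "WKL M \<longleftrightarrow> (\<forall>T\<in>SetsOf M. binary_tree M T \<and> infiniteM M T \<longrightarrow> (\<exists>g. is_path M T g))"

section \<open>Well-orders\<close>

text \<open>An order is given by the set of codes of the pairs of its reflexive relation.\<close>

definition leX :: "'m l2_structure \<Rightarrow> 'm set \<Rightarrow> 'm \<Rightarrow> 'm \<Rightarrow> bool" where
  "leX M X x y \<longleftrightarrow> pairM M x y \<in> X"

definition lessX :: "'m l2_structure \<Rightarrow> 'm set \<Rightarrow> 'm \<Rightarrow> 'm \<Rightarrow> bool" where
  "lessX M X x y \<longleftrightarrow> leX M X x y \<and> \<not> leX M X y x"

definition fieldX :: "'m l2_structure \<Rightarrow> 'm set \<Rightarrow> 'm set" where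
  "fieldX M X = {x. leX M X x x}"

definition linear_orderM :: "'m l2_structure \<Rightarrow> 'm set \<Rightarrow> bool" where
  "linear_orderM M X \<longleftrightarrow>
     (\<forall>x y. leX M X x y \<longrightarrow> x \<in> fieldX M X \<and> y \<in> fieldX M X) \<and>
     (\<forall>x y z. leX M X x y \<and> leX M X y z \<longrightarrow> leX M X x z) \<and>
     (\<forall>x y. leX M X x y \<and> leX M X y x \<longrightarrow> x = y) \<and>
     (\<forall>x\<in>fieldX M X. \<forall>y\<in>fieldX M X. leX M X x y \<or> leX M X y x)"

definition well_orderM :: "'m l2_structure \<Rightarrow> 'm set \<Rightarrow> bool" where
  "well_orderM M X \<longleftrightarrow>
     X \<in> SetsOf M \<and> linear_orderM M X \<and>
     \<not> (\<exists>f. internal_fun M f \<and> (\<forall>n. f n \<in> fieldX M X) \<and>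
            (\<forall>n. lessX M X (f (addM M n (oneM M))) (f n)))"

definition suborder :: "'m l2_structure \<Rightarrow> 'm set \<Rightarrow> 'm \<Rightarrow> 'm set" where
  "suborder M X x = {pairM M a b | a b. leX M X a b \<and> lessX M X a x \<and> lessX M X b x}"

section \<open>Effective transfinite recursion\<close>

definition restr :: "'m l2_structure \<Rightarrow> 'm set \<Rightarrow> 'm set \<Rightarrow> 'm \<Rightarrow> 'm set" where
  "restr M X Y x = {pairM M x' n | x' n. pairM M x' n \<in> Y \<and> lessX M X x' x}"

definition recH :: "'m l2_structure \<Rightarrow> ('m \<Rightarrow> 'm \<Rightarrow> 'm set \<Rightarrow> bool) \<Rightarrow> 'm set \<Rightarrow> 'm set \<Rightarrow> bool" where
  "recH M P X Y \<longleftrightarrow> Y = {pairM M x n | x n. x \<in> fieldX M X \<and> P n x (restr M X Y x)}"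

text \<open>The distinguished variables of \<open>\<phi>(n, x, Z)\<close> are the number variables 0 and 1 and the set
  variable 0; all other variables are parameters.\<close>

definition inst :: "'m l2_structure \<Rightarrow> (nat \<Rightarrow> 'm) \<Rightarrow> (nat \<Rightarrow> 'm set) \<Rightarrow> fm
    \<Rightarrow> 'm \<Rightarrow> 'm \<Rightarrow> 'm set \<Rightarrow> bool" where
  "inst M e s p n x Z \<longleftrightarrow> sat M (e(0 := n, 1 := x)) (s(0 := Z)) p"

definition SETR :: "'m l2_structure \<Rightarrow> 'm set \<Rightarrow> bool" where
  "SETR M X \<longleftrightarrow>
     (\<forall>\<phi> \<psi> e s. Sigma01 \<phi> \<and> Sigma01 \<psi> \<and> range s \<subseteq> SetsOf M \<longrightarrow>
        (\<forall>n. \<forall>x\<in>fieldX M X. \<forall>Z\<in>SetsOf M.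
           recH M (inst M e s \<phi>) (suborder M X x) Z \<longrightarrow>
           (inst M e s \<phi> n x Z \<longleftrightarrow> \<not> inst M e s \<psi> n x Z)) \<longrightarrow>
        (\<exists>Y\<in>SetsOf M. recH M (inst M e s \<phi>) X Y))"

definition WETR :: "'m l2_structure \<Rightarrow> 'm set \<Rightarrow> bool" where
  "WETR M X \<longleftrightarrow>
     (\<forall>\<phi> \<psi> e s. Sigma01 \<phi> \<and> Sigma01 \<psi> \<and> range s \<subseteq> SetsOf M \<longrightarrow>
        (\<forall>n. \<forall>x\<in>fieldX M X. \<forall>Z\<in>SetsOf M.
           inst M e s \<phi> n x Z \<longleftrightarrow> \<not> inst M e s \<psi> n x Z) \<longrightarrow>
        (\<exists>Y\<in>SetsOf M. recH M (inst M e s \<phi>) X Y))"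

end

theory Submission
  imports Defs
begin

text \<open>Assume WKL. The finite binary sequences which respect every decision of \<open>\<phi>\<close> and \<open>\<psi>\<close> that
  can be verified within their length form a tree. It is infinite because the recursion can be
  carried out along a finite suborder of \<open>X\<close>, and each of its paths solves the recursion.

  If WKL fails, fix an infinite binary tree \<open>T\<close> without paths. Every set leaves \<open>T\<close>, possibly
  arbitrarily late, so that sets can code total functions. Let the recursion produce, together with
  each value, such a code of a bound for a witness of the value. In an arbitrary set \<open>Z\<close> an error is
  then a \<open>\<Sigma>\<^sub>1\<close> event, and the search for a witness of \<open>\<phi>\<close>, a witness of \<open>\<psi>\<close> or an earlier error
  always terminates, because a \<open>Z\<close> without earlier errors is a correct hierarchy. Hence WETR
  applies. In its solution an error at \<open>x\<close> entails an error below \<open>x\<close>, so there are none.\<close>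

section \<open>Substitution in formulas\<close>

text \<open>What separates the two schemes is the range of sets at which \<open>\<phi>\<close> and
  \<open>\<psi>\<close> must be complementary: \<open>SETR\<close> promises this at correct
  hierarchies only. A stored value can be wrong merely because no witness exists, a Pi_1 condition
  that no search detects; a stored bound for the witness turns this into a finite check. The
  obstacle is that such a number must be readable from every set. The plain code by a least element
  is undefined at the empty set, whereas an exit from \<open>T\<close> is always defined, and since
  \<open>T\<close> is infinite the exits have no upper limit. Under WKL no such code exists, because
  compactness bounds every total reading uniformly; this is why the two cases need different
  arguments.

  The other constraint is the model: its numbers may be nonstandard, with induction for Sigma_1
  formulas and comprehension for Delta_1 conditions only. Each induction, each least element and
  each formation of a set therefore carries a definability proof, and finite objects are handled
  through codes with explicit bounds, so that quantification over them stays decidable.\<close>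

fun tm_subst :: "(nat \<Rightarrow> tm) \<Rightarrow> tm \<Rightarrow> tm" where
  "tm_subst \<tau> (Var i) = \<tau> i"
| "tm_subst \<tau> Zero = Zero"
| "tm_subst \<tau> One = One"
| "tm_subst \<tau> (Plus t u) = Plus (tm_subst \<tau> t) (tm_subst \<tau> u)"
| "tm_subst \<tau> (Times t u) = Times (tm_subst \<tau> t) (tm_subst \<tau> u)"

fun fm_vars :: "fm \<Rightarrow> nat set" where
  "fm_vars (Eq t u) = tm_vars t \<union> tm_vars u"
| "fm_vars (Less t u) = tm_vars t \<union> tm_vars u"
| "fm_vars (Mem t k) = tm_vars t"
| "fm_vars (Neg p) = fm_vars p"
| "fm_vars (Conj p q) = fm_vars p \<union> fm_vars q"
| "fm_vars (Disj p q) = fm_vars p \<union> fm_vars q"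
| "fm_vars (Imp p q) = fm_vars p \<union> fm_vars q"
| "fm_vars (AllN i p) = insert i (fm_vars p)"
| "fm_vars (ExN i p) = insert i (fm_vars p)"
| "fm_vars (AllS k p) = fm_vars p"
| "fm_vars (ExS k p) = fm_vars p"

lemma finite_tm_vars [simp]: "finite (tm_vars t)"
  by (induction t) auto

lemma finite_fm_vars [simp]: "finite (fm_vars p)"
  by (induction p) auto

lemma tm_val_subst: "tm_val M e (tm_subst \<tau> t) = tm_val M (\<lambda>i. tm_val M e (\<tau> i)) t"
  by (induction t) auto

lemma tm_vars_subst: "tm_vars (tm_subst \<tau> t) = (\<Union>v\<in>tm_vars t. tm_vars (\<tau> v))"
  by (induction t) auto

lemma tm_val_cong: "(\<And>v. v \<in> tm_vars t \<Longrightarrow> e v = e' v) \<Longrightarrow> tm_val M e t = tm_val M e' t"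
  by (induction t) auto

lemma tm_val_upd [simp]: "i \<notin> tm_vars t \<Longrightarrow> tm_val M (e(i := a)) t = tm_val M e t"
  by (rule tm_val_cong) auto

lemma sat_cong: "(\<And>v. v \<in> fm_vars p \<Longrightarrow> e v = e' v) \<Longrightarrow> sat M e s p = sat M e' s p"
proof (induction p arbitrary: e e' s)
  case (Eq t u)
  have "tm_val M e t = tm_val M e' t" "tm_val M e u = tm_val M e' u"
    by (rule tm_val_cong; use Eq in simp)+
  then show ?case by simp
next
  case (Less t u)
  have "tm_val M e t = tm_val M e' t" "tm_val M e u = tm_val M e' u"
    by (rule tm_val_cong; use Less in simp)+
  then show ?case by simp
next
  case (Mem t u)
  have "tm_val M e t = tm_val M e' t"
    by (rule tm_val_cong; use Mem in simp)+
  then show ?case by simp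
next
  case (Neg p)
  have "sat M e s p = sat M e' s p"
    using Neg.prems by (auto intro!: Neg.IH)
  then show ?case by simp
next
  case (Conj p q)
  have "sat M e s p = sat M e' s p" "sat M e s q = sat M e' s q"
    using Conj.prems by (auto intro!: Conj.IH)
  then show ?case by simp
next
  case (Disj p q)
  have "sat M e s p = sat M e' s p" "sat M e s q = sat M e' s q"
    using Disj.prems by (auto intro!: Disj.IH)
  then show ?case by simp
next
  case (Imp p q)
  have "sat M e s p = sat M e' s p" "sat M e s q = sat M e' s q"
    using Imp.prems by (auto intro!: Imp.IH)
  then show ?case by simp
next
  case (AllN i p)
  have "sat M (e(i := a)) s p = sat M (e'(i := a)) s p" for a
    using AllN.prems by (auto intro!: AllN.IH)
  then show ?case by simp
next
  case (ExN i p)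
  have "sat M (e(i := a)) s p = sat M (e'(i := a)) s p" for a
    using ExN.prems by (auto intro!: ExN.IH)
  then show ?case by simp
next
  case (AllS k p)
  have "sat M e (s(k := A)) p = sat M e' (s(k := A)) p" for A
    using AllS.prems by (auto intro!: AllS.IH)
  then show ?case by simp
next
  case (ExS k p)
  have "sat M e (s(k := A)) p = sat M e' (s(k := A)) p" for A
    using ExS.prems by (auto intro!: ExS.IH)
  then show ?case by simp
qed

lemma fresh_var: "finite A \<Longrightarrow> \<exists>j::nat. j \<notin> A"
  by (rule ex_new_if_finite) simp_all

text \<open>Capture avoidance: \<open>j\<close> may replace the bound variable \<open>i\<close> as
  soon as no term substituted for another variable of \<open>p\<close> mentions
  \<open>j\<close>.\<close>

lemma subst_upd:
  assumes "\<And>v. v \<in> fm_vars p \<Longrightarrow> v \<noteq> i \<Longrightarrow> j \<notin> tm_vars (\<tau> v)"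
  shows "sat M (\<lambda>v. tm_val M (e(j := a)) ((\<tau>(i := Var j)) v)) s p
    \<longleftrightarrow> sat M ((\<lambda>v. tm_val M e (\<tau> v))(i := a)) s p"
  by (rule sat_cong) (use assms in auto)

text \<open>The substituted formula is only claimed to exist, which leaves the quantifier cases free
  to choose a bound variable fresh for all substituted terms. Number variables are replaced by
  terms, set variables are merely renamed by \<open>g\<close>.\<close>

lemma bounded_subst:
  assumes "bounded_fm p"
  shows "\<exists>p'. bounded_fm p' \<and>
    (\<forall>e s. sat M e s p' \<longleftrightarrow> sat M (\<lambda>i. tm_val M e (\<tau> i)) (\<lambda>k. s (g k)) p)"
  using assms
proof (induction arbitrary: \<tau> rule: bounded_fm.induct)
  case (1 t u)
  show ?case by (rule exI[of _ "Eq (tm_subst \<tau> t) (tm_subst \<tau> u)"])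
      (simp add: bounded_fm.intros tm_val_subst)
next
  case (2 t u)
  show ?case by (rule exI[of _ "Less (tm_subst \<tau> t) (tm_subst \<tau> u)"])
      (simp add: bounded_fm.intros tm_val_subst)
next
  case (3 t k)
  show ?case by (rule exI[of _ "Mem (tm_subst \<tau> t) (g k)"])
      (simp add: bounded_fm.intros tm_val_subst)
next
  case (4 p)
  obtain p' where "bounded_fm p'"
    "\<forall>e s. sat M e s p' \<longleftrightarrow> sat M (\<lambda>i. tm_val M e (\<tau> i)) (\<lambda>k. s (g k)) p"
    using 4 by blast
  then show ?case by (intro exI[of _ "Neg p'"]) (simp add: bounded_fm.intros)
next
  case (5 p q)
  obtain p' where "bounded_fm p'"
    "\<forall>e s. sat M e s p' \<longleftrightarrow> sat M (\<lambda>i. tm_val M e (\<tau> i)) (\<lambda>k. s (g k)) p"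
    using 5 by blast
  moreover obtain q' where "bounded_fm q'"
    "\<forall>e s. sat M e s q' \<longleftrightarrow> sat M (\<lambda>i. tm_val M e (\<tau> i)) (\<lambda>k. s (g k)) q"
    using 5 by blast
  ultimately show ?case by (intro exI[of _ "Conj p' q'"]) (simp add: bounded_fm.intros)
next
  case (6 p q)
  obtain p' where "bounded_fm p'"
    "\<forall>e s. sat M e s p' \<longleftrightarrow> sat M (\<lambda>i. tm_val M e (\<tau> i)) (\<lambda>k. s (g k)) p"
    using 6 by blast
  moreover obtain q' where "bounded_fm q'"
    "\<forall>e s. sat M e s q' \<longleftrightarrow> sat M (\<lambda>i. tm_val M e (\<tau> i)) (\<lambda>k. s (g k)) q"
    using 6 by blast
  ultimately show ?case by (intro exI[of _ "Disj p' q'"]) (simp add: bounded_fm.intros)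
next
  case (7 p q)
  obtain p' where "bounded_fm p'"
    "\<forall>e s. sat M e s p' \<longleftrightarrow> sat M (\<lambda>i. tm_val M e (\<tau> i)) (\<lambda>k. s (g k)) p"
    using 7 by blast
  moreover obtain q' where "bounded_fm q'"
    "\<forall>e s. sat M e s q' \<longleftrightarrow> sat M (\<lambda>i. tm_val M e (\<tau> i)) (\<lambda>k. s (g k)) q"
    using 7 by blast
  ultimately show ?case by (intro exI[of _ "Imp p' q'"]) (simp add: bounded_fm.intros)
next
  case (8 p i t)
  obtain j where j: "j \<notin> (\<Union>v\<in>fm_vars p \<union> tm_vars t. tm_vars (\<tau> v))"
    using fresh_var[of "\<Union>v\<in>fm_vars p \<union> tm_vars t. tm_vars (\<tau> v)"] by auto
  obtain p' where p': "bounded_fm p'" "\<forall>e s. sat M e s p' \<longleftrightarrow>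
    sat M (\<lambda>v. tm_val M e ((\<tau>(i := Var j)) v)) (\<lambda>k. s (g k)) p"
    using 8 by blast
  have "sat M (e(j := a)) s p' \<longleftrightarrow>
      sat M ((\<lambda>v. tm_val M e (\<tau> v))(i := a)) (\<lambda>k. s (g k)) p" for e s a
    unfolding p'(2)[rule_format] by (rule subst_upd) (use j in blast)
  moreover define t' where "t' = tm_subst \<tau> t"
  have j': "j \<notin> tm_vars t'"
    using j by (auto simp: tm_vars_subst t'_def)
  moreover have "tm_val M (e(j := a)) t' = tm_val M (\<lambda>i. tm_val M e (\<tau> i)) t" for e a
    unfolding tm_val_upd[OF j'] unfolding t'_def by (rule tm_val_subst)
  ultimately show ?case using p'(1) 8
    by (intro exI[of _ "AllN j (Imp (Less (Var j) t') p')"])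
      (simp add: bounded_fm.intros tm_val_upd[OF \<open>i \<notin> tm_vars t\<close>] del: tm_val_upd)
next
  case (9 p i t)
  obtain j where j: "j \<notin> (\<Union>v\<in>fm_vars p \<union> tm_vars t. tm_vars (\<tau> v))"
    using fresh_var[of "\<Union>v\<in>fm_vars p \<union> tm_vars t. tm_vars (\<tau> v)"] by auto
  obtain p' where p': "bounded_fm p'" "\<forall>e s. sat M e s p' \<longleftrightarrow>
    sat M (\<lambda>v. tm_val M e ((\<tau>(i := Var j)) v)) (\<lambda>k. s (g k)) p"
    using 9 by blast
  have "sat M (e(j := a)) s p' \<longleftrightarrow>
      sat M ((\<lambda>v. tm_val M e (\<tau> v))(i := a)) (\<lambda>k. s (g k)) p" for e s a
    unfolding p'(2)[rule_format] by (rule subst_upd) (use j in blast)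
  moreover define t' where "t' = tm_subst \<tau> t"
  have j': "j \<notin> tm_vars t'"
    using j by (auto simp: tm_vars_subst t'_def)
  moreover have "tm_val M (e(j := a)) t' = tm_val M (\<lambda>i. tm_val M e (\<tau> i)) t" for e a
    unfolding tm_val_upd[OF j'] unfolding t'_def by (rule tm_val_subst)
  ultimately show ?case using p'(1) 9
    by (intro exI[of _ "ExN j (Conj (Less (Var j) t') p')"])
      (simp add: bounded_fm.intros tm_val_upd[OF \<open>i \<notin> tm_vars t\<close>] del: tm_val_upd)
qed

text \<open>Turns the front position of a de Bruijn context into a named variable \<open>j\<close>,
  which a syntactic quantifier can bind. The set \<open>B\<close> serves to keep \<open>j\<close>
  out of a bounding term.\<close>

lemma bounded_quantify:
  assumes "bounded_fm p" "finite B"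
  shows "\<exists>j p'. j \<notin> B \<and> bounded_fm p' \<and> (\<forall>e s a. sat M (e(j := a)) s p' \<longleftrightarrow>
    sat M (case_nat a (\<lambda>i. tm_val M e (\<tau> i))) s p)"
proof -
  \<comment> \<open>\<open>Zero\<close> is a placeholder; position 0 is overwritten by the variable
    \<open>j\<close>.\<close>
  let ?\<tau> = "case_nat Zero \<tau>"
  obtain j where j: "j \<notin> (\<Union>v\<in>fm_vars p. tm_vars (?\<tau> v)) \<union> B"
    using fresh_var[of "(\<Union>v\<in>fm_vars p. tm_vars (?\<tau> v)) \<union> B"] assms by auto
  obtain p' where p': "bounded_fm p'" "\<forall>e s. sat M e s p' \<longleftrightarrow>
    sat M (\<lambda>v. tm_val M e ((?\<tau>(0 := Var j)) v)) s p"
    using bounded_subst[OF assms(1), of M "?\<tau>(0 := Var j)" "\<lambda>k. k"] by auto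
  have "sat M (e(j := a)) s p' \<longleftrightarrow> sat M (case_nat a (\<lambda>i. tm_val M e (\<tau> i))) s p" for e s a
  proof -
    have "(\<lambda>v. tm_val M e (?\<tau> v))(0 := a) = case_nat a (\<lambda>i. tm_val M e (\<tau> i))"
      by (rule ext) (simp split: nat.split)
    then show ?thesis
      using subst_upd[of p 0 j ?\<tau> M e a s] j unfolding p'(2)[rule_format] by simp
  qed
  then show ?thesis using p'(1) j by (intro exI[of _ j] exI[of _ p']) simp
qed

section \<open>Context and parameters in one valuation\<close>

definition interleave :: "(nat \<Rightarrow> 'a) \<Rightarrow> (nat \<Rightarrow> 'a) \<Rightarrow> nat \<Rightarrow> 'a" where
  "interleave f g k = (if even k then f (k div 2) else g (k div 2))"

lemma interleave_simps [simp]: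
  "interleave f g 0 = f 0" "interleave f g (2 * k) = f k" "interleave f g (Suc (2 * k)) = g k"
  by (simp_all add: interleave_def)

lemma interleave_Suc_4 [simp]: "interleave f g (Suc (4 * k)) = g (2 * k)"
  using interleave_simps(3)[of f g "2 * k"] by simp

lemma tm_val_interleave: "(\<lambda>k. tm_val M e (interleave f g k)) =
    interleave (\<lambda>k. tm_val M e (f k)) (\<lambda>k. tm_val M e (g k))"
  by (rule ext) (simp add: interleave_def)

lemma range_interleave [simp]: "range (interleave f g) = range f \<union> range g"
proof -
  have "f k \<in> range (interleave f g)" "g k \<in> range (interleave f g)" for k
    using rangeI[of "interleave f g" "2 * k"] rangeI[of "interleave f g" "Suc (2 * k)"] by auto
  moreover have "interleave f g k \<in> range f \<union> range g" for k
    by (simp add: interleave_def)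
  ultimately show ?thesis by blast
qed

lemma case_nat_case_nat: "(\<lambda>k. case_nat b h (case_nat a f k)) =
    case_nat (case_nat b h a) (\<lambda>k. case_nat b h (f k))"
  by (rule ext) (simp split: nat.split)

lemma bounded_quantify_interleave:
  assumes "bounded_fm p" "finite B"
  shows "\<exists>j p'. j \<notin> B \<and> bounded_fm p' \<and> (\<forall>e s a. sat M (e(j := a)) s p' \<longleftrightarrow>
    sat M (interleave (case_nat a (\<lambda>i. tm_val M e (\<tau> i))) (\<lambda>i. tm_val M e (\<pi> i))) s p)"
proof -
  \<comment> \<open>Pushing \<open>a\<close> in front shifts all positions by one and so exchanges
    the parities: the odd positions of \<open>\<rho>\<close> feed the context, the even ones the
    parameters.\<close>
  define \<rho> where "\<rho> = (\<lambda>i. if odd i then \<tau> (i div 2) else \<pi> (i div 2))"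
  have "case_nat a (\<lambda>i. tm_val M e (\<rho> i)) =
      interleave (case_nat a (\<lambda>i. tm_val M e (\<tau> i))) (\<lambda>i. tm_val M e (\<pi> i))" for a e
  proof (rule ext)
    fix k
    show "case_nat a (\<lambda>i. tm_val M e (\<rho> i)) k =
      interleave (case_nat a (\<lambda>i. tm_val M e (\<tau> i))) (\<lambda>i. tm_val M e (\<pi> i)) k"
    proof (cases k)
      case (Suc i)
      show ?thesis
      proof (cases "even i")
        case False
        then obtain r where "i = Suc (2 * r)" by (auto elim: oddE)
        moreover have "interleave (case_nat a f) g (2 * Suc r) = f r" for f g :: "nat \<Rightarrow> 'a"
          by (subst interleave_simps) simp
        ultimately show ?thesis using Suc by (simp add: \<rho>_def)
      qed (use Suc in \<open>auto simp: \<rho>_def interleave_def\<close>)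
    qed simp
  qed
  then show ?thesis
    using bounded_quantify[OF assms, of M \<rho>] by simp
qed

locale rca0 =
  fixes M :: "'m l2_structure"
  assumes RCA0: "RCA0 M"
begin

abbreviation add (infixl "\<oplus>" 65) where "a \<oplus> b \<equiv> addM M a b"
abbreviation mul (infixl "\<otimes>" 70) where "a \<otimes> b \<equiv> mulM M a b"
abbreviation ls (infix "\<prec>" 50) where "a \<prec> b \<equiv> lessM M a b"
definition le (infix "\<preceq>" 50) where "a \<preceq> b \<longleftrightarrow> a \<prec> b \<or> a = b"
abbreviation zero ("\<zero>") where "\<zero> \<equiv> zeroM M"
abbreviation one ("\<one>") where "\<one> \<equiv> oneM M"
abbreviation pr where "pr \<equiv> pairM M"
abbreviation Sets where "Sets \<equiv> SetsOf M"

section \<open>Definable relations\<close>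

text \<open>Relations depend on a stream of numbers, read as a de Bruijn context, and on one set.
  Formulas read the context at the even variables and their parameters at the odd ones; arbitrary
  set parameters follow the set variable 0.\<close>

definition Tm :: "((nat \<Rightarrow> 'm) \<Rightarrow> 'm) \<Rightarrow> bool" where
  "Tm f \<longleftrightarrow> (\<exists>t par. \<forall>e. tm_val M (interleave e par) t = f e)"

definition Bdd :: "((nat \<Rightarrow> 'm) \<Rightarrow> 'm set \<Rightarrow> bool) \<Rightarrow> bool" where
  "Bdd R \<longleftrightarrow> (\<exists>p par sp. bounded_fm p \<and> range sp \<subseteq> Sets \<and>
    (\<forall>e. \<forall>Z\<in>Sets. sat M (interleave e par) (case_nat Z sp) p \<longleftrightarrow> R e Z))"

definition Sig :: "((nat \<Rightarrow> 'm) \<Rightarrow> 'm set \<Rightarrow> bool) \<Rightarrow> bool" where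
  "Sig R \<longleftrightarrow> (\<exists>R0. Bdd R0 \<and> (\<forall>e. \<forall>Z\<in>Sets. R e Z \<longleftrightarrow> (\<exists>a. R0 (case_nat a e) Z)))"

definition Del :: "((nat \<Rightarrow> 'm) \<Rightarrow> 'm set \<Rightarrow> bool) \<Rightarrow> bool" where
  "Del R \<longleftrightarrow> Sig R \<and> Sig (\<lambda>e Z. \<not> R e Z)"

text \<open>A Sigma_1 graph is enough: \<open>f\<close> is total, so the complement of the graph is
  Sigma_1 too.\<close>

definition Fn :: "((nat \<Rightarrow> 'm) \<Rightarrow> 'm set \<Rightarrow> 'm) \<Rightarrow> bool" where
  "Fn f \<longleftrightarrow> Sig (\<lambda>e Z. f (\<lambda>i. e (Suc i)) Z = e 0)"

lemma Sets_ex: "\<exists>A. A \<in> Sets"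
  using RCA0 unfolding RCA0_def by auto

lemma Bdd_cong: "Bdd R \<Longrightarrow> (\<And>e Z. Z \<in> Sets \<Longrightarrow> R e Z = R' e Z) \<Longrightarrow> Bdd R'"
  unfolding Bdd_def by simp

lemma Sig_cong: "Sig R \<Longrightarrow> (\<And>e Z. Z \<in> Sets \<Longrightarrow> R e Z = R' e Z) \<Longrightarrow> Sig R'"
  unfolding Sig_def by simp

lemma Del_cong: "Del R \<Longrightarrow> (\<And>e Z. Z \<in> Sets \<Longrightarrow> R e Z = R' e Z) \<Longrightarrow> Del R'"
  unfolding Del_def using Sig_cong[of R R'] Sig_cong[of "\<lambda>e Z. \<not> R e Z" "\<lambda>e Z. \<not> R' e Z"] by simp

lemma BddE:
  assumes "Bdd R"
  obtains p par sp where "bounded_fm p" "range sp \<subseteq> Sets"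
    "\<forall>e. \<forall>Z\<in>Sets. sat M (interleave e par) (case_nat Z sp) p \<longleftrightarrow> R e Z"
  using assms unfolding Bdd_def by (elim exE conjE) (rule that)

text \<open>Brings two relations onto common parameters, by interleaving both their number
  parameters and, behind the set variable 0, their set parameters. Connectives that join two
  relations rest on this.\<close>

lemma Bdd_pair:
  assumes "Bdd R" "Bdd R'"
  shows "\<exists>p q par sp. bounded_fm p \<and> bounded_fm q \<and> range sp \<subseteq> Sets \<and>
    (\<forall>e. \<forall>Z\<in>Sets. sat M (interleave e par) (case_nat Z sp) p \<longleftrightarrow> R e Z) \<and>
    (\<forall>e. \<forall>Z\<in>Sets. sat M (interleave e par) (case_nat Z sp) q \<longleftrightarrow> R' e Z)"
proof -
  obtain p par sp where p: "bounded_fm p" "range sp \<subseteq> Sets"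
    "\<forall>e. \<forall>Z\<in>Sets. sat M (interleave e par) (case_nat Z sp) p \<longleftrightarrow> R e Z"
    using assms(1) by (rule BddE)
  obtain q par' sp' where q: "bounded_fm q" "range sp' \<subseteq> Sets"
    "\<forall>e. \<forall>Z\<in>Sets. sat M (interleave e par') (case_nat Z sp') q \<longleftrightarrow> R' e Z"
    using assms(2) by (rule BddE)
  obtain p2 where p2: "bounded_fm p2" "\<forall>e s. sat M e s p2 \<longleftrightarrow>
      sat M (\<lambda>i. tm_val M e (interleave (\<lambda>i. Var (2*i)) (\<lambda>i. Var (Suc (2*(2*i)))) i))
       (\<lambda>k. s (case_nat 0 (\<lambda>i. Suc (2*i)) k)) p"
    using bounded_subst[OF p(1), of M "interleave (\<lambda>i. Var (2*i)) (\<lambda>i. Var (Suc (2*(2*i))))"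
        "case_nat 0 (\<lambda>i. Suc (2*i))"] by (elim exE conjE) (rule that)
  obtain q2 where q2: "bounded_fm q2" "\<forall>e s. sat M e s q2 \<longleftrightarrow>
      sat M (\<lambda>i. tm_val M e (interleave (\<lambda>i. Var (2*i)) (\<lambda>i. Var (Suc (2*(Suc (2*i))))) i))
       (\<lambda>k. s (case_nat 0 (\<lambda>i. Suc (Suc (2*i))) k)) q"
    using bounded_subst[OF q(1), of M "interleave (\<lambda>i. Var (2*i)) (\<lambda>i. Var (Suc (2*(Suc (2*i)))))"
        "case_nat 0 (\<lambda>i. Suc (Suc (2*i)))"] by (elim exE conjE) (rule that)
  have "sat M (interleave e (interleave par par')) (case_nat Z (interleave sp sp')) p2 \<longleftrightarrow> R e Z"
    if "Z \<in> Sets" for e Z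
    using p(3) that by (simp add: p2(2) tm_val_interleave case_nat_case_nat del: mult_Suc_right)
  moreover have "sat M (interleave e (interleave par par')) (case_nat Z (interleave sp sp')) q2 \<longleftrightarrow> R' e Z"
    if "Z \<in> Sets" for e Z
    using q(3) that by (simp add: q2(2) tm_val_interleave case_nat_case_nat del: mult_Suc_right)
  ultimately show ?thesis using p2(1) q2(1) p(2) q(2)
    by (intro exI[of _ p2] exI[of _ q2] exI[of _ "interleave par par'"] exI[of _ "interleave sp sp'"])
      simp
qed

lemma Tm_pair:
  assumes "Tm f" "Tm g"
  shows "\<exists>t u par. \<forall>e. tm_val M (interleave e par) t = f e \<and> tm_val M (interleave e par) u = g e"
proof -
  obtain t par where t: "\<forall>e. tm_val M (interleave e par) t = f e" using assms(1) unfolding Tm_def by blast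
  obtain u par' where u: "\<forall>e. tm_val M (interleave e par') u = g e" using assms(2) unfolding Tm_def by blast
  show ?thesis
    using t u by (intro exI[of _ "tm_subst (interleave (\<lambda>i. Var (2*i)) (\<lambda>i. Var (Suc (2*(2*i))))) t"]
       exI[of _ "tm_subst (interleave (\<lambda>i. Var (2*i)) (\<lambda>i. Var (Suc (2*(Suc (2*i)))))) u"]
       exI[of _ "interleave par par'"])
      (simp add: tm_val_subst tm_val_interleave del: mult_Suc_right)
qed

lemma Tm_intros:
  "Tm (\<lambda>e. e i)" "Tm (\<lambda>e. c)"
  "Tm f \<Longrightarrow> Tm g \<Longrightarrow> Tm (\<lambda>e. f e \<oplus> g e)"
  "Tm f \<Longrightarrow> Tm g \<Longrightarrow> Tm (\<lambda>e. f e \<otimes> g e)"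
proof -
  show "Tm (\<lambda>e. e i)" unfolding Tm_def by (rule exI[of _ "Var (2*i)"]) simp
  show "Tm (\<lambda>e. c)" unfolding Tm_def
    by (intro exI[of _ "Var (Suc (2*0))"] exI[of _ "\<lambda>_. c"]) (simp add: interleave_def)
next
  assume fg: "Tm f" "Tm g"
  obtain t u par where *: "\<forall>e. tm_val M (interleave e par) t = f e \<and> tm_val M (interleave e par) u = g e"
    using Tm_pair[OF fg] by blast
  show "Tm (\<lambda>e. f e \<oplus> g e)" unfolding Tm_def using *
    by (intro exI[of _ "Plus t u"] exI[of _ par]) simp
  show "Tm (\<lambda>e. f e \<otimes> g e)" unfolding Tm_def using *
    by (intro exI[of _ "Times t u"] exI[of _ par]) simp
qed

lemma Bdd_atoms:
  assumes "Tm f" "Tm g"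
  shows "Bdd (\<lambda>e Z. f e = g e)" "Bdd (\<lambda>e Z. f e \<prec> g e)"
    "Bdd (\<lambda>e Z. f e \<in> Z)" "A \<in> Sets \<Longrightarrow> Bdd (\<lambda>e Z. f e \<in> A)"
proof -
  obtain t u par where *: "\<forall>e. tm_val M (interleave e par) t = f e \<and> tm_val M (interleave e par) u = g e"
    using Tm_pair[OF assms] by blast
  obtain B where B: "B \<in> Sets" using Sets_ex by blast
  show "Bdd (\<lambda>e Z. f e = g e)" unfolding Bdd_def using * B
    by (intro exI[of _ "Eq t u"] exI[of _ par] exI[of _ "\<lambda>_. B"]) (auto simp: bounded_fm.intros)
  show "Bdd (\<lambda>e Z. f e \<prec> g e)" unfolding Bdd_def using * B
    by (intro exI[of _ "Less t u"] exI[of _ par] exI[of _ "\<lambda>_. B"]) (auto simp: bounded_fm.intros)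
  show "Bdd (\<lambda>e Z. f e \<in> Z)" unfolding Bdd_def using * B
    by (intro exI[of _ "Mem t 0"] exI[of _ par] exI[of _ "\<lambda>_. B"]) (auto simp: bounded_fm.intros)
  show "A \<in> Sets \<Longrightarrow> Bdd (\<lambda>e Z. f e \<in> A)" unfolding Bdd_def using * B
    by (intro exI[of _ "Mem t 1"] exI[of _ par] exI[of _ "\<lambda>_. A"]) (auto simp: bounded_fm.intros)
qed

lemma Bdd_mem:
  assumes "Tm f"
  shows "Bdd (\<lambda>e Z. f e \<in> Z)" "A \<in> Sets \<Longrightarrow> Bdd (\<lambda>e Z. f e \<in> A)"
  using Bdd_atoms(3,4)[OF assms assms] by blast+

lemma Bdd_Neg:
  assumes "Bdd R"
  shows "Bdd (\<lambda>e Z. \<not> R e Z)"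
proof -
  obtain p par sp where p: "bounded_fm p" "range sp \<subseteq> Sets"
    "\<forall>e. \<forall>Z\<in>Sets. sat M (interleave e par) (case_nat Z sp) p \<longleftrightarrow> R e Z"
    using assms by (rule BddE)
  then show ?thesis unfolding Bdd_def
    by (intro exI[of _ "Neg p"] exI[of _ par] exI[of _ sp]) (auto simp: bounded_fm.intros)
qed

lemma Bdd_Conj:
  assumes "Bdd R" "Bdd R'"
  shows "Bdd (\<lambda>e Z. R e Z \<and> R' e Z)"
proof -
  obtain p q par sp where "bounded_fm p" "bounded_fm q" "range sp \<subseteq> Sets"
    "\<forall>e. \<forall>Z\<in>Sets. sat M (interleave e par) (case_nat Z sp) p \<longleftrightarrow> R e Z"
    "\<forall>e. \<forall>Z\<in>Sets. sat M (interleave e par) (case_nat Z sp) q \<longleftrightarrow> R' e Z"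
    using Bdd_pair[OF assms] by blast
  then show ?thesis unfolding Bdd_def
    by (intro exI[of _ "Conj p q"] exI[of _ par] exI[of _ sp]) (simp add: bounded_fm.intros)
qed

lemma Bdd_Disj:
  assumes "Bdd R" "Bdd R'"
  shows "Bdd (\<lambda>e Z. R e Z \<or> R' e Z)"
  by (rule Bdd_cong[OF Bdd_Neg[OF Bdd_Conj[OF Bdd_Neg[OF assms(1)] Bdd_Neg[OF assms(2)]]]]) auto

lemma Bdd_Imp:
  assumes "Bdd R" "Bdd R'"
  shows "Bdd (\<lambda>e Z. R e Z \<longrightarrow> R' e Z)"
  by (rule Bdd_cong[OF Bdd_Neg[OF Bdd_Conj[OF assms(1) Bdd_Neg[OF assms(2)]]]]) auto

lemma Bdd_rename:
  assumes "Bdd R"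
  shows "Bdd (\<lambda>e Z. R (\<lambda>i. e (\<sigma> i)) Z)"
proof -
  obtain p par sp where p: "bounded_fm p" "range sp \<subseteq> Sets"
    "\<forall>e. \<forall>Z\<in>Sets. sat M (interleave e par) (case_nat Z sp) p \<longleftrightarrow> R e Z"
    using assms by (rule BddE)
  obtain p' where p': "bounded_fm p'" "\<forall>e s. sat M e s p' \<longleftrightarrow>
      sat M (\<lambda>i. tm_val M e (interleave (\<lambda>i. Var (2 * \<sigma> i)) (\<lambda>i. Var (Suc (2 * i))) i)) s p"
    using bounded_subst[OF p(1), of M "interleave (\<lambda>i. Var (2 * \<sigma> i)) (\<lambda>i. Var (Suc (2 * i)))" "\<lambda>k. k"] by auto
  show ?thesis unfolding Bdd_def
    using p p' by (intro exI[of _ p'] exI[of _ par] exI[of _ sp]) (simp add: tm_val_interleave)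
qed

lemma Bdd_ball:
  assumes "Bdd (\<lambda>e Z. R (e 0) (\<lambda>i. e (Suc i)) Z)" "Tm f"
  shows "Bdd (\<lambda>e Z. \<forall>x. x \<prec> f e \<longrightarrow> R x e Z)"
proof -
  obtain p par sp where p: "bounded_fm p" "range sp \<subseteq> Sets"
    "\<forall>e. \<forall>Z\<in>Sets. sat M (interleave e par) (case_nat Z sp) p \<longleftrightarrow> R (e 0) (\<lambda>i. e (Suc i)) Z"
    using assms(1) by (rule BddE)
  obtain t par' where t: "\<forall>e. tm_val M (interleave e par') t = f e"
    using assms(2) unfolding Tm_def by blast
  define t' where "t' = tm_subst (interleave (\<lambda>i. Var (2*i)) (\<lambda>i. Var (Suc (2*(Suc (2*i)))))) t"
  have t': "tm_val M (interleave e (interleave par par')) t' = f e" for e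
    unfolding t'_def using t by (simp add: tm_val_subst tm_val_interleave del: mult_Suc_right)
  obtain j p' where p': "j \<notin> tm_vars t'" "bounded_fm p'"
    "\<forall>e s a. sat M (e(j := a)) s p' \<longleftrightarrow> sat M (interleave (case_nat a (\<lambda>i. tm_val M e (Var (2 * i))))
       (\<lambda>i. tm_val M e (Var (Suc (2 * (2 * i)))))) s p"
    using bounded_quantify_interleave[OF p(1), of "tm_vars t'" M "\<lambda>i. Var (2 * i)"
      "\<lambda>i. Var (Suc (2 * (2 * i)))"] by auto
  show ?thesis unfolding Bdd_def
    using p p' t'
    by (intro exI[of _ "AllN j (Imp (Less (Var j) t') p')"] exI[of _ "interleave par par'"] exI[of _ sp])
      (simp add: bounded_fm.intros)
qed

lemma Bdd_bex:
  assumes "Bdd (\<lambda>e Z. R (e 0) (\<lambda>i. e (Suc i)) Z)" "Tm f"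
  shows "Bdd (\<lambda>e Z. \<exists>x. x \<prec> f e \<and> R x e Z)"
  by (rule Bdd_cong[OF Bdd_Neg[OF Bdd_ball[OF Bdd_Neg[OF assms(1)] assms(2)]]]) auto

lemmas Bdd_intros = Tm_intros Bdd_atoms Bdd_Neg Bdd_Conj Bdd_Disj Bdd_Imp Bdd_ball Bdd_bex

lemma Bdd_formula:
  assumes "bounded_fm p" "range sp \<subseteq> Sets"
    "\<forall>e. \<forall>Z\<in>Sets. sat M (interleave e par) (case_nat Z sp) p \<longleftrightarrow> R e Z"
  shows "\<exists>j p'. bounded_fm p' \<and> (\<forall>e a. \<forall>Z\<in>Sets.
    sat M ((interleave e par)(j := a)) (case_nat Z sp) p' \<longleftrightarrow> R (case_nat a e) Z)"
proof -
  obtain j p' where p': "bounded_fm p'"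
    "\<forall>e s a. sat M (e(j := a)) s p' \<longleftrightarrow> sat M (interleave (case_nat a (\<lambda>i. tm_val M e (Var (2 * i))))
       (\<lambda>i. tm_val M e (Var (Suc (2 * i))))) s p"
    using bounded_quantify_interleave[OF assms(1), of "{}" M "\<lambda>i. Var (2 * i)"
      "\<lambda>i. Var (Suc (2 * i))"] by auto
  show ?thesis
    using p' assms(3) by (intro exI[of _ j] exI[of _ p']) simp
qed

text \<open>The axiom schemes update a single variable. Choosing variable 0 makes that update a
  change of the front of the context.\<close>

lemma interleave_upd_0: "(interleave (case_nat c e) par)(0 := n) = interleave (case_nat n e) par"
  by (rule ext) (auto simp: interleave_def split: nat.split)

lemma Sig_induct:
  assumes "Sig (\<lambda>e Z. P (e 0) (\<lambda>i. e (Suc i)) Z)" "Z \<in> Sets"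
    and "P \<zero> e Z" "\<And>n. P n e Z \<Longrightarrow> P (n \<oplus> \<one>) e Z"
  shows "P n e Z"
proof -
  obtain R0 where R0: "Bdd R0" "\<forall>e. \<forall>Z\<in>Sets. P (e 0) (\<lambda>i. e (Suc i)) Z \<longleftrightarrow> (\<exists>a. R0 (case_nat a e) Z)"
    using assms(1) unfolding Sig_def by auto
  obtain p par sp where p: "bounded_fm p" "range sp \<subseteq> Sets"
    "\<forall>e. \<forall>Z\<in>Sets. sat M (interleave e par) (case_nat Z sp) p \<longleftrightarrow> R0 e Z"
    using R0(1) by (rule BddE)
  obtain j p' where p': "bounded_fm p'" "\<forall>e a. \<forall>Z\<in>Sets.
    sat M ((interleave e par)(j := a)) (case_nat Z sp) p' \<longleftrightarrow> R0 (case_nat a e) Z"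
    using Bdd_formula[OF p] by auto
  have sat: "sat M ((interleave (case_nat c e) par)(0 := n)) (case_nat Z sp) (ExN j p') \<longleftrightarrow> P n e Z" for n c
    unfolding interleave_upd_0 using p'(2) R0(2)[rule_format, OF assms(2), of "case_nat n e"] assms(2) by simp
  have "Sigma01 (ExN j p')" using p'(1) unfolding Sigma01_def by auto
  moreover have "range (case_nat Z sp) \<subseteq> Sets"
    using assms(2) p(2) by (auto split: nat.splits simp: subset_iff)
  moreover have "Sigma01_induction M" using RCA0 unfolding RCA0_def by simp
  ultimately show ?thesis
    unfolding Sigma01_induction_def using sat assms(3,4) by metis
qed

text \<open>The Pi_1 form required by the axiom is the negated Sigma_1 form of the
  complement.\<close>

lemma comprehension:
  assumes "Del (\<lambda>e Z. P (e 0) (\<lambda>i. e (Suc i)) Z)" "Z \<in> Sets"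
  shows "{n. P n e Z} \<in> Sets"
proof -
  obtain R where R: "Bdd R" "\<forall>e. \<forall>Z\<in>Sets. P (e 0) (\<lambda>i. e (Suc i)) Z \<longleftrightarrow> (\<exists>a. R (case_nat a e) Z)"
    using assms(1) unfolding Del_def Sig_def by auto
  obtain R' where R': "Bdd R'" "\<forall>e. \<forall>Z\<in>Sets. (\<not> P (e 0) (\<lambda>i. e (Suc i)) Z) \<longleftrightarrow> (\<exists>a. R' (case_nat a e) Z)"
    using assms(1) unfolding Del_def Sig_def by auto
  obtain p q par sp where p: "bounded_fm p" "bounded_fm q" "range sp \<subseteq> Sets"
    "\<forall>e. \<forall>Z\<in>Sets. sat M (interleave e par) (case_nat Z sp) p \<longleftrightarrow> R e Z"
    "\<forall>e. \<forall>Z\<in>Sets. sat M (interleave e par) (case_nat Z sp) q \<longleftrightarrow> R' e Z"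
    using Bdd_pair[OF R(1) R'(1)] by (elim exE conjE) (rule that)
  obtain j p' where p': "bounded_fm p'" "\<forall>e a. \<forall>Z\<in>Sets.
    sat M ((interleave e par)(j := a)) (case_nat Z sp) p' \<longleftrightarrow> R (case_nat a e) Z"
    using Bdd_formula[OF p(1,3,4)] by auto
  obtain k q' where q': "bounded_fm q'" "\<forall>e a. \<forall>Z\<in>Sets.
    sat M ((interleave e par)(k := a)) (case_nat Z sp) q' \<longleftrightarrow> R' (case_nat a e) Z"
    using Bdd_formula[OF p(2,3,5)] by auto
  define E where "E = interleave (case_nat \<zero> e) par"
  have 1: "sat M (E(0 := n)) (case_nat Z sp) (ExN j p') \<longleftrightarrow> P n e Z" for n
    unfolding interleave_upd_0 E_def using p'(2) R(2)[rule_format, OF assms(2), of "case_nat n e"] assms(2) by simp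
  have 2: "sat M (E(0 := n)) (case_nat Z sp) (AllN k (Neg q')) \<longleftrightarrow> P n e Z" for n
    unfolding interleave_upd_0 E_def using q'(2) R'(2)[rule_format, OF assms(2), of "case_nat n e"] assms(2) by auto
  have 3: "Sigma01 (ExN j p')" "Pi01 (AllN k (Neg q'))"
    using p'(1) q'(1) unfolding Sigma01_def Pi01_def by (auto simp: bounded_fm.intros)
  have 4: "range (case_nat Z sp) \<subseteq> Sets"
    using assms(2) p(3) by (auto split: nat.splits simp: subset_iff)
  have "Delta01_comprehension M" using RCA0 unfolding RCA0_def by simp
  then have "{n. sat M (E(0 := n)) (case_nat Z sp) (ExN j p')} \<in> Sets"
    unfolding Delta01_comprehension_def using 1 2 3 4 by metis
  then show ?thesis unfolding 1 .
qed

lemma Sig_Bdd: "Bdd R \<Longrightarrow> Sig R"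
  unfolding Sig_def by (rule exI[of _ "\<lambda>e. R (\<lambda>i. e (Suc i))"]) (simp add: Bdd_rename)

lemma Sig_exB: "Bdd (\<lambda>e Z. R (e 0) (\<lambda>i. e (Suc i)) Z) \<Longrightarrow> Sig (\<lambda>e Z. \<exists>x. R x e Z)"
  unfolding Sig_def by (rule exI[of _ "\<lambda>e Z. R (e 0) (\<lambda>i. e (Suc i)) Z"]) simp

section \<open>Arithmetic\<close>

lemma arith_axioms [simp]:
  "m \<oplus> \<one> \<noteq> \<zero>" "m \<oplus> \<one> = n \<oplus> \<one> \<longleftrightarrow> m = n" "m \<oplus> \<zero> = m"
  "m \<otimes> \<zero> = \<zero>" "\<not> m \<prec> \<zero>" "m \<prec> n \<oplus> \<one> \<longleftrightarrow> m \<preceq> n"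
  and add_Suc: "m \<oplus> (n \<oplus> \<one>) = m \<oplus> n \<oplus> \<one>"
  and mult_Suc: "m \<otimes> (n \<oplus> \<one>) = m \<otimes> n \<oplus> m"
  using RCA0 unfolding RCA0_def basic_axioms_def le_def by metis+

lemma Sig_ind: "Sig (\<lambda>e Z. P (e 0)) \<Longrightarrow> P \<zero> \<Longrightarrow> (\<And>n. P n \<Longrightarrow> P (n \<oplus> \<one>)) \<Longrightarrow> P n"
  using Sig_induct[of "\<lambda>n e Z. P n"] Sets_ex by metis

lemma Bdd_ind: "Bdd (\<lambda>e Z. P (e 0)) \<Longrightarrow> P \<zero> \<Longrightarrow> (\<And>n. P n \<Longrightarrow> P (n \<oplus> \<one>)) \<Longrightarrow> P n"
  using Sig_ind Sig_Bdd by metis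

lemma zero_add [simp]: "\<zero> \<oplus> n = n"
  by (rule Bdd_ind[where P = "\<lambda>n. \<zero> \<oplus> n = n"]; (intro Bdd_intros)?) (auto simp: add_Suc)

lemma Suc_add: "m \<oplus> \<one> \<oplus> n = m \<oplus> n \<oplus> \<one>"
  by (rule Bdd_ind[where P = "\<lambda>n. m \<oplus> \<one> \<oplus> n = m \<oplus> n \<oplus> \<one>"]; (intro Bdd_intros)?) (auto simp: add_Suc)

lemma add_commute: "m \<oplus> n = n \<oplus> m"
  by (rule Bdd_ind[where P = "\<lambda>n. m \<oplus> n = n \<oplus> m"]; (intro Bdd_intros)?) (auto simp: add_Suc Suc_add)

lemma add_assoc: "m \<oplus> n \<oplus> k = m \<oplus> (n \<oplus> k)"
  by (rule Bdd_ind[where P = "\<lambda>k. m \<oplus> n \<oplus> k = m \<oplus> (n \<oplus> k)"]; (intro Bdd_intros)?) (auto simp: add_Suc)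

lemma add_left_commute: "m \<oplus> (n \<oplus> k) = n \<oplus> (m \<oplus> k)"
  by (metis add_assoc add_commute)

lemma zero_mult [simp]: "\<zero> \<otimes> n = \<zero>"
  by (rule Bdd_ind[where P = "\<lambda>n. \<zero> \<otimes> n = \<zero>"]; (intro Bdd_intros)?) (auto simp: mult_Suc)

lemma Suc_mult: "(m \<oplus> \<one>) \<otimes> n = m \<otimes> n \<oplus> n"
  by (rule Bdd_ind[where P = "\<lambda>n. (m \<oplus> \<one>) \<otimes> n = m \<otimes> n \<oplus> n"]; (intro Bdd_intros)?)
    (auto simp: mult_Suc add_assoc add_left_commute add_commute)

lemma mult_commute: "m \<otimes> n = n \<otimes> m"
  by (rule Bdd_ind[where P = "\<lambda>n. m \<otimes> n = n \<otimes> m"]; (intro Bdd_intros)?) (auto simp: mult_Suc Suc_mult)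

lemma mult_one [simp]: "\<one> \<otimes> n = n"
  using Suc_mult[of \<zero> n] by simp

lemma distrib: "(m \<oplus> n) \<otimes> k = m \<otimes> k \<oplus> n \<otimes> k"
  by (rule Bdd_ind[where P = "\<lambda>k. (m \<oplus> n) \<otimes> k = m \<otimes> k \<oplus> n \<otimes> k"]; (intro Bdd_intros)?)
    (auto simp: mult_Suc add_assoc add_left_commute add_commute)

lemma mult_assoc: "m \<otimes> n \<otimes> k = m \<otimes> (n \<otimes> k)"
  by (rule Bdd_ind[where P = "\<lambda>m. m \<otimes> n \<otimes> k = m \<otimes> (n \<otimes> k)"]; (intro Bdd_intros)?)
    (auto simp: Suc_mult distrib)

lemma add_cancel: "a \<oplus> c = b \<oplus> c \<Longrightarrow> a = b"
  by (rule Bdd_ind[where P = "\<lambda>c. a \<oplus> c = b \<oplus> c \<longrightarrow> a = b", rule_format]; (intro Bdd_intros)?) (auto simp: add_Suc)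

lemma less_add: "m \<prec> m \<oplus> (d \<oplus> \<one>)"
  by (rule Bdd_ind[where P = "\<lambda>d. m \<prec> m \<oplus> (d \<oplus> \<one>)"]; (intro Bdd_intros)?) (auto simp: add_Suc le_def)

text \<open>The axioms describe the order by its successor steps only. The difference
  \<open>d\<close> is built up along an induction on \<open>n\<close> whose statement is
  existential, hence Sigma_1.\<close>

lemma less_iff: "m \<prec> n \<longleftrightarrow> (\<exists>d. m \<oplus> (d \<oplus> \<one>) = n)"
proof
  have "\<exists>d. m \<prec> n \<longrightarrow> m \<oplus> (d \<oplus> \<one>) = n"
  proof (rule Sig_ind[where P = "\<lambda>n. \<exists>d. m \<prec> n \<longrightarrow> m \<oplus> (d \<oplus> \<one>) = n"])
    show "Sig (\<lambda>e Z. \<exists>d. m \<prec> e 0 \<longrightarrow> m \<oplus> (d \<oplus> \<one>) = e 0)"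
      by (intro Sig_exB Bdd_intros)
  next
    fix n assume IH: "\<exists>d. m \<prec> n \<longrightarrow> m \<oplus> (d \<oplus> \<one>) = n"
    show "\<exists>d. m \<prec> n \<oplus> \<one> \<longrightarrow> m \<oplus> (d \<oplus> \<one>) = n \<oplus> \<one>"
    proof (cases "m = n")
      case True then show ?thesis by (intro exI[of _ \<zero>]) simp
    next
      case False
      obtain d where "m \<prec> n \<longrightarrow> m \<oplus> (d \<oplus> \<one>) = n" using IH by blast
      then show ?thesis using False
        by (intro exI[of _ "d \<oplus> \<one>"]) (auto simp: le_def add_Suc)
    qed
  qed simp
  then show "m \<prec> n \<Longrightarrow> \<exists>d. m \<oplus> (d \<oplus> \<one>) = n" by (auto simp: le_def)
qed (use less_add in auto)

lemma zero_or_Suc: "d = \<zero> \<or> (\<exists>k. d = k \<oplus> \<one>)"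
proof -
  have "d = \<zero> \<or> \<zero> \<prec> d"
    by (rule Bdd_ind[where P = "\<lambda>d. d = \<zero> \<or> \<zero> \<prec> d"]; (intro Bdd_intros)?) (auto simp: le_def)
  then show ?thesis unfolding less_iff by (metis zero_add)
qed

lemma le_iff: "m \<preceq> n \<longleftrightarrow> (\<exists>d. m \<oplus> d = n)"
proof
  assume "\<exists>d. m \<oplus> d = n"
  then obtain d where "m \<oplus> d = n" by blast
  then show "m \<preceq> n" using zero_or_Suc[of d] by (auto simp: less_iff le_def)
qed (metis le_def less_iff arith_axioms(3))

lemma less_linear: "m \<prec> n \<or> m = n \<or> n \<prec> m"
proof (rule Bdd_ind[where P = "\<lambda>n. m \<prec> n \<or> m = n \<or> n \<prec> m"])
  show "m \<prec> \<zero> \<or> m = \<zero> \<or> \<zero> \<prec> m" using zero_or_Suc[of m] by (auto simp: less_iff le_def)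
  fix n assume "m \<prec> n \<or> m = n \<or> n \<prec> m"
  moreover have "m = n \<oplus> \<one> \<or> n \<oplus> \<one> \<prec> m" if nm: "n \<prec> m"
  proof -
    obtain d where "n \<oplus> (d \<oplus> \<one>) = m" using nm less_iff[of n m] by blast
    then have "n \<oplus> \<one> \<oplus> d = m" by (simp add: add_Suc Suc_add)
    then show ?thesis using le_iff[of "n \<oplus> \<one>" m] by (auto simp: le_def)
  qed
  ultimately show "m \<prec> n \<oplus> \<one> \<or> m = n \<oplus> \<one> \<or> n \<oplus> \<one> \<prec> m" by (auto simp: le_def)
qed (intro Bdd_intros)

lemma less_irrefl: "\<not> a \<prec> a"
proof
  assume "a \<prec> a"
  then obtain d where "a \<oplus> (d \<oplus> \<one>) = a" by (auto simp: less_iff le_def)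
  then have "d \<oplus> \<one> \<oplus> a = \<zero> \<oplus> a" by (simp add: add_commute)
  from add_cancel[OF this] show False by simp
qed

lemma less_trans: "a \<prec> b \<Longrightarrow> b \<prec> c \<Longrightarrow> a \<prec> c"
  unfolding less_iff by (metis add_assoc)

definition minus where "minus a b = (if b \<preceq> a then THE d. b \<oplus> d = a else \<zero>)"

lemma minus_add [simp]: "minus (b \<oplus> d) b = d"
proof -
  have "b \<preceq> b \<oplus> d" unfolding le_iff by blast
  moreover have "(THE d'. b \<oplus> d' = b \<oplus> d) = d"
    by (rule the_equality) (metis add_cancel add_commute)+
  ultimately show ?thesis unfolding minus_def by simp
qed

lemma minus_not_le: "\<not> b \<preceq> a \<Longrightarrow> minus a b = \<zero>"
  unfolding minus_def by simp

lemma add_less_mono: "a \<prec> b \<Longrightarrow> c \<oplus> a \<prec> c \<oplus> b"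
  unfolding less_iff by (metis add_assoc)

lemma mult_less_mono: "a \<prec> b \<Longrightarrow> \<zero> \<prec> c \<Longrightarrow> c \<otimes> a \<prec> c \<otimes> b"
proof -
  assume "a \<prec> b" "\<zero> \<prec> c"
  then obtain d k where "a \<oplus> (d \<oplus> \<one>) = b" "c = k \<oplus> \<one>" unfolding less_iff by auto
  then have "c \<otimes> b = c \<otimes> a \<oplus> (c \<otimes> d \<oplus> k \<oplus> \<one>)"
    by (metis distrib mult_commute mult_one add_assoc)
  then show ?thesis using less_add by simp
qed

lemma minus_cases: "(\<exists>d. a = b \<oplus> d) \<or> minus a b = \<zero> \<and> (\<exists>d. b = a \<oplus> d)"
  using less_linear[of a b] minus_not_le[of b a] le_iff unfolding le_def by metis

lemma minus_ge: "minus a (a \<oplus> d) = \<zero>"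
proof (cases "a = a \<oplus> d")
  case True
  then show ?thesis using minus_add[of a \<zero>] by simp
next
  case False
  have "a \<prec> a \<oplus> d" using False le_iff[of a "a \<oplus> d"] unfolding le_def by auto
  then have "\<not> a \<oplus> d \<preceq> a" using less_trans less_irrefl unfolding le_def by metis
  then show ?thesis by (rule minus_not_le)
qed

text \<open>Makes the library on ordered semirings available for the numbers of the model. The class
  asks for a difference, hence the truncated \<open>minus\<close>.\<close>

sublocale ar: linordered_semidom
  where plus = "addM M" and times = "mulM M" and zero = "zeroM M" and one = "oneM M"
    and minus = minus and less_eq = le and less = "lessM M"
proof unfold_locales
  fix a b c x y z
  show "a \<oplus> b \<oplus> c = a \<oplus> (b \<oplus> c)" "a \<oplus> b = b \<oplus> a" "\<zero> \<oplus> a = a"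
    "a \<otimes> b \<otimes> c = a \<otimes> (b \<otimes> c)" "a \<otimes> b = b \<otimes> a" "\<one> \<otimes> a = a"
    "(a \<oplus> b) \<otimes> c = a \<otimes> c \<oplus> b \<otimes> c" "a \<otimes> (b \<oplus> c) = a \<otimes> b \<oplus> a \<otimes> c" "\<zero> \<otimes> a = \<zero>" "a \<otimes> \<zero> = \<zero>"
    "minus (a \<oplus> b) a = b"
    by (simp_all add: add_assoc mult_assoc distrib) (metis add_commute mult_commute distrib)+
  show "\<zero> \<noteq> \<one>" using arith_axioms(1)[of \<zero>] by simp
  show "minus (minus a b) c = minus a (b \<oplus> c)"
    using minus_cases[of a b] minus_cases[of "minus a b" c]
    by (metis add_assoc minus_add minus_ge add_left_commute add_commute zero_add)
  show "a \<otimes> minus b c = minus (a \<otimes> b) (a \<otimes> c)"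
    using minus_cases[of b c] by (metis distrib mult_commute minus_add minus_ge zero_mult)
  show "x \<prec> y \<longleftrightarrow> x \<preceq> y \<and> \<not> y \<preceq> x" "x \<preceq> x" "x \<preceq> y \<Longrightarrow> y \<preceq> z \<Longrightarrow> x \<preceq> z"
    "x \<preceq> y \<Longrightarrow> y \<preceq> x \<Longrightarrow> x = y" "x \<preceq> y \<or> y \<preceq> x" 
    unfolding le_def using less_linear less_trans less_irrefl by metis+
  show "a \<preceq> b \<Longrightarrow> c \<oplus> a \<preceq> c \<oplus> b" unfolding le_def using add_less_mono by auto
  show "a \<prec> b \<Longrightarrow> \<zero> \<prec> c \<Longrightarrow> c \<otimes> a \<prec> c \<otimes> b" by (rule mult_less_mono)
  show "b \<preceq> a \<Longrightarrow> minus a b \<oplus> b = a"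
    using le_iff[of b a] minus_add add_commute by metis
  show "\<zero> \<prec> \<one>" using less_add[of \<zero> \<zero>] by simp
  show "a \<noteq> \<zero> \<Longrightarrow> b \<noteq> \<zero> \<Longrightarrow> a \<otimes> b \<noteq> \<zero>"
    by (metis zero_or_Suc mult_Suc add_Suc arith_axioms(1))
qed

section \<open>Closure properties\<close>

lemma case_nat_rename: "(\<lambda>k. e (case_nat i f k)) = case_nat (e i) (\<lambda>k. e (f k))"
  by (rule ext) (simp split: nat.split)

lemma Bdd_rename1: "Bdd R \<Longrightarrow> Bdd (\<lambda>e Z. R (case_nat (e i) (\<lambda>k. e (f k))) Z)"
  using Bdd_rename[of R "case_nat i f"] unfolding case_nat_rename .

lemma Bdd_rename2:
  "Bdd R \<Longrightarrow> Bdd (\<lambda>e Z. R (case_nat (e i) (case_nat (e j) (\<lambda>k. e (f k)))) Z)"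
  using Bdd_rename[of R "case_nat i (case_nat j f)"] unfolding case_nat_rename .

lemma SigE:
  assumes "Sig R"
  obtains R0 where "Bdd R0" "\<forall>e Z. Z \<in> Sets \<longrightarrow> R e Z \<longleftrightarrow> (\<exists>a. R0 (case_nat a e) Z)"
  using assms unfolding Sig_def by auto

lemma less_Suc_add: "x \<prec> x \<oplus> a \<oplus> \<one>" "a \<prec> x \<oplus> a \<oplus> \<one>"
  by (simp_all add: le_iff) (metis add_commute)

text \<open>Two unbounded witnesses are replaced by one number above both, which leaves bounded
  quantifiers inside.\<close>

lemma Sig_ex:
  assumes "Sig (\<lambda>e Z. R (e 0) (\<lambda>i. e (Suc i)) Z)"
  shows "Sig (\<lambda>e Z. \<exists>x. R x e Z)"
proof -
  obtain R0 where R0: "Bdd R0" "\<forall>e Z. Z \<in> Sets \<longrightarrow> R (e 0) (\<lambda>i. e (Suc i)) Z \<longleftrightarrow> (\<exists>a. R0 (case_nat a e) Z)"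
    using assms by (rule SigE)
  have eq: "R x e Z \<longleftrightarrow> (\<exists>a. R0 (case_nat a (case_nat x e)) Z)" if "Z \<in> Sets" for x e Z
    using R0(2)[rule_format, OF that, of "case_nat x e"] by simp
  have "Sig (\<lambda>e Z. \<exists>c. \<exists>x. x \<prec> c \<and> (\<exists>a. a \<prec> c \<and> R0 (case_nat a (case_nat x e)) Z))"
    by (intro Sig_exB Bdd_bex Tm_intros Bdd_rename2 R0(1))
  then show ?thesis
    by (rule Sig_cong) (use eq less_Suc_add in blast)
qed

lemma Sig_conj:
  assumes "Sig R" "Sig R'"
  shows "Sig (\<lambda>e Z. R e Z \<and> R' e Z)"
proof -
  obtain R0 where R0: "Bdd R0" "\<forall>e Z. Z \<in> Sets \<longrightarrow> R e Z \<longleftrightarrow> (\<exists>a. R0 (case_nat a e) Z)"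
    using assms(1) by (rule SigE)
  obtain R1 where R1: "Bdd R1" "\<forall>e Z. Z \<in> Sets \<longrightarrow> R' e Z \<longleftrightarrow> (\<exists>a. R1 (case_nat a e) Z)"
    using assms(2) by (rule SigE)
  have "Sig (\<lambda>e Z. \<exists>a b. R0 (case_nat a e) Z \<and> R1 (case_nat b e) Z)"
    by (intro Sig_ex Sig_Bdd Bdd_Conj Bdd_rename1 R0(1) R1(1))
  then show ?thesis by (rule Sig_cong) (simp add: R0(2) R1(2))
qed

lemma Sig_disj:
  assumes "Sig R" "Sig R'"
  shows "Sig (\<lambda>e Z. R e Z \<or> R' e Z)"
proof -
  obtain R0 where R0: "Bdd R0" "\<forall>e Z. Z \<in> Sets \<longrightarrow> R e Z \<longleftrightarrow> (\<exists>a. R0 (case_nat a e) Z)"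
    using assms(1) by (rule SigE)
  obtain R1 where R1: "Bdd R1" "\<forall>e Z. Z \<in> Sets \<longrightarrow> R' e Z \<longleftrightarrow> (\<exists>a. R1 (case_nat a e) Z)"
    using assms(2) by (rule SigE)
  have "Sig (\<lambda>e Z. \<exists>a. R0 (case_nat a e) Z \<or> R1 (case_nat a e) Z)"
    by (intro Sig_ex Sig_Bdd Bdd_Disj Bdd_rename1 R0(1) R1(1))
  then show ?thesis by (rule Sig_cong) (auto simp add: R0(2) R1(2))
qed

lemma Sig_rename:
  assumes "Sig R"
  shows "Sig (\<lambda>e Z. R (\<lambda>i. e (\<sigma> i)) Z)"
proof -
  obtain R0 where R0: "Bdd R0" "\<forall>e Z. Z \<in> Sets \<longrightarrow> R e Z \<longleftrightarrow> (\<exists>a. R0 (case_nat a e) Z)"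
    using assms by (rule SigE)
  have "Sig (\<lambda>e Z. \<exists>a. R0 (case_nat a (\<lambda>i. e (\<sigma> i))) Z)"
    by (intro Sig_exB Bdd_rename1 R0(1))
  then show ?thesis by (rule Sig_cong) (simp add: R0(2))
qed

text \<open>Sigma_1 collection from Sigma_1 induction: since \<open>R\<close> is bounded, the
  existence of a common bound for the witnesses at all \<open>x \<prec> n\<close> is itself Sigma_1.
  The condition \<open>x \<prec> b\<close> stays in the statement because witnesses are only
  guaranteed there.\<close>

lemma Sig_collection:
  assumes "Bdd R" "Z \<in> Sets" "\<forall>x. x \<prec> b \<longrightarrow> (\<exists>a. R (case_nat a (case_nat x e)) Z)"
  shows "\<exists>c. \<forall>x. x \<prec> b \<longrightarrow> (\<exists>a. a \<prec> c \<and> R (case_nat a (case_nat x e)) Z)"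
proof -
  have "\<exists>c. \<forall>x. x \<prec> b \<longrightarrow> x \<prec> b \<longrightarrow> (\<exists>a. a \<prec> c \<and> R (case_nat a (case_nat x e)) Z)"
  proof (rule Sig_induct[where P = "\<lambda>n e Z. \<exists>c. \<forall>x. x \<prec> n \<longrightarrow> x \<prec> b \<longrightarrow>
        (\<exists>a. a \<prec> c \<and> R (case_nat a (case_nat x e)) Z)"])
    show "Sig (\<lambda>e Z. \<exists>c. \<forall>x. x \<prec> e 0 \<longrightarrow> x \<prec> b \<longrightarrow>
        (\<exists>a. a \<prec> c \<and> R (case_nat a (case_nat x (\<lambda>i. e (Suc i)))) Z))"
      by (intro Sig_exB Bdd_ball Bdd_bex Bdd_Imp Bdd_atoms Tm_intros Bdd_rename2 assms(1))
  next
    fix n assume "\<exists>c. \<forall>x. x \<prec> n \<longrightarrow> x \<prec> b \<longrightarrow> (\<exists>a. a \<prec> c \<and> R (case_nat a (case_nat x e)) Z)"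
    then obtain c where c: "\<And>x. x \<prec> n \<Longrightarrow> x \<prec> b \<Longrightarrow> \<exists>a. a \<prec> c \<and> R (case_nat a (case_nat x e)) Z"
      by blast
    obtain d where d: "n \<prec> b \<Longrightarrow> R (case_nat d (case_nat n e)) Z" using assms(3) by blast
    have mono: "a \<prec> c \<Longrightarrow> a \<prec> c \<oplus> d \<oplus> \<one>" for a using less_Suc_add less_trans by blast
    then have "\<exists>a. a \<prec> c \<oplus> d \<oplus> \<one> \<and> R (case_nat a (case_nat x e)) Z"
      if x: "x \<prec> n \<oplus> \<one>" "x \<prec> b" for x
    proof (cases "x = n")
      case True
      then show ?thesis using d x less_Suc_add(2) by (intro exI[of _ d]) auto
    next
      case False
      then have "x \<prec> n" using x unfolding arith_axioms le_def by simp
      then show ?thesis using c[of x] x mono by auto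
    qed
    then show "\<exists>c. \<forall>x. x \<prec> n \<oplus> \<one> \<longrightarrow> x \<prec> b \<longrightarrow> (\<exists>a. a \<prec> c \<and> R (case_nat a (case_nat x e)) Z)"
      by blast
  qed (use assms(2) in auto)
  then show ?thesis by blast
qed

lemma Sig_ball_Tm:
  assumes "Sig (\<lambda>e Z. R (e 0) (\<lambda>i. e (Suc i)) Z)" "Tm f"
  shows "Sig (\<lambda>e Z. \<forall>x. x \<prec> f e \<longrightarrow> R x e Z)"
proof -
  obtain R0 where R0: "Bdd R0" "\<forall>e Z. Z \<in> Sets \<longrightarrow> R (e 0) (\<lambda>i. e (Suc i)) Z \<longleftrightarrow> (\<exists>a. R0 (case_nat a e) Z)"
    using assms(1) by (rule SigE)
  have eq: "R x e Z \<longleftrightarrow> (\<exists>a. R0 (case_nat a (case_nat x e)) Z)" if "Z \<in> Sets" for x e Z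
    using R0(2)[rule_format, OF that, of "case_nat x e"] by simp
  obtain t par where t: "\<forall>e. tm_val M (interleave e par) t = f e" using assms(2) unfolding Tm_def by blast
  have "Tm (\<lambda>e. f (\<lambda>i. e (Suc i)))" unfolding Tm_def using t
    by (intro exI[of _ "tm_subst (interleave (\<lambda>i. Var (2 * Suc i)) (\<lambda>i. Var (Suc (2 * i)))) t"] exI[of _ par])
     (simp add: tm_val_subst tm_val_interleave del: mult_Suc_right)
  then have "Sig (\<lambda>e Z. \<exists>c. \<forall>x. x \<prec> f e \<longrightarrow> (\<exists>a. a \<prec> c \<and> R0 (case_nat a (case_nat x e)) Z))"
    by (intro Sig_exB Bdd_ball Bdd_bex Tm_intros Bdd_rename2 R0(1))
  then show ?thesis
    by (rule Sig_cong) (use eq Sig_collection[OF R0(1)] in blast)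
qed

lemma Sig_subst:
  assumes "Sig (\<lambda>e Z. R (e 0) (\<lambda>i. e (Suc i)) Z)" "Fn f"
  shows "Sig (\<lambda>e Z. R (f e Z) e Z)"
proof -
  have "Sig (\<lambda>e Z. \<exists>y. f e Z = y \<and> R y e Z)"
    by (intro Sig_ex Sig_conj assms(1)) (use assms(2) in \<open>simp add: Fn_def\<close>)
  then show ?thesis by (rule Sig_cong) simp
qed

lemma Fn_rename:
  assumes "Fn f"
  shows "Fn (\<lambda>e Z. f (\<lambda>i. e (\<sigma> i)) Z)"
  using Sig_rename[OF assms[unfolded Fn_def], of "case_nat 0 (\<lambda>i. Suc (\<sigma> i))"]
  unfolding Fn_def by simp

text \<open>The free renaming \<open>\<sigma>\<close> carries the induction: variable
  \<open>n\<close> is moved to the front of the context while the remaining ones are shifted, and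
  \<open>Sig_subst\<close> then removes the front.\<close>

lemma Sig_substs:
  assumes "Sig R" "\<And>k. Fn (F k)"
  shows "Sig (\<lambda>e Z. R (\<lambda>k. if k < n then F k e Z else e (\<sigma> k)) Z)"
  using assms(2)
proof (induction n arbitrary: F \<sigma>)
  case 0
  then show ?case using Sig_rename[OF assms(1)] by simp
next
  case (Suc n)
  have eq: "(\<lambda>k. if k < n then F k (\<lambda>i. e (Suc i)) Z else e (if k = n then 0 else Suc (\<sigma> k))) =
     (\<lambda>k. if k < n then F k (\<lambda>i. e (Suc i)) Z else if k = n then e 0 else e (Suc (\<sigma> k)))" for e Z
    by auto
  have "Sig (\<lambda>e Z. R (\<lambda>k. if k < n then F k (\<lambda>i. e (Suc i)) Z
      else if k = n then e 0 else e (Suc (\<sigma> k))) Z)"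
    using Suc.IH[of "\<lambda>k e Z. F k (\<lambda>i. e (Suc i)) Z" "\<lambda>k. if k = n then 0 else Suc (\<sigma> k)"]
      Fn_rename[OF Suc.prems] unfolding eq by blast
  from Sig_subst[where R = "\<lambda>y e Z. R (\<lambda>k. if k < n then F k e Z
      else if k = n then y else e (\<sigma> k)) Z", OF this Suc.prems[of n]]
  show ?case by (rule Sig_cong) (auto intro!: arg_cong2[of _ _ _ _ R] simp: less_Suc_eq)
qed

lemma Sig_app1: "Sig (\<lambda>e Z. R (e 0) Z) \<Longrightarrow> Fn f \<Longrightarrow> Sig (\<lambda>e Z. R (f e Z) Z)"
  by (rule Sig_subst)

lemma Sig_app2:
  assumes "Sig (\<lambda>e Z. R (e 0) (e 1) Z)" "Fn f" "Fn g"
  shows "Sig (\<lambda>e Z. R (f e Z) (g e Z) Z)"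
  using Sig_substs[OF assms(1), of "\<lambda>k. if k = 0 then f else g" 2 id] assms(2,3) by simp

lemma Sig_app3:
  assumes "Sig (\<lambda>e Z. R (e 0) (e 1) (e 2) Z)" "Fn f" "Fn g" "Fn h"
  shows "Sig (\<lambda>e Z. R (f e Z) (g e Z) (h e Z) Z)"
  using Sig_substs[OF assms(1), of "\<lambda>k. if k = 0 then f else if k = 1 then g else h" 3 id] assms(2-) by simp

lemma Del_app1: "Del (\<lambda>e Z. R (e 0) Z) \<Longrightarrow> Fn f \<Longrightarrow> Del (\<lambda>e Z. R (f e Z) Z)"
  unfolding Del_def using Sig_app1[of R f] Sig_app1[of "\<lambda>x Z. \<not> R x Z" f] by blast

lemma Del_app2: "Del (\<lambda>e Z. R (e 0) (e 1) Z) \<Longrightarrow> Fn f \<Longrightarrow> Fn g \<Longrightarrow> Del (\<lambda>e Z. R (f e Z) (g e Z) Z)"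
  unfolding Del_def using Sig_app2[of R f g] Sig_app2[of "\<lambda>x y Z. \<not> R x y Z" f g] by blast

lemma Del_app3: "Del (\<lambda>e Z. R (e 0) (e 1) (e 2) Z) \<Longrightarrow> Fn f \<Longrightarrow> Fn g \<Longrightarrow> Fn h \<Longrightarrow>
    Del (\<lambda>e Z. R (f e Z) (g e Z) (h e Z) Z)"
  unfolding Del_def using Sig_app3[of R f g h] Sig_app3[of "\<lambda>x y z Z. \<not> R x y z Z" f g h] by blast

lemma Del_Bdd: "Bdd R \<Longrightarrow> Del R"
  unfolding Del_def by (intro conjI Sig_Bdd Bdd_Neg)

lemma Del_Sig: "Del R \<Longrightarrow> Sig R"
  unfolding Del_def by simp

lemma Del_rename: "Del R \<Longrightarrow> Del (\<lambda>e Z. R (\<lambda>i. e (\<sigma> i)) Z)"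
  unfolding Del_def using Sig_rename[of R \<sigma>] Sig_rename[of "\<lambda>e Z. \<not> R e Z" \<sigma>] by blast

lemma Del_neg: "Del R \<Longrightarrow> Del (\<lambda>e Z. \<not> R e Z)"
  unfolding Del_def by simp

lemma Del_conj: "Del R \<Longrightarrow> Del R' \<Longrightarrow> Del (\<lambda>e Z. R e Z \<and> R' e Z)"
  unfolding Del_def de_Morgan_conj by (intro conjI Sig_conj Sig_disj) auto

lemma Del_disj: "Del R \<Longrightarrow> Del R' \<Longrightarrow> Del (\<lambda>e Z. R e Z \<or> R' e Z)"
  unfolding Del_def de_Morgan_disj by (intro conjI Sig_conj Sig_disj) auto

lemma Del_imp: "Del R \<Longrightarrow> Del R' \<Longrightarrow> Del (\<lambda>e Z. R e Z \<longrightarrow> R' e Z)"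
  unfolding imp_conv_disj by (intro Del_disj Del_neg)

lemma Del_iff: "Del R \<Longrightarrow> Del R' \<Longrightarrow> Del (\<lambda>e Z. R e Z \<longleftrightarrow> R' e Z)"
  unfolding iff_conv_conj_imp by (intro Del_conj Del_imp)

lemma Del_const: "Del (\<lambda>e Z. c)"
proof -
  have "Bdd (\<lambda>e Z. \<zero> = (if c then \<zero> else \<one>))" by (intro Bdd_intros)
  then show ?thesis using Del_Bdd arith_axioms(1)[of \<zero>] by (cases c) auto
qed

lemma Fn_var: "Fn (\<lambda>e Z. e k)"
  unfolding Fn_def by (intro Sig_Bdd Bdd_intros)

lemma Fn_const: "Fn (\<lambda>e Z. c)"
  unfolding Fn_def by (intro Sig_Bdd Bdd_intros)

lemma Fn_app2:
  assumes "Fn (\<lambda>e Z. F (e 0) (e 1) Z)" "Fn f" "Fn g"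
  shows "Fn (\<lambda>e Z. F (f e Z) (g e Z) Z)"
proof -
  have "Sig (\<lambda>e Z. F (e 0) (e 1) Z = e 2)"
    using Sig_rename[OF assms(1)[unfolded Fn_def], of "\<lambda>k. if k = 0 then 2 else k - 1"] by simp
  from Sig_app3[of "\<lambda>x y z Z. F x y Z = z", OF this Fn_rename[OF assms(2)] Fn_rename[OF assms(3)] Fn_var]
  show ?thesis unfolding Fn_def by simp
qed

lemma Fn_app1: "Fn (\<lambda>e Z. F (e 0) Z) \<Longrightarrow> Fn f \<Longrightarrow> Fn (\<lambda>e Z. F (f e Z) Z)"
  using Fn_app2[of "\<lambda>x y. F x" f f] by simp

lemma Fn_add: "Fn f \<Longrightarrow> Fn g \<Longrightarrow> Fn (\<lambda>e Z. f e Z \<oplus> g e Z)"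
  by (rule Fn_app2) (unfold Fn_def, intro Sig_Bdd Bdd_intros)

lemma Fn_mult: "Fn f \<Longrightarrow> Fn g \<Longrightarrow> Fn (\<lambda>e Z. f e Z \<otimes> g e Z)"
  by (rule Fn_app2) (unfold Fn_def, intro Sig_Bdd Bdd_intros)

lemma Fn_pair: "Fn f \<Longrightarrow> Fn g \<Longrightarrow> Fn (\<lambda>e Z. pr (f e Z) (g e Z))"
  unfolding pairM_def by (intro Fn_add Fn_mult)

lemma Fn_if:
  assumes "Del R" "Fn f" "Fn g"
  shows "Fn (\<lambda>e Z. if R e Z then f e Z else g e Z)"
proof -
  have "Sig (\<lambda>e Z. R (\<lambda>i. e (Suc i)) Z \<and> f (\<lambda>i. e (Suc i)) Z = e 0 \<or>
      \<not> R (\<lambda>i. e (Suc i)) Z \<and> g (\<lambda>i. e (Suc i)) Z = e 0)"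
    using assms(2,3) Del_rename[OF assms(1), of Suc] unfolding Fn_def Del_def
    by (intro Sig_disj Sig_conj) auto
  then show ?thesis unfolding Fn_def by (rule Sig_cong) auto
qed

lemma Del_eq: "Fn f \<Longrightarrow> Fn g \<Longrightarrow> Del (\<lambda>e Z. f e Z = g e Z)"
  by (rule Del_app2) (intro Del_Bdd Bdd_intros)

lemma Del_less: "Fn f \<Longrightarrow> Fn g \<Longrightarrow> Del (\<lambda>e Z. f e Z \<prec> g e Z)"
  by (rule Del_app2) (intro Del_Bdd Bdd_intros)

lemma Del_le: "Fn f \<Longrightarrow> Fn g \<Longrightarrow> Del (\<lambda>e Z. f e Z \<preceq> g e Z)"
  unfolding le_def by (intro Del_disj Del_less Del_eq)

lemma Del_memZ: "Fn f \<Longrightarrow> Del (\<lambda>e Z. f e Z \<in> Z)"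
  by (rule Del_app1) (intro Del_Bdd Bdd_mem Tm_intros)

lemma Del_memA: "A \<in> Sets \<Longrightarrow> Fn f \<Longrightarrow> Del (\<lambda>e Z. f e Z \<in> A)"
  by (rule Del_app1) (intro Del_Bdd Bdd_mem Tm_intros)

lemma Sig_ball:
  assumes "Sig (\<lambda>e Z. R (e 0) (\<lambda>i. e (Suc i)) Z)" "Fn f"
  shows "Sig (\<lambda>e Z. \<forall>x. x \<prec> f e Z \<longrightarrow> R x e Z)"
proof (rule Sig_subst[OF _ assms(2)])
  have "Sig (\<lambda>e Z. R (e 0) (\<lambda>i. e (Suc (Suc i))) Z)"
    using Sig_rename[OF assms(1), of "\<lambda>k. if k = 0 then 0 else Suc k"] by simp
  then show "Sig (\<lambda>e Z. \<forall>x. x \<prec> e 0 \<longrightarrow> R x (\<lambda>i. e (Suc i)) Z)"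
    by (intro Sig_ball_Tm Tm_intros)
qed

lemma Sig_bex:
  assumes "Sig (\<lambda>e Z. R (e 0) (\<lambda>i. e (Suc i)) Z)" "Fn f"
  shows "Sig (\<lambda>e Z. \<exists>x. x \<prec> f e Z \<and> R x e Z)"
  by (intro Sig_ex Sig_conj assms(1) Del_Sig[OF Del_less] Fn_var Fn_rename[OF assms(2)])

lemma Del_ball:
  assumes "Del (\<lambda>e Z. R (e 0) (\<lambda>i. e (Suc i)) Z)" "Fn f"
  shows "Del (\<lambda>e Z. \<forall>x. x \<prec> f e Z \<longrightarrow> R x e Z)"
  using Sig_ball[of R f] Sig_bex[of "\<lambda>x e Z. \<not> R x e Z" f] assms unfolding Del_def by simp

lemma Del_bex:
  assumes "Del (\<lambda>e Z. R (e 0) (\<lambda>i. e (Suc i)) Z)" "Fn f"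
  shows "Del (\<lambda>e Z. \<exists>x. x \<prec> f e Z \<and> R x e Z)"
  using Sig_bex[of R f] Sig_ball[of "\<lambda>x e Z. \<not> R x e Z" f] assms unfolding Del_def by simp

lemma Del_ball_le:
  assumes "Del (\<lambda>e Z. R (e 0) (\<lambda>i. e (Suc i)) Z)" "Fn f"
  shows "Del (\<lambda>e Z. \<forall>x. x \<preceq> f e Z \<longrightarrow> R x e Z)"
  using Del_ball[OF assms(1) Fn_add[OF assms(2) Fn_const[of \<one>]]] by simp

lemma Del_bex_le:
  assumes "Del (\<lambda>e Z. R (e 0) (\<lambda>i. e (Suc i)) Z)" "Fn f"
  shows "Del (\<lambda>e Z. \<exists>x. x \<preceq> f e Z \<and> R x e Z)"
  using Del_bex[OF assms(1) Fn_add[OF assms(2) Fn_const[of \<one>]]] by simp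

section \<open>Uniformly decidable families of sets\<close>

definition DelSet :: "((nat \<Rightarrow> 'm) \<Rightarrow> 'm set \<Rightarrow> 'm set) \<Rightarrow> bool" where
  "DelSet A \<longleftrightarrow> Del (\<lambda>e Z. e 0 \<in> A (\<lambda>i. e (Suc i)) Z)"

lemma Del_mem:
  assumes "DelSet A" "Fn f"
  shows "Del (\<lambda>e Z. f e Z \<in> A e Z)"
  using Sig_subst[of "\<lambda>y e Z. y \<in> A e Z" f] Sig_subst[of "\<lambda>y e Z. y \<notin> A e Z" f] assms
  unfolding Del_def DelSet_def by blast

lemma DelSet_rename: "DelSet A \<Longrightarrow> DelSet (\<lambda>e Z. A (\<lambda>i. e (\<sigma> i)) Z)"
  using Del_rename[of "\<lambda>e Z. e 0 \<in> A (\<lambda>i. e (Suc i)) Z" "case_nat 0 (\<lambda>i. Suc (\<sigma> i))"]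
  unfolding DelSet_def by simp

lemma DelSet_const: "A \<in> Sets \<Longrightarrow> DelSet (\<lambda>e Z. A)"
  unfolding DelSet_def by (intro Del_memA Fn_var)

lemma DelSet_Collect: "Del (\<lambda>e Z. R (e 0) (\<lambda>i. e (Suc i)) Z) \<Longrightarrow> DelSet (\<lambda>e Z. {x. R x e Z})"
  unfolding DelSet_def by simp

lemma DelSet_Sets: "DelSet A \<Longrightarrow> Z \<in> Sets \<Longrightarrow> A e Z \<in> Sets"
  using comprehension[of "\<lambda>x e Z. x \<in> A e Z" Z e] unfolding DelSet_def by simp

lemmas Fn_intros = Fn_var Fn_const Fn_add Fn_mult Fn_pair Fn_if
lemmas Del_intros = Del_neg Del_conj Del_disj Del_imp Del_iff Del_const Del_eq Del_less Del_le
  Del_memZ Del_ball Del_bex Del_ball_le Del_bex_le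

lemma Fn_tm_val: "(\<And>i. Fn (F i)) \<Longrightarrow> Fn (\<lambda>e Z. tm_val M (\<lambda>i. F i e Z) t)"
  by (induction t) (auto intro!: Fn_intros)

text \<open>Formulas have to be evaluated at sets computed from \<open>Z\<close>, such as its
  restrictions, and not only at \<open>Z\<close>. Bounded quantifiers remain decidable because the
  values of their bounding terms are computable.\<close>

lemma Del_sat:
  assumes "bounded_fm p" "\<And>i. Fn (F i)" "\<And>k. DelSet (S k)"
  shows "Del (\<lambda>e Z. sat M (\<lambda>i. F i e Z) (\<lambda>k. S k e Z) p)"
  using assms
proof (induction arbitrary: F S rule: bounded_fm.induct)
  case (8 p i t)
  have "Del (\<lambda>e Z. \<forall>a. a \<prec> tm_val M (\<lambda>v. F v e Z) t \<longrightarrow>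
     sat M (\<lambda>v. if v = i then a else F v e Z) (\<lambda>k. S k e Z) p)"
  proof (intro Del_ball Fn_tm_val "8.prems")
    have "Fn (\<lambda>e Z. if v = i then e 0 else F v (\<lambda>i. e (Suc i)) Z)" for v
      using "8.prems"(1) by (cases "v = i") (simp_all add: Fn_rename Fn_var)
    then show "Del (\<lambda>e Z. sat M (\<lambda>v. if v = i then e 0 else F v (\<lambda>i. e (Suc i)) Z)
        (\<lambda>k. S k (\<lambda>i. e (Suc i)) Z) p)"
      using DelSet_rename[OF "8.prems"(2)] by (rule "8.IH")
  qed
  then show ?case
    unfolding sat.simps tm_val.simps fun_upd_same tm_val_upd[OF \<open>i \<notin> tm_vars t\<close>]
    unfolding fun_upd_def .
next
  case (9 p i t)
  have "Del (\<lambda>e Z. \<exists>a. a \<prec> tm_val M (\<lambda>v. F v e Z) t \<and>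
     sat M (\<lambda>v. if v = i then a else F v e Z) (\<lambda>k. S k e Z) p)"
  proof (intro Del_bex Fn_tm_val "9.prems")
    have "Fn (\<lambda>e Z. if v = i then e 0 else F v (\<lambda>i. e (Suc i)) Z)" for v
      using "9.prems"(1) by (cases "v = i") (simp_all add: Fn_rename Fn_var)
    then show "Del (\<lambda>e Z. sat M (\<lambda>v. if v = i then e 0 else F v (\<lambda>i. e (Suc i)) Z)
        (\<lambda>k. S k (\<lambda>i. e (Suc i)) Z) p)"
      using DelSet_rename[OF "9.prems"(2)] by (rule "9.IH")
  qed
  then show ?case
    unfolding sat.simps tm_val.simps fun_upd_same tm_val_upd[OF \<open>i \<notin> tm_vars t\<close>]
    unfolding fun_upd_def .
qed (simp_all add: Del_intros Del_mem Fn_tm_val)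

section \<open>Least numbers\<close>

definition leastM where "leastM P = (THE m. P m \<and> (\<forall>k. k \<prec> m \<longrightarrow> \<not> P k))"

text \<open>Without a least witness, the absence of witnesses below \<open>n\<close> is preserved by
  successors, and it is a Sigma_1 statement because \<open>P\<close> is decidable.\<close>

lemma least_ex:
  assumes "Del (\<lambda>e Z. P (e 0) (\<lambda>i. e (Suc i)) Z)" "P a e Z" "Z \<in> Sets"
  shows "\<exists>m. P m e Z \<and> (\<forall>k. k \<prec> m \<longrightarrow> \<not> P k e Z)"
proof (rule ccontr)
  assume neg: "\<not> ?thesis"
  have Sig: "Sig (\<lambda>e Z. \<forall>k. k \<prec> e 0 \<longrightarrow> \<not> P k (\<lambda>i. e (Suc i)) Z)"
  proof (intro Sig_ball Fn_var)
    show "Sig (\<lambda>e Z. \<not> P (e 0) (\<lambda>i. e (Suc (Suc i))) Z)"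
      using Del_Sig[OF Del_neg[OF Del_rename[OF assms(1), of "\<lambda>k. if k = 0 then 0 else Suc k"]]] by simp
  qed
  have "\<forall>k. k \<prec> a \<oplus> \<one> \<longrightarrow> \<not> P k e Z"
    by (rule Sig_induct[where P = "\<lambda>n e Z. \<forall>k. k \<prec> n \<longrightarrow> \<not> P k e Z", OF Sig assms(3)])
      (use neg in \<open>auto simp: le_def\<close>)
  then show False using assms(2) by (auto simp: le_def)
qed

lemma leastM_eq: "P m \<Longrightarrow> (\<And>k. k \<prec> m \<Longrightarrow> \<not> P k) \<Longrightarrow> leastM P = m"
  unfolding leastM_def using less_linear by (intro the_equality) blast+

lemma leastM:
  assumes "Del (\<lambda>e Z. P (e 0) (\<lambda>i. e (Suc i)) Z)" "P a e Z" "Z \<in> Sets"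
  shows "P (leastM (\<lambda>x. P x e Z)) e Z" "k \<prec> leastM (\<lambda>x. P x e Z) \<Longrightarrow> \<not> P k e Z"
proof -
  obtain m where m: "P m e Z" "\<forall>k. k \<prec> m \<longrightarrow> \<not> P k e Z"
    using least_ex[OF assms] by blast
  then have "leastM (\<lambda>x. P x e Z) = m" by (intro leastM_eq) auto
  then show "P (leastM (\<lambda>x. P x e Z)) e Z" "k \<prec> leastM (\<lambda>x. P x e Z) \<Longrightarrow> \<not> P k e Z"
    using m by auto
qed

text \<open>Unbounded search is computable once it is total; the second premise demands this for
  every set of the model, which later forces searches to have a way out at arbitrary
  \<open>Z\<close>.\<close>

lemma Fn_leastM:
  assumes "Del (\<lambda>e Z. P (e 0) (\<lambda>i. e (Suc i)) Z)" "\<And>e Z. Z \<in> Sets \<Longrightarrow> \<exists>x. P x e Z"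
  shows "Fn (\<lambda>e Z. leastM (\<lambda>x. P x e Z))"
proof -
  have D: "Del (\<lambda>e Z. P (e 0) (\<lambda>i. e (Suc (Suc i))) Z)"
    using Del_rename[OF assms(1), of "\<lambda>k. if k = 0 then 0 else Suc k"] by simp
  have "Del (\<lambda>e Z. P (e 0) (\<lambda>i. e (Suc i)) Z \<and> (\<forall>k. k \<prec> e 0 \<longrightarrow> \<not> P k (\<lambda>i. e (Suc i)) Z))"
    by (intro Del_conj Del_ball Del_neg assms(1) D Fn_var)
  from Del_Sig[OF this] show ?thesis unfolding Fn_def
  proof (rule Sig_cong)
    fix e Z assume "Z \<in> Sets"
    then obtain a where a: "P a (\<lambda>i. e (Suc i)) Z" using assms(2) by blast
    show "(P (e 0) (\<lambda>i. e (Suc i)) Z \<and> (\<forall>k. k \<prec> e 0 \<longrightarrow> \<not> P k (\<lambda>i. e (Suc i)) Z)) =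
      (leastM (\<lambda>x. P x (\<lambda>i. e (Suc i)) Z) = e 0)"
      (is "?l = ?r")
    proof
      show "?l \<Longrightarrow> ?r" by (rule leastM_eq) auto
      show "?r \<Longrightarrow> ?l" using leastM[OF assms(1) a \<open>Z \<in> Sets\<close>] by metis
    qed
  qed
qed

section \<open>Coding\<close>

lemma Suc_le_iff: "a \<oplus> \<one> \<preceq> b \<longleftrightarrow> a \<prec> b"
  using arith_axioms(6)[of "a \<oplus> \<one>" b] ar.add_less_cancel_right[of a \<one> b] by simp

lemma zero_le [simp]: "\<zero> \<preceq> a"
  unfolding le_iff by auto

lemma add_le1: "a \<preceq> a \<oplus> b" and add_le2: "b \<preceq> a \<oplus> b"
  unfolding le_iff by (metis add_commute)+

lemma mult_le: "b \<noteq> \<zero> \<Longrightarrow> a \<preceq> a \<otimes> b"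
  using zero_or_Suc[of b] add_le2 mult_Suc by auto

text \<open>The next square is \<open>s \<otimes> s \<oplus> s \<oplus> (s \<oplus> \<one>)\<close>,
  already beyond \<open>s \<otimes> s \<oplus> i\<close>. A pair code thus determines the sum of its
  components, and then the components.\<close>

lemma square_add_less:
  assumes "s \<prec> t" "i \<preceq> s"
  shows "s \<otimes> s \<oplus> i \<prec> t \<otimes> t \<oplus> j"
proof -
  have "s \<oplus> \<one> \<preceq> t" using assms(1) Suc_le_iff by simp
  then have "(s \<oplus> \<one>) \<otimes> (s \<oplus> \<one>) \<preceq> t \<otimes> t" by (intro ar.mult_mono) auto
  moreover have "(s \<oplus> \<one>) \<otimes> (s \<oplus> \<one>) = s \<otimes> s \<oplus> s \<oplus> (s \<oplus> \<one>)"
    by (simp add: distrib mult_Suc ar.add.assoc)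
  ultimately have "s \<otimes> s \<oplus> s \<oplus> (s \<oplus> \<one>) \<preceq> t \<otimes> t" by simp
  moreover have "s \<otimes> s \<oplus> s \<prec> s \<otimes> s \<oplus> s \<oplus> (s \<oplus> \<one>)" by (rule less_add)
  moreover have "s \<otimes> s \<oplus> i \<preceq> s \<otimes> s \<oplus> s" using assms(2) by simp
  ultimately have "s \<otimes> s \<oplus> i \<prec> t \<otimes> t"
    by (meson ar.le_less_trans ar.less_le_trans)
  then show ?thesis using add_le1 ar.less_le_trans by blast
qed

lemma pair_eq_iff [simp]: "pr i j = pr i' j' \<longleftrightarrow> i = i' \<and> j = j'"
proof
  assume eq: "pr i j = pr i' j'"
  have "i \<oplus> j = i' \<oplus> j'"
    using less_linear[of "i \<oplus> j" "i' \<oplus> j'"] square_add_less[of "i \<oplus> j" "i' \<oplus> j'" i i']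
      square_add_less[of "i' \<oplus> j'" "i \<oplus> j" i' i] add_le1 eq less_irrefl
    unfolding pairM_def by auto
  then show "i = i' \<and> j = j'" using eq unfolding pairM_def by auto
qed simp

lemma le_pair1: "i \<preceq> pr i j"
  unfolding pairM_def by (rule add_le2)

lemma le_pair2: "j \<preceq> pr i j"
proof (cases "i \<oplus> j = \<zero>")
  case True
  then have "j = \<zero>" using add_le2[of j i] by (simp add: le_def)
  then show ?thesis by simp
next
  case False
  have "j \<preceq> i \<oplus> j" by (rule add_le2)
  also have "\<dots> \<preceq> (i \<oplus> j) \<otimes> (i \<oplus> j)" using False by (rule mult_le)
  also have "\<dots> \<preceq> pr i j" unfolding pairM_def by (rule add_le1)
  finally show ?thesis .
qed

lemma pair_mono: "i \<preceq> i' \<Longrightarrow> j \<preceq> j' \<Longrightarrow> pr i j \<preceq> pr i' j'"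
  unfolding pairM_def by (intro ar.add_mono ar.mult_mono) auto

section \<open>Divisibility and the moduli of the beta function\<close>

definition divides where "divides a n \<longleftrightarrow> (\<exists>d. n = a \<otimes> d)"

lemma divides_bounded: "divides a n \<longleftrightarrow> (\<exists>d. d \<preceq> n \<and> n = a \<otimes> d)"
proof
  assume "divides a n"
  then obtain d where d: "n = a \<otimes> d" unfolding divides_def by blast
  show "\<exists>d. d \<preceq> n \<and> n = a \<otimes> d"
  proof (cases "a = \<zero>")
    case True then show ?thesis using d by (intro exI[of _ \<zero>]) simp
  next
    case False then show ?thesis using d mult_le[of a d] mult_commute by auto
  qed
qed (auto simp: divides_def)

lemma Del_divides: "Fn f \<Longrightarrow> Fn g \<Longrightarrow> Del (\<lambda>e Z. divides (f e Z) (g e Z))"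
  by (rule Del_app2) (unfold divides_bounded, intro Del_intros Fn_intros)

lemma divides_mult1: "divides a n \<Longrightarrow> divides a (n \<otimes> k)"
  unfolding divides_def by (metis mult_assoc)

lemma divides_mult2: "divides a n \<Longrightarrow> divides a (k \<otimes> n)"
  using divides_mult1 mult_commute by metis

lemma divides_refl [simp]: "divides a a"
  unfolding divides_def by (rule exI[of _ \<one>]) simp

lemma divides_add_cancel:
  assumes "divides a x" "divides a (x \<oplus> y)"
  shows "divides a y"
proof -
  obtain d d' where d: "x = a \<otimes> d" "x \<oplus> y = a \<otimes> d'" using assms unfolding divides_def by blast
  show ?thesis
  proof (cases "d \<preceq> d'")
    case True
    then obtain k where "d' = d \<oplus> k" unfolding le_iff by blast
    then have "x \<oplus> y = x \<oplus> a \<otimes> k" using d by (simp add: ar.distrib_left)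
    then show ?thesis unfolding divides_def by auto
  next
    case False
    then have "d' \<preceq> d" using less_linear[of d d'] unfolding le_def by auto
    then have "x \<oplus> y \<preceq> x \<oplus> \<zero>" using d by (auto intro: ar.mult_mono)
    then have "y = \<zero>" by (simp add: le_def)
    then show ?thesis unfolding divides_def by (intro exI[of _ \<zero>]) simp
  qed
qed

definition modulus where "modulus m i = m \<otimes> (i \<oplus> \<one>) \<oplus> \<one>"

lemma Fn_modulus: "Fn f \<Longrightarrow> Fn g \<Longrightarrow> Fn (\<lambda>e Z. modulus (f e Z) (g e Z))"
  unfolding modulus_def by (intro Fn_intros)

text \<open>The modulus is one more than a multiple of \<open>m\<close>, so \<open>y\<close> is the
  difference of two multiples of it.\<close>

lemma modulus_coprime_base:
  assumes "divides (modulus m i) (y \<otimes> m)"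
  shows "divides (modulus m i) y"
proof -
  have "y \<otimes> modulus m i = y \<otimes> m \<otimes> (i \<oplus> \<one>) \<oplus> y"
    unfolding modulus_def by (simp add: ar.distrib_left mult_assoc)
  then show ?thesis
    using divides_add_cancel[of "modulus m i" "y \<otimes> m \<otimes> (i \<oplus> \<one>)" y] divides_mult1[OF assms]
      divides_mult2[OF divides_refl, of "modulus m i" y] by simp
qed

lemma modulus_add: "modulus m (i \<oplus> d) = modulus m i \<oplus> m \<otimes> d"
  unfolding modulus_def by (simp add: ar.distrib_left add_assoc add_commute add_left_commute)

text \<open>The two moduli differ by \<open>m \<otimes> (d \<oplus> \<one>)\<close> with
  \<open>d \<oplus> \<one>\<close> at most \<open>k\<close>. The factor \<open>m\<close> cancels by
  the previous argument, and so does \<open>d \<oplus> \<one>\<close>, being a divisor of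
  \<open>m\<close>. Coprimality is expressed by cancellation throughout, which avoids
  primes.\<close>

lemma modulus_coprime:
  assumes m: "\<And>d. d \<prec> k \<Longrightarrow> divides (d \<oplus> \<one>) m" and ij: "i \<prec> k" "j \<prec> k" "i \<noteq> j"
    and divides: "divides (modulus m i) (n \<otimes> modulus m j)"
  shows "divides (modulus m i) n"
proof -
  have "\<exists>d. d \<oplus> \<one> \<preceq> k \<and> divides (modulus m i) (n \<otimes> (m \<otimes> (d \<oplus> \<one>)))"
  proof (cases "i \<prec> j")
    case True
    then obtain d where d: "j = i \<oplus> (d \<oplus> \<one>)" unfolding less_iff by metis
    have "n \<otimes> modulus m j = n \<otimes> modulus m i \<oplus> n \<otimes> (m \<otimes> (d \<oplus> \<one>))"
      unfolding d modulus_add by (rule ar.distrib_left)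
    then have "divides (modulus m i) (n \<otimes> (m \<otimes> (d \<oplus> \<one>)))"
      using divides_add_cancel[OF divides_mult2[OF divides_refl, of "modulus m i" n]] divides by simp
    moreover have "d \<oplus> \<one> \<preceq> j" unfolding d by (rule add_le2)
    ultimately show ?thesis using ij ar.order.trans unfolding le_def by metis
  next
    case False
    then have "j \<prec> i" using ij less_linear by blast
    then obtain d where d: "i = j \<oplus> (d \<oplus> \<one>)" unfolding less_iff by metis
    have "n \<otimes> modulus m i = n \<otimes> modulus m j \<oplus> n \<otimes> (m \<otimes> (d \<oplus> \<one>))"
      by (subst d, unfold modulus_add) (rule ar.distrib_left)
    then have "divides (modulus m i) (n \<otimes> (m \<otimes> (d \<oplus> \<one>)))"
      using divides_add_cancel[OF divides] divides_mult2[OF divides_refl, of "modulus m i" n] by simp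
    moreover have "d \<oplus> \<one> \<preceq> i" unfolding d by (rule add_le2)
    ultimately show ?thesis using ij ar.order.trans unfolding le_def by metis
  qed
  then obtain d where d: "d \<prec> k" "divides (modulus m i) (n \<otimes> (m \<otimes> (d \<oplus> \<one>)))" unfolding Suc_le_iff by blast
  then have "divides (modulus m i) (n \<otimes> (d \<oplus> \<one>) \<otimes> m)" by (simp add: ar.mult.assoc ar.mult.commute ar.mult.left_commute)
  then have *: "divides (modulus m i) (n \<otimes> (d \<oplus> \<one>))" by (rule modulus_coprime_base)
  \<comment> \<open>Multiplying by the cofactor \<open>q\<close> restores a multiple of
    \<open>m\<close>, so that \<open>modulus_coprime_base\<close> can be applied a second
    time.\<close>
  obtain q where "m = (d \<oplus> \<one>) \<otimes> q" using m[OF d(1)] unfolding divides_def by blast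
  then have "n \<otimes> m = n \<otimes> (d \<oplus> \<one>) \<otimes> q" by (simp add: mult_assoc)
  then have "divides (modulus m i) (n \<otimes> m)" using divides_mult1[OF *] by simp
  then show ?thesis by (rule modulus_coprime_base)
qed

text \<open>Products over a range would require recursion. The existence of some nonzero common
  multiple is Sigma_1, and one more factor extends it.\<close>

lemma common_multiple:
  assumes "Fn (\<lambda>e Z. f (e 0))" "\<And>i. f i \<noteq> \<zero>"
  shows "\<exists>N. N \<noteq> \<zero> \<and> (\<forall>i. i \<prec> l \<longrightarrow> divides (f i) N)"
proof (rule Sig_ind[where P = "\<lambda>l. \<exists>N. N \<noteq> \<zero> \<and> (\<forall>i. i \<prec> l \<longrightarrow> divides (f i) N)"])
  from assms(1) show "Sig (\<lambda>e Z. \<exists>N. N \<noteq> \<zero> \<and> (\<forall>i. i \<prec> e 0 \<longrightarrow> divides (f i) N))"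
    by (intro Sig_ex Del_Sig[of "\<lambda>e Z. e 0 \<noteq> \<zero> \<and> (\<forall>i. i \<prec> e (Suc 0) \<longrightarrow> divides (f i) (e 0))"]
        Del_intros Fn_intros Del_divides)
next
  fix n assume "\<exists>N. N \<noteq> \<zero> \<and> (\<forall>i. i \<prec> n \<longrightarrow> divides (f i) N)"
  then obtain N where "N \<noteq> \<zero>" "\<forall>i. i \<prec> n \<longrightarrow> divides (f i) N" by blast
  then show "\<exists>N. N \<noteq> \<zero> \<and> (\<forall>i. i \<prec> n \<oplus> \<one> \<longrightarrow> divides (f i) N)"
    using assms(2) by (intro exI[of _ "N \<otimes> f n"]) (auto simp: le_def intro: divides_mult1 divides_mult2)
qed (auto intro: exI[of _ \<one>])

section \<open>Codes of finite sets\<close>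

definition decode where "decode c = {i. \<exists>k m n. c = pr k (pr m n) \<and> i \<prec> k \<and> divides (modulus m i) n}"

text \<open>\<open>decode\<close> is total and sends numbers that are not triples to the empty set;
  this predicate excludes them as representatives.\<close>

definition is_triple where "is_triple c \<longleftrightarrow> (\<exists>k m n. c = pr k (pr m n))"

lemma decode_pair: "decode (pr k (pr m n)) = {i. i \<prec> k \<and> divides (modulus m i) n}"
  unfolding decode_def by auto

lemma represents_iff: "represents_finite M c A \<longleftrightarrow> is_triple c \<and> A = decode c"
  unfolding represents_finite_def is_triple_def by (auto simp: decode_def divides_def modulus_def)

lemma pair_bounds: "c = pr k (pr m n) \<Longrightarrow> k \<preceq> c \<and> m \<preceq> c \<and> n \<preceq> c"
  using le_pair1 le_pair2 ar.order.trans by metis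

lemma Del_is_triple: "Fn f \<Longrightarrow> Del (\<lambda>e Z. is_triple (f e Z))"
proof (rule Del_app1)
  have "is_triple c \<longleftrightarrow> (\<exists>k. k \<preceq> c \<and> (\<exists>m. m \<preceq> c \<and> (\<exists>n. n \<preceq> c \<and> c = pr k (pr m n))))" for c
    unfolding is_triple_def using pair_bounds by blast
  then show "Del (\<lambda>e Z. is_triple (e 0))" by (simp only:) (intro Del_intros Fn_intros)
qed

lemma decode_less: "i \<in> decode c \<Longrightarrow> i \<prec> c"
  unfolding decode_def using pair_bounds ar.less_le_trans by blast

lemma Del_decode: "Fn f \<Longrightarrow> Fn g \<Longrightarrow> Del (\<lambda>e Z. f e Z \<in> decode (g e Z))"
proof (rule Del_app2)
  have "i \<in> decode c \<longleftrightarrow> (\<exists>k. k \<preceq> c \<and> (\<exists>m. m \<preceq> c \<and> (\<exists>n. n \<preceq> c \<and>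
      c = pr k (pr m n) \<and> i \<prec> k \<and> divides (modulus m i) n)))" for i c
    unfolding decode_def mem_Collect_eq using pair_bounds by blast
  then show "Del (\<lambda>e Z. e 0 \<in> decode (e 1))" by (simp only:) (intro Del_intros Fn_intros Del_divides Fn_modulus)
qed

lemma DelSet_decode: "Fn g \<Longrightarrow> DelSet (\<lambda>e Z. decode (g e Z))"
  unfolding DelSet_def by (intro Del_decode Fn_var) (rule Fn_rename)

lemma decode_Sets [simp]: "decode c \<in> Sets"
  using DelSet_Sets[OF DelSet_decode[OF Fn_const]] Sets_ex by blast

text \<open>With \<open>m\<close> and a common multiple \<open>N\<close> of the moduli fixed, every set below \<open>l\<close> is given by a
  divisor of \<open>N\<close>, so the bound on the codes is independent of the set.\<close>

lemma finite_sets_bound: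
  "\<exists>C. \<forall>A\<in>Sets. (\<forall>i\<in>A. i \<prec> l) \<longrightarrow> (\<exists>c. c \<preceq> C \<and> is_triple c \<and> decode c = A)"
proof -
  obtain m where m: "m \<noteq> \<zero>" "\<forall>i. i \<prec> l \<longrightarrow> divides (i \<oplus> \<one>) m"
    using common_multiple[of "\<lambda>i. i \<oplus> \<one>" l, OF Fn_add[OF Fn_var Fn_const] arith_axioms(1)] by blast
  obtain N where N: "N \<noteq> \<zero>" "\<forall>i. i \<prec> l \<longrightarrow> divides (modulus m i) N"
    using common_multiple[of "modulus m" l, OF Fn_modulus[OF Fn_const Fn_var]] by (auto simp: modulus_def)
  \<comment> \<open>As \<open>m\<close> is nonzero, every modulus exceeds one. Hence the
    construction below can start from \<open>n = \<one>\<close>, the product for the empty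
    set.\<close>
  have not1: "\<not> divides (modulus m i) \<one>" for i
  proof
    assume "divides (modulus m i) \<one>"
    then obtain d where d: "\<one> = modulus m i \<otimes> d" unfolding divides_def by blast
    then have "d \<noteq> \<zero>" by (metis arith_axioms(4) ar.zero_neq_one)
    then have "modulus m i \<preceq> \<zero> \<oplus> \<one>" using mult_le[of d "modulus m i"] d by simp
    then have "m \<otimes> (i \<oplus> \<one>) \<preceq> \<zero>" unfolding modulus_def by simp
    then show False using m(1) by (simp add: le_def)
  qed
  have "\<exists>c. c \<preceq> pr l (pr m N) \<and> is_triple c \<and> decode c = A" if A: "A \<in> Sets" "\<forall>i\<in>A. i \<prec> l" for A
  proof -
    \<comment> \<open>\<open>n\<close> collects the moduli of the members of \<open>A\<close> below
      \<open>j\<close>, while the cofactor \<open>n'\<close> retains all others. Keeping the product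
      equal to \<open>N\<close> is what bounds the final \<open>n\<close> by
      \<open>N\<close>.\<close>
    define P where "P j n n' \<longleftrightarrow> n \<otimes> n' = N \<and> (\<forall>i. i \<prec> l \<longrightarrow> (divides (modulus m i) n \<longleftrightarrow> i \<prec> j \<and> i \<in> A)) \<and>
      (\<forall>i. i \<prec> l \<longrightarrow> \<not> (i \<prec> j \<and> i \<in> A) \<longrightarrow> divides (modulus m i) n')" for j n n'
    have "\<exists>n n'. P l n n'"
    proof (rule Sig_ind[where P = "\<lambda>j. \<exists>n n'. P j n n'"])
      have "Del (\<lambda>e Z. P (e (Suc (Suc 0))) (e (Suc 0)) (e 0))"
        unfolding P_def using A(1) by (intro Del_intros Fn_intros Del_memA Del_divides Fn_modulus)
      then show "Sig (\<lambda>e Z. \<exists>n n'. P (e 0) n n')" by (intro Sig_ex Del_Sig)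
    next
      have "P \<zero> \<one> N" unfolding P_def using N not1 by simp
      then show "\<exists>n n'. P \<zero> n n'" by blast
    next
      fix j assume "\<exists>n n'. P j n n'"
      then obtain n n' where n: "n \<otimes> n' = N" "\<And>i. i \<prec> l \<Longrightarrow> divides (modulus m i) n \<longleftrightarrow> i \<prec> j \<and> i \<in> A"
        "\<And>i. i \<prec> l \<Longrightarrow> \<not> (i \<prec> j \<and> i \<in> A) \<Longrightarrow> divides (modulus m i) n'" unfolding P_def by blast
      show "\<exists>n n'. P (j \<oplus> \<one>) n n'"
      proof (cases "j \<in> A")
        case False
        then have "P (j \<oplus> \<one>) n n'" unfolding P_def using n by (auto simp: le_def)
        then show ?thesis by blast
      next
        case True
        then have j: "j \<prec> l" using A(2) by blast
        \<comment> \<open>The modulus at \<open>j\<close> moves from the cofactor to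
          \<open>n\<close>; by coprimality the other divisibilities of both factors survive.\<close>
        then have "divides (modulus m j) n'" using n(3) less_irrefl by blast
        then obtain q where q: "n' = modulus m j \<otimes> q" unfolding divides_def by blast
        have "n \<otimes> modulus m j \<otimes> q = N" using n(1) q mult_assoc by simp
        moreover have "divides (modulus m i) (n \<otimes> modulus m j) \<longleftrightarrow> i \<prec> j \<oplus> \<one> \<and> i \<in> A" if i: "i \<prec> l" for i
        proof (cases "i = j")
          case True then show ?thesis using \<open>j \<in> A\<close> by (simp add: divides_mult2 le_def)
        next
          case False
          then have "divides (modulus m i) (n \<otimes> modulus m j) \<longleftrightarrow> divides (modulus m i) n"
            using modulus_coprime[of l m i j n] m(2) i j divides_mult1 by blast
          then show ?thesis using n(2)[OF i] False by (simp add: le_def)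
        qed
        moreover have "divides (modulus m i) q" if i: "i \<prec> l" "\<not> (i \<prec> j \<oplus> \<one> \<and> i \<in> A)" for i
        proof -
          have "i \<noteq> j" "divides (modulus m i) n'" using i True n(3)[OF i(1)] by (auto simp: le_def)
          then show ?thesis
            using modulus_coprime[of l m i j q] m(2) i(1) j unfolding q by (metis mult_commute)
        qed
        ultimately have "P (j \<oplus> \<one>) (n \<otimes> modulus m j) q" unfolding P_def by blast
        then show ?thesis by blast
      qed
    qed
    then obtain n n' where n: "n \<otimes> n' = N" "\<And>i. i \<prec> l \<Longrightarrow> divides (modulus m i) n \<longleftrightarrow> i \<in> A"
      unfolding P_def by blast
    have "n' \<noteq> \<zero>" using n(1) N(1) by auto
    then have "n \<preceq> N" using mult_le n(1) by blast
    then have "pr l (pr m n) \<preceq> pr l (pr m N)" by (intro pair_mono) auto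
    moreover have "decode (pr l (pr m n)) = A" unfolding decode_pair using n(2) A(2) by auto
    ultimately show ?thesis unfolding is_triple_def by blast
  qed
  then show ?thesis by blast
qed

lemma codes_iff: "codes_finite M c A \<longleftrightarrow> is_triple c \<and> decode c = A \<and> (\<forall>c'. c' \<prec> c \<longrightarrow> is_triple c' \<longrightarrow> decode c' \<noteq> A)"
  unfolding codes_finite_def represents_iff by auto

lemma codes_unique: "codes_finite M c A \<Longrightarrow> codes_finite M c' A \<Longrightarrow> c = c'"
  unfolding codes_iff using less_linear by blast

text \<open>Equality of sets becomes decidable by a computable bound \<open>g\<close> on the
  elements of the family; the elements of a decoded set are below its code anyway.\<close>

lemma Del_decode_eq:
  assumes "Fn f" "Fn g" "DelSet A" "\<And>e Z i. Z \<in> Sets \<Longrightarrow> i \<in> A e Z \<Longrightarrow> i \<prec> g e Z"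
  shows "Del (\<lambda>e Z. decode (f e Z) = A e Z)"
proof -
  have "Del (\<lambda>e Z. (\<forall>i. i \<prec> f e Z \<longrightarrow> i \<in> decode (f e Z) \<longrightarrow> i \<in> A e Z) \<and>
      (\<forall>i. i \<prec> g e Z \<longrightarrow> i \<in> A e Z \<longrightarrow> i \<in> decode (f e Z)))"
    by (intro Del_intros Del_decode Del_mem Fn_var DelSet_rename[OF assms(3)] Fn_rename[OF assms(1)] assms)
  then show ?thesis by (rule Del_cong) (use assms(4) decode_less in blast)
qed

lemma Del_codes:
  assumes "Fn f" "Fn g" "DelSet A" "\<And>e Z i. Z \<in> Sets \<Longrightarrow> i \<in> A e Z \<Longrightarrow> i \<prec> g e Z"
  shows "Del (\<lambda>e Z. codes_finite M (f e Z) (A e Z))"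
  unfolding codes_iff
  by (intro Del_intros Del_is_triple Del_decode_eq[OF assms] Fn_var
      Del_decode_eq[OF Fn_var Fn_rename[OF assms(2)] DelSet_rename[OF assms(3)]] assms)

definition code_of where "code_of A = (THE c. codes_finite M c A)"

lemma code_of_eq: "codes_finite M c A \<Longrightarrow> code_of A = c"
  unfolding code_of_def using codes_unique by blast

lemma codes_ex:
  assumes "A \<in> Sets" "is_triple c" "decode c = A"
  shows "\<exists>c'. c' \<preceq> c \<and> codes_finite M c' A"
proof -
  obtain B where B: "B \<in> Sets" using Sets_ex by blast
  have "\<And>i. i \<in> A \<Longrightarrow> i \<prec> c" using decode_less assms(3) by blast
  then have "Del (\<lambda>e Z. is_triple (e 0) \<and> decode (e 0) = A)"
    by (intro Del_intros Del_is_triple Fn_intros Del_decode_eq[where g = "\<lambda>e Z. c"] DelSet_const assms(1))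
  from least_ex[where P = "\<lambda>x e Z. is_triple x \<and> decode x = A", OF this _ B, of c] obtain c'
    where c': "is_triple c'" "decode c' = A" "\<forall>k. k \<prec> c' \<longrightarrow> \<not> (is_triple k \<and> decode k = A)" using assms by blast
  then have "c' \<preceq> c" using less_linear[of c c'] assms unfolding le_def by blast
  then show ?thesis using c' unfolding codes_iff by blast
qed

lemma codes_bound:
  "\<exists>C. \<forall>A\<in>Sets. (\<forall>i\<in>A. i \<prec> l) \<longrightarrow> codes_finite M (code_of A) A \<and> code_of A \<preceq> C"
proof -
  obtain C where C: "\<forall>A\<in>Sets. (\<forall>i\<in>A. i \<prec> l) \<longrightarrow> (\<exists>c. c \<preceq> C \<and> is_triple c \<and> decode c = A)"
    using finite_sets_bound by blast
  show ?thesis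
  proof (intro exI[of _ C] ballI impI)
    fix A assume A: "A \<in> Sets" "\<forall>i\<in>A. i \<prec> l"
    then obtain c where c: "c \<preceq> C" "is_triple c" "decode c = A" using C by blast
    obtain c' where "c' \<preceq> c" "codes_finite M c' A" using codes_ex[OF A(1) c(2,3)] by blast
    then show "codes_finite M (code_of A) A \<and> code_of A \<preceq> C"
      using code_of_eq c(1) ar.order.trans by metis
  qed
qed

section \<open>Binary sequences\<close>

definition chi where "chi B i = (if i \<in> B then \<one> else \<zero>)"

definition seg where "seg B l = {pr i (chi B i) | i. i \<prec> l}"

definition seq_code where "seq_code B l = code_of (seg B l)"

text \<open>For the code of a binary sequence this is the continuation by zeros, read as a set. It
  is defined at every number.\<close>

definition seq_set where "seq_set c = {i. pr i \<one> \<in> decode c}"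

lemma chi_eq [simp]: "chi B i = chi B' i \<longleftrightarrow> (i \<in> B \<longleftrightarrow> i \<in> B')"
  "chi B i = \<one> \<longleftrightarrow> i \<in> B" "chi B i = \<zero> \<longleftrightarrow> i \<notin> B"
  unfolding chi_def by auto

lemma chi_le: "chi B i \<preceq> \<one>"
  unfolding chi_def by simp

lemma Fn_chi: "DelSet B \<Longrightarrow> Fn f \<Longrightarrow> Fn (\<lambda>e Z. chi (B e Z) (f e Z))"
  unfolding chi_def by (intro Fn_if Fn_const Del_mem)

lemma mem_seg [simp]: "pr i j \<in> seg B l \<longleftrightarrow> i \<prec> l \<and> j = chi B i"
  unfolding seg_def by auto

lemma seg_less: "y \<in> seg B l \<Longrightarrow> y \<prec> pr l \<one> \<oplus> \<one>"
proof -
  assume "y \<in> seg B l"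
  then obtain i where i: "i \<prec> l" "y = pr i (chi B i)" unfolding seg_def by blast
  then have "i \<preceq> l" unfolding le_def by simp
  from pair_mono[OF this chi_le] have "y \<preceq> pr l \<one>" using i(2) by metis
  then show ?thesis by simp
qed

lemma DelSet_seg:
  assumes "DelSet B" "Fn l"
  shows "DelSet (\<lambda>e Z. seg (B e Z) (l e Z))"
proof -
  have "DelSet (\<lambda>e Z. {y. \<exists>i. i \<prec> l e Z \<and> y = pr i (chi (B e Z) i)})"
    by (intro DelSet_Collect Del_intros Fn_var Fn_pair Fn_chi DelSet_rename[OF assms(1)] Fn_rename[OF assms(2)])
  moreover have "(\<lambda>e Z. {y. \<exists>i. i \<prec> l e Z \<and> y = pr i (chi (B e Z) i)}) = (\<lambda>e Z. seg (B e Z) (l e Z))"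
    unfolding seg_def by (intro ext) blast
  ultimately show ?thesis by simp
qed

lemma seg_Sets: "B \<in> Sets \<Longrightarrow> seg B l \<in> Sets"
  using DelSet_Sets[OF DelSet_seg[OF DelSet_const[of B] Fn_const[of l]]] by blast

lemma codes_seq_code:
  assumes "B \<in> Sets"
  shows "codes_finite M (seq_code B l) (seg B l)"
proof -
  obtain C where "\<forall>A\<in>Sets. (\<forall>i\<in>A. i \<prec> pr l \<one> \<oplus> \<one>) \<longrightarrow> codes_finite M (code_of A) A \<and> code_of A \<preceq> C"
    using codes_bound[of "pr l \<one> \<oplus> \<one>"] by blast
  then have "codes_finite M (code_of (seg B l)) (seg B l) \<and> code_of (seg B l) \<preceq> C"
    using seg_Sets[OF assms, of l] seg_less[of _ B l] by (elim ballE impE) auto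
  then show ?thesis unfolding seq_code_def by simp
qed

text \<open>All sequences up to a given length have codes below one bound; this is how an infinite
  binary tree is later seen to have long members.\<close>

lemma seq_code_bound: "\<exists>C. \<forall>B\<in>Sets. \<forall>l'. l' \<preceq> l \<longrightarrow> seq_code B l' \<preceq> C"
proof -
  obtain C where C: "\<forall>A\<in>Sets. (\<forall>i\<in>A. i \<prec> pr l \<one> \<oplus> \<one>) \<longrightarrow> codes_finite M (code_of A) A \<and> code_of A \<preceq> C"
    using codes_bound[of "pr l \<one> \<oplus> \<one>"] by blast
  have "seq_code B l' \<preceq> C" if "B \<in> Sets" "l' \<preceq> l" for B l'
  proof -
    have "seg B l' \<subseteq> seg B l" using that(2) ar.less_le_trans unfolding seg_def by blast
    then have "\<forall>i\<in>seg B l'. i \<prec> pr l \<one> \<oplus> \<one>" using seg_less[of _ B l] by (metis subsetD)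
    then show ?thesis using C[rule_format, of "seg B l'"] seg_Sets[OF that(1)] unfolding seq_code_def by simp
  qed
  then show ?thesis by blast
qed

lemma decode_seq_code: "B \<in> Sets \<Longrightarrow> decode (seq_code B l) = seg B l"
  using codes_seq_code codes_iff by blast

lemma seg_subset: "seg B l \<subseteq> seg B' l' \<longleftrightarrow> l \<preceq> l' \<and> (\<forall>i. i \<prec> l \<longrightarrow> (i \<in> B \<longleftrightarrow> i \<in> B'))"
proof
  assume sub: "seg B l \<subseteq> seg B' l'"
  have *: "i \<prec> l' \<and> (i \<in> B \<longleftrightarrow> i \<in> B')" if "i \<prec> l" for i
  proof -
    have "pr i (chi B i) \<in> seg B' l'" using sub that by (metis mem_seg subsetD)
    then show ?thesis by simp
  qed
  moreover have "l \<preceq> l'"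
    using *[of l'] less_irrefl less_linear[of l l'] unfolding le_def by blast
  ultimately show "l \<preceq> l' \<and> (\<forall>i. i \<prec> l \<longrightarrow> (i \<in> B \<longleftrightarrow> i \<in> B'))" by blast
next
  assume *: "l \<preceq> l' \<and> (\<forall>i. i \<prec> l \<longrightarrow> (i \<in> B \<longleftrightarrow> i \<in> B'))"
  show "seg B l \<subseteq> seg B' l'"
    using * ar.less_le_trans unfolding seg_def by (auto simp: chi_def)
qed

lemma seg_eq: "seg B l = seg B' l' \<longleftrightarrow> l = l' \<and> (\<forall>i. i \<prec> l \<longrightarrow> (i \<in> B \<longleftrightarrow> i \<in> B'))"
  using seg_subset[of B l B' l'] seg_subset[of B' l' B l] ar.order.antisym by blast

lemma seq_code_eq:
  "B \<in> Sets \<Longrightarrow> B' \<in> Sets \<Longrightarrow>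
    seq_code B l = seq_code B' l' \<longleftrightarrow> l = l' \<and> (\<forall>i. i \<prec> l \<longrightarrow> (i \<in> B \<longleftrightarrow> i \<in> B'))"
  using decode_seq_code seg_eq unfolding seq_code_def by metis

lemma seq_set_Sets [simp]: "seq_set c \<in> Sets"
proof -
  have "DelSet (\<lambda>e Z. seq_set c)" unfolding seq_set_def by (intro DelSet_Collect Del_decode Fn_intros)
  then show ?thesis using DelSet_Sets Sets_ex by blast
qed

lemma DelSet_seq_set: "Fn f \<Longrightarrow> DelSet (\<lambda>e Z. seq_set (f e Z))"
  unfolding seq_set_def by (intro DelSet_Collect Del_decode Fn_pair Fn_var Fn_const) (rule Fn_rename)

lemma seq_set_seq_code: "B \<in> Sets \<Longrightarrow> i \<in> seq_set (seq_code B l) \<longleftrightarrow> i \<prec> l \<and> i \<in> B"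
  unfolding seq_set_def by (auto simp: decode_seq_code chi_def split: if_splits)

lemma seq_code_seq_set: "B \<in> Sets \<Longrightarrow> seq_code (seq_set (seq_code B l)) l = seq_code B l"
  using seq_code_eq seq_set_seq_code by simp

text \<open>Every coded binary sequence is an initial segment of the characteristic function of a
  set in the model, for instance of its continuation by zeros. Trees can therefore be discussed
  through \<open>seq_code\<close> alone.\<close>

lemma codes_binseq_iff: "codes_binseq M c l A \<longleftrightarrow> (\<exists>B\<in>Sets. c = seq_code B l \<and> A = seg B l)"
proof
  assume *: "codes_binseq M c l A"
  then have c: "codes_finite M c A" and pairs: "\<And>a. a \<in> A \<Longrightarrow> \<exists>i j. a = pr i j"
    and fun_: "\<And>i j k. pr i j \<in> A \<Longrightarrow> pr i k \<in> A \<Longrightarrow> j = k"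
    and dom: "\<And>i. i \<prec> l \<longleftrightarrow> (\<exists>j. pr i j \<in> A)"
    and bin: "\<And>i j. pr i j \<in> A \<Longrightarrow> j = \<zero> \<or> j = \<one>"
    unfolding codes_binseq_def codes_seq_def by blast+
  have A: "A = decode c" using c codes_iff by blast
  have "pr i j \<in> A \<longleftrightarrow> i \<prec> l \<and> j = chi (seq_set c) i" for i j
    unfolding seq_set_def A[symmetric] chi_def using dom[of i] bin[of i] fun_[of i] by auto
  then have "pr i j \<in> A \<longleftrightarrow> pr i j \<in> seg (seq_set c) l" for i j by simp
  moreover have "\<exists>i j. a = pr i j" if "a \<in> seg (seq_set c) l" for a using that unfolding seg_def by blast
  ultimately have "A = seg (seq_set c) l" using pairs by blast
  then show "\<exists>B\<in>Sets. c = seq_code B l \<and> A = seg B l"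
    using c code_of_eq unfolding seq_code_def by (intro bexI[of _ "seq_set c"]) auto
next
  assume "\<exists>B\<in>Sets. c = seq_code B l \<and> A = seg B l"
  then obtain B where B: "B \<in> Sets" "c = seq_code B l" "A = seg B l" by blast
  then show "codes_binseq M c l A"
    unfolding codes_binseq_def codes_seq_def using codes_seq_code[OF B(1)]
    by (auto simp: chi_def) (auto simp: seg_def)
qed

lemma codes_seq_seq_code: "B \<in> Sets \<Longrightarrow> codes_seq M (seq_code B l) l (seg B l)"
  using codes_binseq_iff unfolding codes_binseq_def by blast

text \<open>The pair at the last position \<open>k\<close>, with
  \<open>l = k \<oplus> \<one>\<close>, is an element of the coded set, and elements are smaller
  than codes.\<close>

lemma le_seq_code: "B \<in> Sets \<Longrightarrow> l \<preceq> seq_code B l"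
proof -
  assume B: "B \<in> Sets"
  show ?thesis
  proof (cases "l = \<zero>")
    case False
    then obtain k where k: "l = k \<oplus> \<one>" using zero_or_Suc by blast
    then have "pr k (chi B k) \<in> decode (seq_code B l)" using decode_seq_code[OF B] by (simp add: le_def)
    then have "k \<prec> seq_code B l" using decode_less le_pair1 ar.le_less_trans by blast
    then show ?thesis using k Suc_le_iff by simp
  qed simp
qed

lemma Fn_seq_code:
  assumes "DelSet B" "Fn l"
  shows "Fn (\<lambda>e Z. seq_code (B e Z) (l e Z))"
proof -
  have "Del (\<lambda>e Z. codes_finite M (e 0) (seg (B (\<lambda>i. e (Suc i)) Z) (l (\<lambda>i. e (Suc i)) Z)))"
    by (rule Del_codes[where g = "\<lambda>e Z. pr (l (\<lambda>i. e (Suc i)) Z) \<one> \<oplus> \<one>"])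
      (intro Fn_intros Fn_rename[OF assms(2)] DelSet_seg DelSet_rename[OF assms(1)] | rule seg_less | assumption)+
  from Del_Sig[OF this] show ?thesis unfolding Fn_def
  proof (rule Sig_cong)
    fix e Z assume Z: "Z \<in> Sets"
    then have "codes_finite M (seq_code (B (\<lambda>i. e (Suc i)) Z) (l (\<lambda>i. e (Suc i)) Z))
        (seg (B (\<lambda>i. e (Suc i)) Z) (l (\<lambda>i. e (Suc i)) Z))"
      using codes_seq_code DelSet_Sets[OF assms(1)] by blast
    then show "codes_finite M (e 0) (seg (B (\<lambda>i. e (Suc i)) Z) (l (\<lambda>i. e (Suc i)) Z)) =
        (seq_code (B (\<lambda>i. e (Suc i)) Z) (l (\<lambda>i. e (Suc i)) Z) = e 0)"
      using codes_unique by metis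
  qed
qed

section \<open>Matrices of formulas and their use\<close>

text \<open>Terms are built from sums and products only. This monotonicity controls the use of a
  formula under its bounded quantifiers.\<close>

lemma tm_val_mono: "(\<And>v. e v \<preceq> e' v) \<Longrightarrow> tm_val M e t \<preceq> tm_val M e' t"
  by (induction t) (auto intro: ar.add_mono ar.mult_mono)

lemma less_addI: "i \<prec> a \<Longrightarrow> i \<prec> a \<oplus> b" "i \<prec> b \<Longrightarrow> i \<prec> a \<oplus> b"
  using add_le1 add_le2 ar.less_le_trans by blast+

text \<open>The part of the set that is consulted is bounded by a term: a membership atom asks for
  one position, binary connectives add the bounds of their parts, and under a bounded quantifier the
  bounding term takes the place of the bound variable.\<close>

lemma bounded_use:
  assumes "bounded_fm p"
  shows "\<exists>t. \<forall>e s Z Z'. (\<forall>i. i \<prec> tm_val M e t \<longrightarrow> (i \<in> Z \<longleftrightarrow> i \<in> Z')) \<longrightarrow>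
    sat M e (s(0 := Z)) p = sat M e (s(0 := Z')) p"
  using assms
proof (induction rule: bounded_fm.induct)
  case (1 t u)
  show ?case by (rule exI[of _ Zero]) simp
next
  case (2 t u)
  show ?case by (rule exI[of _ Zero]) simp
next
  case (3 t k)
  show ?case by (rule exI[of _ "Plus t One"]) (auto simp: le_def)
next
  case (4 p)
  then show ?case by simp
next
  case (5 p q)
  obtain t where t: "\<forall>e s Z Z'. (\<forall>i. i \<prec> tm_val M e t \<longrightarrow> (i \<in> Z \<longleftrightarrow> i \<in> Z')) \<longrightarrow>
      sat M e (s(0 := Z)) p = sat M e (s(0 := Z')) p" using "5.IH"(1) by (rule exE)
  obtain u where u: "\<forall>e s Z Z'. (\<forall>i. i \<prec> tm_val M e u \<longrightarrow> (i \<in> Z \<longleftrightarrow> i \<in> Z')) \<longrightarrow>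
      sat M e (s(0 := Z)) q = sat M e (s(0 := Z')) q" using "5.IH"(2) by (rule exE)
  show ?case
  proof (intro exI[of _ "Plus t u"] allI impI)
    fix e s Z Z' assume *: "\<forall>i. i \<prec> tm_val M e (Plus t u) \<longrightarrow> (i \<in> Z \<longleftrightarrow> i \<in> Z')"
    have "sat M e (s(0 := Z)) p = sat M e (s(0 := Z')) p"
      using t[rule_format, of e Z Z' s] * less_addI by simp
    moreover have "sat M e (s(0 := Z)) q = sat M e (s(0 := Z')) q"
      using u[rule_format, of e Z Z' s] * less_addI by simp
    ultimately show "sat M e (s(0 := Z)) (Conj p q) = sat M e (s(0 := Z')) (Conj p q)" by simp
  qed
next
  case (6 p q)
  obtain t where t: "\<forall>e s Z Z'. (\<forall>i. i \<prec> tm_val M e t \<longrightarrow> (i \<in> Z \<longleftrightarrow> i \<in> Z')) \<longrightarrow>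
      sat M e (s(0 := Z)) p = sat M e (s(0 := Z')) p" using "6.IH"(1) by (rule exE)
  obtain u where u: "\<forall>e s Z Z'. (\<forall>i. i \<prec> tm_val M e u \<longrightarrow> (i \<in> Z \<longleftrightarrow> i \<in> Z')) \<longrightarrow>
      sat M e (s(0 := Z)) q = sat M e (s(0 := Z')) q" using "6.IH"(2) by (rule exE)
  show ?case
  proof (intro exI[of _ "Plus t u"] allI impI)
    fix e s Z Z' assume *: "\<forall>i. i \<prec> tm_val M e (Plus t u) \<longrightarrow> (i \<in> Z \<longleftrightarrow> i \<in> Z')"
    have "sat M e (s(0 := Z)) p = sat M e (s(0 := Z')) p"
      using t[rule_format, of e Z Z' s] * less_addI by simp
    moreover have "sat M e (s(0 := Z)) q = sat M e (s(0 := Z')) q"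
      using u[rule_format, of e Z Z' s] * less_addI by simp
    ultimately show "sat M e (s(0 := Z)) (Disj p q) = sat M e (s(0 := Z')) (Disj p q)" by simp
  qed
next
  case (7 p q)
  obtain t where t: "\<forall>e s Z Z'. (\<forall>i. i \<prec> tm_val M e t \<longrightarrow> (i \<in> Z \<longleftrightarrow> i \<in> Z')) \<longrightarrow>
      sat M e (s(0 := Z)) p = sat M e (s(0 := Z')) p" using "7.IH"(1) by (rule exE)
  obtain u where u: "\<forall>e s Z Z'. (\<forall>i. i \<prec> tm_val M e u \<longrightarrow> (i \<in> Z \<longleftrightarrow> i \<in> Z')) \<longrightarrow>
      sat M e (s(0 := Z)) q = sat M e (s(0 := Z')) q" using "7.IH"(2) by (rule exE)
  show ?case
  proof (intro exI[of _ "Plus t u"] allI impI)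
    fix e s Z Z' assume *: "\<forall>i. i \<prec> tm_val M e (Plus t u) \<longrightarrow> (i \<in> Z \<longleftrightarrow> i \<in> Z')"
    have "sat M e (s(0 := Z)) p = sat M e (s(0 := Z')) p"
      using t[rule_format, of e Z Z' s] * less_addI by simp
    moreover have "sat M e (s(0 := Z)) q = sat M e (s(0 := Z')) q"
      using u[rule_format, of e Z Z' s] * less_addI by simp
    ultimately show "sat M e (s(0 := Z)) (Imp p q) = sat M e (s(0 := Z')) (Imp p q)" by simp
  qed
next
  case (8 p i t)
  then obtain u where u: "\<forall>e s Z Z'. (\<forall>i. i \<prec> tm_val M e u \<longrightarrow> (i \<in> Z \<longleftrightarrow> i \<in> Z')) \<longrightarrow>
      sat M e (s(0 := Z)) p = sat M e (s(0 := Z')) p" by blast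
  show ?case
  proof (intro exI[of _ "tm_subst (Var(i := t)) u"] allI impI)
    fix e s Z Z'
    assume *: "\<forall>j. j \<prec> tm_val M e (tm_subst (Var(i := t)) u) \<longrightarrow> (j \<in> Z \<longleftrightarrow> j \<in> Z')"
    have eq: "(\<lambda>v. tm_val M e ((Var(i := t)) v)) = e(i := tm_val M e t)" by auto
    have "sat M (e(i := a)) (s(0 := Z)) p = sat M (e(i := a)) (s(0 := Z')) p"
      if "a \<prec> tm_val M e t" for a
    proof -
      have "tm_val M (e(i := a)) u \<preceq> tm_val M (e(i := tm_val M e t)) u"
        using that by (intro tm_val_mono) (simp add: le_def)
      then have "j \<in> Z \<longleftrightarrow> j \<in> Z'" if "j \<prec> tm_val M (e(i := a)) u" for j
        using *[unfolded tm_val_subst eq] ar.less_le_trans[OF that] by blast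
      then show ?thesis by (intro u[rule_format])
    qed
    then show "sat M e (s(0 := Z)) (AllN i (Imp (Less (Var i) t) p)) =
        sat M e (s(0 := Z')) (AllN i (Imp (Less (Var i) t) p))"
      using \<open>i \<notin> tm_vars t\<close> by simp
  qed
next
  case (9 p i t)
  then obtain u where u: "\<forall>e s Z Z'. (\<forall>i. i \<prec> tm_val M e u \<longrightarrow> (i \<in> Z \<longleftrightarrow> i \<in> Z')) \<longrightarrow>
      sat M e (s(0 := Z)) p = sat M e (s(0 := Z')) p" by blast
  show ?case
  proof (intro exI[of _ "tm_subst (Var(i := t)) u"] allI impI)
    fix e s Z Z'
    assume *: "\<forall>j. j \<prec> tm_val M e (tm_subst (Var(i := t)) u) \<longrightarrow> (j \<in> Z \<longleftrightarrow> j \<in> Z')"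
    have eq: "(\<lambda>v. tm_val M e ((Var(i := t)) v)) = e(i := tm_val M e t)" by auto
    have "sat M (e(i := a)) (s(0 := Z)) p = sat M (e(i := a)) (s(0 := Z')) p"
      if "a \<prec> tm_val M e t" for a
    proof -
      have "tm_val M (e(i := a)) u \<preceq> tm_val M (e(i := tm_val M e t)) u"
        using that by (intro tm_val_mono) (simp add: le_def)
      then have "j \<in> Z \<longleftrightarrow> j \<in> Z'" if "j \<prec> tm_val M (e(i := a)) u" for j
        using *[unfolded tm_val_subst eq] ar.less_le_trans[OF that] by blast
      then show ?thesis by (intro u[rule_format])
    qed
    then show "sat M e (s(0 := Z)) (ExN i (Conj (Less (Var i) t) p)) =
        sat M e (s(0 := Z')) (ExN i (Conj (Less (Var i) t) p))"
      using \<open>i \<notin> tm_vars t\<close> by auto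
  qed
qed

text \<open>The semantic kernel of a Sigma_1 formula: \<open>\<theta> k n x W\<close> means that
  \<open>k\<close> is a witness, and \<open>u\<close> bounds the part of \<open>W\<close> consulted.
  Decidability is required after substitution of computable numbers and decidable sets, so that it
  can be used at any \<open>W\<close> computed from \<open>Z\<close>.\<close>

definition matrix :: "('m \<Rightarrow> 'm \<Rightarrow> 'm \<Rightarrow> 'm set \<Rightarrow> bool) \<Rightarrow> ('m \<Rightarrow> 'm \<Rightarrow> 'm \<Rightarrow> 'm) \<Rightarrow> bool" where
  "matrix \<theta> u \<longleftrightarrow>
    (\<forall>F G H A. Fn F \<longrightarrow> Fn G \<longrightarrow> Fn H \<longrightarrow> DelSet A \<longrightarrow> Del (\<lambda>e Z. \<theta> (F e Z) (G e Z) (H e Z) (A e Z))) \<and>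
    (\<forall>F G H. Fn F \<longrightarrow> Fn G \<longrightarrow> Fn H \<longrightarrow> Fn (\<lambda>e Z. u (F e Z) (G e Z) (H e Z))) \<and>
    (\<forall>k n x W W'. (\<forall>i. i \<prec> u k n x \<longrightarrow> (i \<in> W \<longleftrightarrow> i \<in> W')) \<longrightarrow> \<theta> k n x W = \<theta> k n x W')"

lemma matrixD:
  assumes "matrix \<theta> u"
  shows "Fn F \<Longrightarrow> Fn G \<Longrightarrow> Fn H \<Longrightarrow> DelSet A \<Longrightarrow> Del (\<lambda>e Z. \<theta> (F e Z) (G e Z) (H e Z) (A e Z))"
    and "Fn F \<Longrightarrow> Fn G \<Longrightarrow> Fn H \<Longrightarrow> Fn (\<lambda>e Z. u (F e Z) (G e Z) (H e Z))"
    and "(\<And>i. i \<prec> u k n x \<Longrightarrow> i \<in> W \<longleftrightarrow> i \<in> W') \<Longrightarrow> \<theta> k n x W = \<theta> k n x W'"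
proof -
  note a = assms[unfolded matrix_def]
  show "Fn F \<Longrightarrow> Fn G \<Longrightarrow> Fn H \<Longrightarrow> DelSet A \<Longrightarrow> Del (\<lambda>e Z. \<theta> (F e Z) (G e Z) (H e Z) (A e Z))"
    by (rule a[THEN conjunct1, rule_format])
  show "Fn F \<Longrightarrow> Fn G \<Longrightarrow> Fn H \<Longrightarrow> Fn (\<lambda>e Z. u (F e Z) (G e Z) (H e Z))"
    by (rule a[THEN conjunct2, THEN conjunct1, rule_format])
  show "(\<And>i. i \<prec> u k n x \<Longrightarrow> i \<in> W \<longleftrightarrow> i \<in> W') \<Longrightarrow> \<theta> k n x W = \<theta> k n x W'"
    by (rule a[THEN conjunct2, THEN conjunct2, rule_format])
qed

lemma Sigma01_matrix:
  assumes "Sigma01 \<phi>" "range s \<subseteq> Sets"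
  shows "\<exists>\<theta> u. matrix \<theta> u \<and> (\<forall>n x W. inst M e s \<phi> n x W \<longleftrightarrow> (\<exists>k. \<theta> k n x W))"
proof -
  obtain j q where q: "bounded_fm q" "\<phi> = ExN j q" using assms(1) unfolding Sigma01_def by blast
  obtain t where t: "\<forall>e s Z Z'. (\<forall>i. i \<prec> tm_val M e t \<longrightarrow> (i \<in> Z \<longleftrightarrow> i \<in> Z')) \<longrightarrow>
      sat M e (s(0 := Z)) q = sat M e (s(0 := Z')) q" using bounded_use[OF q(1)] by blast
  \<comment> \<open>The order of the cases matters: the quantified variable \<open>j\<close> may be
    0 or 1 and then shadows the distinguished variable.\<close>
  define E where "E k n x = (\<lambda>i. if i = j then k else if i = 1 then x else if i = 0 then n else e i)" for k n x
  have E: "(e(0 := n, 1 := x))(j := k) = E k n x" for k n x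
    unfolding E_def by auto
  define \<theta> where "\<theta> k n x W = sat M (E k n x) (s(0 := W)) q" for k n x W
  define u where "u k n x = tm_val M (E k n x) t" for k n x
  have FE: "Fn (\<lambda>e Z. E (F e Z) (G e Z) (H e Z) i)" if "Fn F" "Fn G" "Fn H" for F G H i
    unfolding E_def using that Fn_const by (cases "i = j"; cases "i = 1"; cases "i = 0") simp_all
  have "Del (\<lambda>e Z. \<theta> (F e Z) (G e Z) (H e Z) (A e Z))" if "Fn F" "Fn G" "Fn H" "DelSet A" for F G H A
  proof -
    have "DelSet (\<lambda>e Z. if k = 0 then A e Z else s k)" for k
      using that(4) DelSet_const[of "s k"] assms(2) by (cases "k = 0") auto
    from Del_sat[OF q(1) FE[OF that(1-3)] this] show ?thesis
      unfolding \<theta>_def fun_upd_def .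
  qed
  moreover have "Fn (\<lambda>e Z. u (F e Z) (G e Z) (H e Z))" if "Fn F" "Fn G" "Fn H" for F G H
    unfolding u_def using Fn_tm_val[OF FE[OF that]] .
  moreover have "\<theta> k n x W = \<theta> k n x W'" if "\<forall>i. i \<prec> u k n x \<longrightarrow> (i \<in> W \<longleftrightarrow> i \<in> W')" for k n x W W'
    unfolding \<theta>_def using t that unfolding u_def by blast
  ultimately have "matrix \<theta> u" unfolding matrix_def by blast
  moreover have "inst M e s \<phi> n x W \<longleftrightarrow> (\<exists>k. \<theta> k n x W)" for n x W
    unfolding inst_def q(2) sat.simps E \<theta>_def ..
  ultimately show ?thesis by blast
qed

end

section \<open>Linear orders in the model\<close>

locale rca0_order = rca0 M for M :: "'m l2_structure" +
  fixes X :: "'m set"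
  assumes X: "X \<in> SetsOf M" and linear: "linear_orderM M X"
begin

abbreviation lt (infix "\<sqsubset>" 50) where "a \<sqsubset> b \<equiv> lessX M X a b"
abbreviation leq (infix "\<sqsubseteq>" 50) where "a \<sqsubseteq> b \<equiv> leX M X a b"
abbreviation field where "field \<equiv> fieldX M X"
abbreviation below where "below \<equiv> restr M X"

lemma leq_facts:
  "x \<in> field \<longleftrightarrow> x \<sqsubseteq> x" "x \<sqsubseteq> y \<Longrightarrow> x \<in> field" "x \<sqsubseteq> y \<Longrightarrow> y \<in> field"
  "x \<sqsubseteq> y \<Longrightarrow> y \<sqsubseteq> z \<Longrightarrow> x \<sqsubseteq> z" "x \<sqsubseteq> y \<Longrightarrow> y \<sqsubseteq> x \<Longrightarrow> x = y"
  "x \<in> field \<Longrightarrow> y \<in> field \<Longrightarrow> x \<sqsubseteq> y \<or> y \<sqsubseteq> x"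
proof -
  show "x \<in> field \<longleftrightarrow> x \<sqsubseteq> x" unfolding fieldX_def by simp
qed (use linear[unfolded linear_orderM_def] in blast)+

lemma lt_facts:
  "x \<sqsubset> y \<Longrightarrow> x \<in> field" "x \<sqsubset> y \<Longrightarrow> y \<in> field"
  "x \<sqsubset> y \<Longrightarrow> y \<sqsubset> z \<Longrightarrow> x \<sqsubset> z" "\<not> x \<sqsubset> x"
  "x \<in> field \<Longrightarrow> y \<in> field \<Longrightarrow> x \<sqsubset> y \<longleftrightarrow> \<not> y \<sqsubseteq> x"
  unfolding lessX_def using leq_facts by metis+

lemmas order_facts = leq_facts lt_facts

lemma Del_order:
  assumes "Fn f" "Fn g"
  shows "Del (\<lambda>e Z. f e Z \<sqsubseteq> g e Z)" "Del (\<lambda>e Z. f e Z \<sqsubset> g e Z)"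
  unfolding lessX_def leX_def by (intro Del_intros Del_memA X Fn_pair assms)+

lemma Del_field: "Fn f \<Longrightarrow> Del (\<lambda>e Z. f e Z \<in> field)"
  unfolding fieldX_def leX_def mem_Collect_eq by (intro Del_memA X Fn_pair)

lemma mem_below [simp]: "pr x n \<in> below A y \<longleftrightarrow> pr x n \<in> A \<and> x \<sqsubset> y"
  unfolding restr_def by auto

lemma DelSet_below:
  assumes "DelSet A" "Fn f"
  shows "DelSet (\<lambda>e Z. below (A e Z) (f e Z))"
proof -
  have "DelSet (\<lambda>e Z. {y. \<exists>x. x \<preceq> y \<and> (\<exists>n. n \<preceq> y \<and> y = pr x n \<and> y \<in> A e Z \<and> x \<sqsubset> f e Z)})"
    by (intro DelSet_Collect Del_intros Fn_var Fn_pair Del_mem Del_field Del_order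
        DelSet_rename[OF assms(1)] Fn_rename[OF assms(2)])
  moreover have "(\<lambda>e Z. {y. \<exists>x. x \<preceq> y \<and> (\<exists>n. n \<preceq> y \<and> y = pr x n \<and> y \<in> A e Z \<and> x \<sqsubset> f e Z)}) =
      (\<lambda>e Z. below (A e Z) (f e Z))"
    unfolding restr_def using le_pair1 le_pair2 by (intro ext) blast
  ultimately show ?thesis by simp
qed

lemma below_Sets: "A \<in> Sets \<Longrightarrow> below A x \<in> Sets"
  using DelSet_Sets[OF DelSet_below[OF DelSet_const Fn_const]] by blast

lemma below_cong:
  assumes "\<And>y n. y \<sqsubset> x \<Longrightarrow> pr y n \<prec> l \<Longrightarrow> pr y n \<in> A \<longleftrightarrow> pr y n \<in> B" "i \<prec> l"
  shows "i \<in> below A x \<longleftrightarrow> i \<in> below B x"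
  using assms unfolding restr_def by auto

text \<open>Induction on the bound \<open>l\<close>, comparing the minimum so far with the new
  number. The relation is kept general so that the converse order yields maxima.\<close>

lemma finite_min:
  assumes r: "Del (\<lambda>e Z. r (e 0) (e 1))" and A: "A \<in> Sets"
    and total: "\<And>x y. x \<in> A \<Longrightarrow> y \<in> A \<Longrightarrow> r x y \<or> r y x"
    and trans: "\<And>x y z. r x y \<Longrightarrow> r y z \<Longrightarrow> r x z"
    and a: "a \<in> A" "a \<prec> l"
  shows "\<exists>x\<in>A. x \<prec> l \<and> (\<forall>y\<in>A. y \<prec> l \<longrightarrow> r x y)"
proof -
  have "(\<forall>a. a \<prec> l \<longrightarrow> a \<notin> A) \<or> (\<exists>x. x \<prec> l \<and> x \<in> A \<and> (\<forall>y. y \<prec> l \<longrightarrow> y \<in> A \<longrightarrow> r x y))"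
  proof (rule Sig_ind[where P = "\<lambda>l. (\<forall>a. a \<prec> l \<longrightarrow> a \<notin> A) \<or>
        (\<exists>x. x \<prec> l \<and> x \<in> A \<and> (\<forall>y. y \<prec> l \<longrightarrow> y \<in> A \<longrightarrow> r x y))"])
    show "Sig (\<lambda>e Z. (\<forall>a. a \<prec> e 0 \<longrightarrow> a \<notin> A) \<or>
        (\<exists>x. x \<prec> e 0 \<and> x \<in> A \<and> (\<forall>y. y \<prec> e 0 \<longrightarrow> y \<in> A \<longrightarrow> r x y)))"
      by (intro Del_Sig Del_intros Fn_var Del_memA A Del_app2[OF r])
  next
    fix l
    assume IH: "(\<forall>a. a \<prec> l \<longrightarrow> a \<notin> A) \<or> (\<exists>x. x \<prec> l \<and> x \<in> A \<and> (\<forall>y. y \<prec> l \<longrightarrow> y \<in> A \<longrightarrow> r x y))"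
    show "(\<forall>a. a \<prec> l \<oplus> \<one> \<longrightarrow> a \<notin> A) \<or>
        (\<exists>x. x \<prec> l \<oplus> \<one> \<and> x \<in> A \<and> (\<forall>y. y \<prec> l \<oplus> \<one> \<longrightarrow> y \<in> A \<longrightarrow> r x y))"
    proof (cases "l \<in> A")
      case False
      then show ?thesis using IH unfolding arith_axioms le_def by blast
    next
      case True
      show ?thesis
      proof (cases "\<forall>a. a \<prec> l \<longrightarrow> a \<notin> A")
        case True
        then show ?thesis using \<open>l \<in> A\<close> total unfolding arith_axioms le_def by blast
      next
        case False
        then obtain x where x: "x \<prec> l" "x \<in> A" "\<And>y. y \<prec> l \<Longrightarrow> y \<in> A \<Longrightarrow> r x y" using IH by blast
        have "r x l \<or> r l x" using total x True by blast
        then show ?thesis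
        proof
          assume "r x l"
          then show ?thesis using x unfolding arith_axioms le_def by blast
        next
          assume "r l x"
          then have "\<And>y. y \<prec> l \<Longrightarrow> y \<in> A \<Longrightarrow> r l y" using x trans by blast
          then show ?thesis using \<open>l \<in> A\<close> total unfolding arith_axioms le_def by blast
        qed
      qed
    qed
  qed simp
  then show ?thesis using a by blast
qed

section \<open>Recursion from Weak Koenig's Lemma\<close>

context
  fixes \<theta>1 \<theta>2 :: "'m \<Rightarrow> 'm \<Rightarrow> 'm \<Rightarrow> 'm set \<Rightarrow> bool" and u1 u2 :: "'m \<Rightarrow> 'm \<Rightarrow> 'm \<Rightarrow> 'm"
  assumes matrix1: "matrix \<theta>1 u1" and matrix2: "matrix \<theta>2 u2"
    and compl: "\<And>n x Z. x \<in> field \<Longrightarrow> Z \<in> SetsOf M \<Longrightarrow>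
      (\<exists>k. \<theta>1 k n x Z) \<longleftrightarrow> \<not> (\<exists>k. \<theta>2 k n x Z)"
begin

text \<open>Only witnesses whose use is at most \<open>l\<close> are binding: this makes the condition depend on \<open>B\<close>
  below \<open>l\<close> only.\<close>

definition good where
  "good B l \<longleftrightarrow> (\<forall>x n k. pr x n \<prec> l \<longrightarrow> x \<in> field \<longrightarrow> k \<prec> l \<longrightarrow>
    (u1 k n x \<preceq> l \<longrightarrow> \<theta>1 k n x (below B x) \<longrightarrow> pr x n \<in> B) \<and>
    (u2 k n x \<preceq> l \<longrightarrow> \<theta>2 k n x (below B x) \<longrightarrow> pr x n \<notin> B))"

lemma good_bounded: "good B l \<longleftrightarrow>
    (\<forall>x. x \<prec> l \<longrightarrow> (\<forall>n. n \<prec> l \<longrightarrow> (\<forall>k. k \<prec> l \<longrightarrow> pr x n \<prec> l \<longrightarrow> x \<in> field \<longrightarrow>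
    (u1 k n x \<preceq> l \<longrightarrow> \<theta>1 k n x (below B x) \<longrightarrow> pr x n \<in> B) \<and>
    (u2 k n x \<preceq> l \<longrightarrow> \<theta>2 k n x (below B x) \<longrightarrow> pr x n \<notin> B))))"
proof -
  have "pr x n \<prec> l \<Longrightarrow> x \<prec> l \<and> n \<prec> l" for x n
    using le_pair1 le_pair2 ar.le_less_trans by blast
  then have "(\<forall>x n k. pr x n \<prec> l \<longrightarrow> x \<in> field \<longrightarrow> k \<prec> l \<longrightarrow> R x n k) \<longleftrightarrow>
      (\<forall>x. x \<prec> l \<longrightarrow> (\<forall>n. n \<prec> l \<longrightarrow> (\<forall>k. k \<prec> l \<longrightarrow> pr x n \<prec> l \<longrightarrow> x \<in> field \<longrightarrow> R x n k)))" for R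
    by blast
  then show ?thesis unfolding good_def .
qed

lemma Del_good:
  assumes "DelSet A" "Fn f"
  shows "Del (\<lambda>e Z. good (A e Z) (f e Z))"
  unfolding good_bounded
  by (intro Del_intros Fn_var Fn_pair Del_field Del_order Del_mem matrixD[OF matrix1] matrixD[OF matrix2] DelSet_below
      DelSet_rename[OF assms(1)] Fn_rename[OF assms(2)] assms(2))

lemma good_cong:
  assumes "\<And>i. i \<prec> l \<Longrightarrow> i \<in> B \<longleftrightarrow> i \<in> B'" "good B l"
  shows "good B' l"
proof -
  have "\<theta>1 k n x (below B x) = \<theta>1 k n x (below B' x)" if "u1 k n x \<preceq> l" for k n x
    using that assms(1) ar.less_le_trans by (intro matrixD(3)[OF matrix1] below_cong[of _ l]) blast+
  moreover have "\<theta>2 k n x (below B x) = \<theta>2 k n x (below B' x)" if "u2 k n x \<preceq> l" for k n x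
    using that assms(1) ar.less_le_trans by (intro matrixD(3)[OF matrix2] below_cong[of _ l]) blast+
  ultimately show ?thesis using assms unfolding good_def by metis
qed

lemma good_mono: "good B l \<Longrightarrow> l' \<preceq> l \<Longrightarrow> good B l'"
  unfolding good_def using ar.order.trans ar.less_le_trans by meson

text \<open>The values are computed from the decidable truncation \<open>val\<close> of the first
  kernel. A true \<open>val\<close> has a genuine witness, so by \<open>compl\<close> the second
  kernel has none at the same place. In place of a recursion along the numbers below
  \<open>l\<close> in the order of \<open>X\<close>, a least point without a partial solution is
  refuted.\<close>

lemma exists_good: "\<exists>B\<in>Sets. good B l"
proof -
  define val where "val x n W \<longleftrightarrow> (\<exists>k. k \<prec> l \<and> u1 k n x \<preceq> l \<and> \<theta>1 k n x W)" for x n W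
  define correct where "correct B x \<longleftrightarrow> (\<forall>n. n \<prec> l \<longrightarrow> pr x n \<prec> l \<longrightarrow> (pr x n \<in> B \<longleftrightarrow> val x n (below B x)))" for B x
  have Del_val: "Del (\<lambda>e Z. val (F e Z) (G e Z) (A e Z))" if "Fn F" "Fn G" "DelSet A" for F G A
    unfolding val_def
    by (intro Del_intros Fn_var Fn_const matrixD[OF matrix1] Fn_rename[OF that(1)] Fn_rename[OF that(2)] DelSet_rename[OF that(3)])
  have Del_correct: "Del (\<lambda>e Z. correct (A e Z) (F e Z))" if "Fn F" "DelSet A" for F A
    unfolding correct_def
    by (intro Del_intros Fn_var Fn_const Fn_pair Del_val Del_mem DelSet_below Fn_rename[OF that(1)] DelSet_rename[OF that(2)])
  have val_cong: "val x n (below A x) = val x n (below B x)"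
    if agree: "\<And>y n. y \<sqsubset> x \<Longrightarrow> pr y n \<prec> l \<Longrightarrow> pr y n \<in> A \<longleftrightarrow> pr y n \<in> B" for x n A B
  proof -
    have "\<theta>1 k n x (below A x) = \<theta>1 k n x (below B x)" if "u1 k n x \<preceq> l" for k
      by (intro matrixD(3)[OF matrix1] below_cong[of _ l]) (use that agree ar.less_le_trans in blast)+
    then show ?thesis unfolding val_def by blast
  qed
  have pr_less: "pr x n \<prec> l \<Longrightarrow> x \<prec> l \<and> n \<prec> l" for x n
    using le_pair1 le_pair2 ar.le_less_trans by blast
  obtain C where "\<forall>A\<in>Sets. (\<forall>i\<in>A. i \<prec> l) \<longrightarrow> (\<exists>c. c \<preceq> C \<and> is_triple c \<and> decode c = A)"
    using finite_sets_bound[of l] by (rule exE)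
  note C = this[rule_format]
  \<comment> \<open>A coded partial solution up to \<open>x\<close>. The bound \<open>C\<close>,
    uniform for all sets below \<open>l\<close>, makes its existence decidable, so that the failures
    form a set.\<close>
  define Q where "Q x \<longleftrightarrow> (\<exists>c. c \<preceq> C \<and> (\<forall>y. y \<prec> l \<longrightarrow> y \<sqsubseteq> x \<longrightarrow> correct (decode c) y))" for x
  have Del_Q: "Del (\<lambda>e Z. Q (e 0))" unfolding Q_def
    by (intro Del_intros Fn_var Fn_const Del_correct DelSet_decode Del_field Del_order)
  have max: "\<exists>x\<in>A. \<forall>y\<in>A. y \<sqsubseteq> x" if A: "A \<in> Sets" "\<And>x. x \<in> A \<Longrightarrow> x \<in> field \<and> x \<prec> l" "A \<noteq> {}" for A
  proof -
    obtain a where "a \<in> A" using A(3) by blast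
    have "\<exists>x\<in>A. x \<prec> l \<and> (\<forall>y\<in>A. y \<prec> l \<longrightarrow> y \<sqsubseteq> x)"
    proof (rule finite_min[where r = "\<lambda>x y. y \<sqsubseteq> x", OF Del_order(1)[OF Fn_var Fn_var] A(1)])
      show "a \<in> A" "a \<prec> l" using \<open>a \<in> A\<close> A(2) by auto
    qed (use order_facts(4,6) A(2) in blast)+
    then show ?thesis using A(2) by blast
  qed
  \<comment> \<open>Partial solutions need not be compared with each other: one for the greatest
    element of \<open>A\<close> serves all of \<open>A\<close>.\<close>
  have glue: "\<exists>B\<in>Sets. \<forall>y\<in>A. correct B y"
    if A: "A \<in> Sets" "\<And>x. x \<in> A \<Longrightarrow> x \<in> field \<and> x \<prec> l" "\<And>x. x \<in> A \<Longrightarrow> Q x" for A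
  proof (cases "A = {}")
    case True
    then show ?thesis using Sets_ex by blast
  next
    case False
    then obtain x where x: "x \<in> A" "\<And>y. y \<in> A \<Longrightarrow> y \<sqsubseteq> x" using max[OF A(1,2)] by blast
    obtain c where "\<And>y. y \<prec> l \<Longrightarrow> y \<sqsubseteq> x \<Longrightarrow> correct (decode c) y" using A(3)[OF x(1)] unfolding Q_def by blast
    then show ?thesis using A(2) x(2) by (intro bexI[of _ "decode c"]) auto
  qed
  have all_Q: "Q x" if x: "x \<in> field" "x \<prec> l" for x
  proof (rule ccontr)
    assume "\<not> Q x"
    define A where "A = {x. x \<in> field \<and> x \<prec> l \<and> \<not> Q x}"
    have "DelSet (\<lambda>e Z. A)" unfolding A_def
      by (intro DelSet_Collect Del_intros Fn_var Fn_const Del_field Del_order Del_Q)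
    then have A: "A \<in> Sets" using DelSet_Sets Sets_ex by blast
    have "x \<in> A" unfolding A_def using x \<open>\<not> Q x\<close> by blast
    from finite_min[of leq, OF Del_order(1)[OF Fn_var Fn_var] A _ _ this x(2)]
    obtain z where z: "z \<in> A" "\<And>y. y \<in> A \<Longrightarrow> z \<sqsubseteq> y"
      using order_facts(4,6) unfolding A_def by blast
    then have zf: "z \<in> field" "z \<prec> l" "\<not> Q z" unfolding A_def by auto
    define P where "P = {y. y \<sqsubset> z \<and> y \<prec> l}"
    have "DelSet (\<lambda>e Z. P)" unfolding P_def
      by (intro DelSet_Collect Del_intros Fn_var Fn_const Del_field Del_order)
    then have P: "P \<in> Sets" using DelSet_Sets Sets_ex by blast
    have "Q y" if "y \<in> P" for y
      using that z(2)[of y] order_facts(7,10,11) zf unfolding P_def A_def by (auto simp: lessX_def)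
    then obtain B0 where B0: "B0 \<in> Sets" "\<And>y. y \<in> P \<Longrightarrow> correct B0 y"
      using glue[OF P] order_facts(7) unfolding P_def by auto
    \<comment> \<open>The rows before \<open>z\<close> come from \<open>B0\<close>, and row
      \<open>z\<close> is computed from them. Cutting off at \<open>l\<close> ensures a code of size
      at most \<open>C\<close>.\<close>
    define B where "B = {y. \<exists>x. x \<prec> l \<and> (\<exists>n. n \<prec> l \<and> y = pr x n \<and> y \<prec> l \<and>
        (x \<sqsubset> z \<and> y \<in> B0 \<or> x = z \<and> val x n (below B0 z)))}"
    have "DelSet (\<lambda>e Z. B)" unfolding B_def
      by (intro DelSet_Collect Del_intros Fn_var Fn_const Fn_pair Del_field Del_order Del_val Del_memA B0
          DelSet_below DelSet_const)
    then have B: "B \<in> Sets" using DelSet_Sets Sets_ex by blast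
    have B_iff: "pr x n \<in> B \<longleftrightarrow> pr x n \<prec> l \<and> (x \<sqsubset> z \<and> pr x n \<in> B0 \<or> x = z \<and> val x n (below B0 z))" for x n
      unfolding B_def mem_Collect_eq pair_eq_iff using pr_less[of x n] by blast
    have agree: "pr y n \<in> B \<longleftrightarrow> pr y n \<in> B0" if "y \<sqsubset> z" "pr y n \<prec> l" for y n
      using that order_facts(10) unfolding B_iff by blast
    have "correct B y" if y: "y \<prec> l" "y \<sqsubseteq> z" for y
    proof (cases "y = z")
      case True
      have "val z n (below B z) = val z n (below B0 z)" for n by (rule val_cong) (rule agree)
      then show ?thesis using True order_facts(10) unfolding correct_def B_iff by simp
    next
      case False
      then have yz: "y \<sqsubset> z" using y order_facts(5) unfolding lessX_def by blast
      then have "correct B0 y" using B0(2) y unfolding P_def by blast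
      moreover have "val y n (below B y) = val y n (below B0 y)" for n
        using agree order_facts(9) yz by (intro val_cong) blast
      ultimately show ?thesis using agree[OF yz] unfolding correct_def by blast
    qed
    moreover obtain c where "c \<preceq> C" "decode c = B"
      using C[OF B] unfolding B_def by blast
    ultimately have "Q z" unfolding Q_def by blast
    then show False using zf by blast
  qed
  define F where "F = {x. x \<in> field \<and> x \<prec> l}"
  have "DelSet (\<lambda>e Z. F)" unfolding F_def
    by (intro DelSet_Collect Del_intros Fn_var Fn_const Del_field Del_order)
  then have F: "F \<in> Sets" using DelSet_Sets Sets_ex by blast
  obtain B where B: "B \<in> Sets" "\<And>y. y \<in> field \<Longrightarrow> y \<prec> l \<Longrightarrow> correct B y"
    using glue[OF F] all_Q unfolding F_def by auto
  have "good B l" unfolding good_def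
  proof (intro allI impI)
    fix x n k assume *: "pr x n \<prec> l" "x \<in> field" "k \<prec> l"
    then have iff: "pr x n \<in> B \<longleftrightarrow> val x n (below B x)"
      using B(2) pr_less unfolding correct_def by blast
    moreover have "\<not> \<theta>2 k n x (below B x)" if "val x n (below B x)"
      using that compl[OF *(2) below_Sets[OF B(1)]] unfolding val_def by blast
    ultimately show "(u1 k n x \<preceq> l \<longrightarrow> \<theta>1 k n x (below B x) \<longrightarrow> pr x n \<in> B) \<and>
        (u2 k n x \<preceq> l \<longrightarrow> \<theta>2 k n x (below B x) \<longrightarrow> pr x n \<notin> B)"
      using *(3) unfolding val_def by blast
  qed
  then show ?thesis using B(1) by blast
qed

lemma WKL_recursion:
  assumes "WKL M"
  shows "\<exists>Y\<in>Sets. recH M (\<lambda>n x Z. \<exists>k. \<theta>1 k n x Z) X Y"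
proof -
  \<comment> \<open>The bound on \<open>l\<close> comes from \<open>le_seq_code\<close> and makes
    \<open>T\<close> decidable.\<close>
  define T where "T = {c. \<exists>l. l \<preceq> c \<and> c = seq_code (seq_set c) l \<and> good (seq_set c) l}"
  have "DelSet (\<lambda>e Z. T)" unfolding T_def
    by (intro DelSet_Collect Del_intros Fn_var Fn_seq_code DelSet_seq_set Del_good)
  then have T: "T \<in> Sets" using DelSet_Sets Sets_ex by blast
  have T_iff: "seq_code B l \<in> T \<longleftrightarrow> good B l" if B: "B \<in> Sets" for B l
  proof
    assume "seq_code B l \<in> T"
    then obtain l' where l': "seq_code B l = seq_code (seq_set (seq_code B l)) l'" "good (seq_set (seq_code B l)) l'" unfolding T_def by blast
    then have eq: "l' = l" using seq_code_eq[OF B seq_set_Sets, of l "seq_code B l" l'] by simp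
    show "good B l" by (rule good_cong[OF _ l'(2)[unfolded eq]]) (simp add: seq_set_seq_code[OF B])
  next
    assume "good B l"
    then have "good (seq_set (seq_code B l)) l" by (rule good_cong[rotated]) (simp add: seq_set_seq_code[OF B])
    then show "seq_code B l \<in> T" unfolding T_def using le_seq_code[OF B] seq_code_seq_set[OF B] by (intro CollectI exI[of _ l]) simp
  qed
  have T_ex: "\<exists>B\<in>Sets. \<exists>l. c = seq_code B l" if "c \<in> T" for c
    using that unfolding T_def by (auto intro: bexI[OF _ seq_set_Sets])
  have "binary_tree M T" unfolding binary_tree_def
  proof (intro conjI ballI allI impI)
    fix c assume "c \<in> T"
    then show "\<exists>l A. codes_binseq M c l A" using T_ex unfolding codes_binseq_iff by blast
  next
    fix c l A c' l' A'
    assume c: "c \<in> T" and *: "codes_binseq M c l A \<and> codes_binseq M c' l' A' \<and> A' \<subseteq> A"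
    then obtain B B' where B: "B \<in> Sets" "c = seq_code B l" "B' \<in> Sets" "c' = seq_code B' l'" "seg B' l' \<subseteq> seg B l"
      unfolding codes_binseq_iff by blast
    have "good B l'" using good_mono c B(2,5) T_iff[OF B(1)] unfolding seg_subset by blast
    then have "good B' l'" by (rule good_cong[rotated]) (use B(5) seg_subset in blast)
    then show "c' \<in> T" using T_iff B by blast
  qed
  moreover have "infiniteM M T" unfolding infiniteM_def
  proof
    fix m
    \<comment> \<open>Length \<open>m \<oplus> \<one>\<close> suffices, as codes are at least as
      large as lengths.\<close>
    obtain B where "B \<in> Sets" "good B (m \<oplus> \<one>)" using exists_good by blast
    then show "\<exists>n\<in>T. m \<prec> n"
      using T_iff le_seq_code[of B "m \<oplus> \<one>"] Suc_le_iff by blast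
  qed
  ultimately obtain g where g: "is_path M T g" using assms T unfolding WKL_def by blast
  define G where "G = {pr n (g n) | n. True}"
  have G: "G \<in> Sets" using g unfolding is_path_def internal_fun_def G_def by blast
  have G_iff: "pr i j \<in> G \<longleftrightarrow> j = g i" for i j unfolding G_def by auto
  define B where "B = {i. pr i \<one> \<in> G}"
  have "DelSet (\<lambda>e Z. B)" unfolding B_def by (intro DelSet_Collect Del_memA G Fn_intros)
  then have B: "B \<in> Sets" using DelSet_Sets Sets_ex by blast
  have good: "good B l" for l
  proof -
    obtain c where c: "c \<in> T" "codes_seq M c l {pr i (g i) | i. i \<prec> l}"
      using g unfolding is_path_def by blast
    obtain B' l' where B': "B' \<in> Sets" "c = seq_code B' l'" using T_ex[OF c(1)] by blast
    have "codes_finite M (seq_code B' l') {pr i (g i) | i. i \<prec> l}"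
      using c(2) unfolding codes_seq_def B'(2) by (rule conjunct1)
    then have "{pr i (g i) | i. i \<prec> l} = seg B' l'"
      using decode_seq_code[OF B'(1), of l'] unfolding codes_iff by simp
    then have "pr i j \<in> {pr i (g i) | i. i \<prec> l} \<longleftrightarrow> pr i j \<in> seg B' l'" for i j by (rule arg_cong)
    then have *: "i \<prec> l \<and> j = g i \<longleftrightarrow> i \<prec> l' \<and> j = chi B' i" for i j by auto
    have "i \<prec> l \<longleftrightarrow> i \<prec> l'" for i using * by blast
    then have "l = l'" using less_linear less_irrefl by metis
    moreover have "i \<in> B' \<longleftrightarrow> i \<in> B" if "i \<prec> l" for i
      using * that unfolding B_def G_iff mem_Collect_eq by (metis chi_eq(2))
    ultimately show ?thesis using good_cong[of l B' B] T_iff[OF B'(1)] c(1) B'(2) by blast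
  qed
  have B_iff: "pr x n \<in> B \<longleftrightarrow> (\<exists>k. \<theta>1 k n x (below B x))" if x: "x \<in> field" for x n
  proof -
    \<comment> \<open>Along the path every witness eventually becomes binding: \<open>l\<close> only
      has to exceed the place and the witness, and to reach the use.\<close>
    have ub: "\<exists>l. pr x n \<prec> l \<and> k \<prec> l \<and> u \<preceq> l" for k u
    proof (intro exI conjI)
      show "pr x n \<prec> pr x n \<oplus> (k \<oplus> u) \<oplus> \<one>" by (rule less_Suc_add)
      show "k \<prec> pr x n \<oplus> (k \<oplus> u) \<oplus> \<one>" using less_Suc_add add_le1 ar.le_less_trans by blast
      show "u \<preceq> pr x n \<oplus> (k \<oplus> u) \<oplus> \<one>"
        using less_Suc_add add_le2 ar.le_less_trans unfolding le_def by metis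
    qed
    have "pr x n \<in> B" if "\<theta>1 k n x (below B x)" for k
      using ub[of k "u1 k n x"] good that x unfolding good_def by blast
    moreover have "pr x n \<notin> B" if "\<theta>2 k n x (below B x)" for k
      using ub[of k "u2 k n x"] good that x unfolding good_def by blast
    ultimately show ?thesis using compl[OF x below_Sets[OF B]] by blast
  qed
  \<comment> \<open>\<open>good\<close> says nothing about numbers that are not pairs over the
    field, so the path is arbitrary there and these numbers are discarded.\<close>
  define Y where "Y = {y. \<exists>x. x \<preceq> y \<and> (\<exists>n. n \<preceq> y \<and> y = pr x n \<and> x \<in> field \<and> y \<in> B)}"
  have "DelSet (\<lambda>e Z. Y)" unfolding Y_def
    by (intro DelSet_Collect Del_intros Fn_var Fn_pair Del_field Del_order Del_memA B)
  then have Y: "Y \<in> Sets" using DelSet_Sets Sets_ex by blast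
  have Y_eq: "Y = {pr x n | x n. x \<in> field \<and> pr x n \<in> B}"
    unfolding Y_def using le_pair1 le_pair2 by blast
  have "below Y x = below B x" for x
    unfolding restr_def Y_eq using order_facts(7) by auto
  then have "recH M (\<lambda>n x Z. \<exists>k. \<theta>1 k n x Z) X Y"
    unfolding recH_def using B_iff Y_eq by auto
  then show ?thesis using Y by blast
qed

end

lemma WKL_imp_WETR:
  assumes "WKL M"
  shows "WETR M X"
  unfolding WETR_def
proof (intro allI impI)
  fix \<phi> \<psi> e s
  assume "Sigma01 \<phi> \<and> Sigma01 \<psi> \<and> range s \<subseteq> Sets"
    and compl: "\<forall>n. \<forall>x\<in>field. \<forall>Z\<in>Sets. inst M e s \<phi> n x Z \<longleftrightarrow> \<not> inst M e s \<psi> n x Z"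
  then have s: "Sigma01 \<phi>" "Sigma01 \<psi>" "range s \<subseteq> Sets" by auto
  obtain \<theta>1 u1 where 1: "matrix \<theta>1 u1" "\<And>n x W. inst M e s \<phi> n x W \<longleftrightarrow> (\<exists>k. \<theta>1 k n x W)"
    using Sigma01_matrix[OF s(1,3), of e] by blast
  obtain \<theta>2 u2 where 2: "matrix \<theta>2 u2" "\<And>n x W. inst M e s \<psi> n x W \<longleftrightarrow> (\<exists>k. \<theta>2 k n x W)"
    using Sigma01_matrix[OF s(2,3), of e] by blast
  have "inst M e s \<phi> = (\<lambda>n x Z. \<exists>k. \<theta>1 k n x Z)" by (intro ext) (rule 1(2))
  then show "\<exists>Y\<in>Sets. recH M (inst M e s \<phi>) X Y"
    using WKL_recursion[OF 1(1) 2(1) _ assms] compl 1(2) 2(2) by auto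
qed

section \<open>Primitive recursion\<close>

text \<open>Turns the variable set into a parameter by shifting the set variables of the formula
  past position 0. In this way a statement about all \<open>Z\<close> can be used for one particular
  set.\<close>

lemma Bdd_fix:
  assumes "Bdd R" "A \<in> Sets"
  shows "Bdd (\<lambda>e Z. R e A)"
proof -
  obtain p par sp where p: "bounded_fm p" "range sp \<subseteq> Sets"
    "\<forall>e. \<forall>Z\<in>Sets. sat M (interleave e par) (case_nat Z sp) p \<longleftrightarrow> R e Z"
    using assms(1) by (rule BddE)
  obtain p' where p': "bounded_fm p'" "\<forall>e s. sat M e s p' \<longleftrightarrow>
      sat M (\<lambda>i. tm_val M e (Var i)) (\<lambda>k. s (Suc k)) p"
    using bounded_subst[OF p(1), of M Var Suc] by (elim exE conjE) (rule that)
  have "range (case_nat A sp) \<subseteq> Sets"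
    using assms(2) p(2) by (auto split: nat.splits simp: subset_iff)
  then show ?thesis unfolding Bdd_def using p p' assms(2)
    by (intro exI[of _ p'] exI[of _ par] exI[of _ "case_nat A sp"]) simp
qed

lemma Sig_fix:
  assumes "Sig R" "A \<in> Sets"
  shows "Sig (\<lambda>e Z. R e A)"
proof -
  obtain R0 where R0: "Bdd R0" "\<forall>e Z. Z \<in> Sets \<longrightarrow> R e Z \<longleftrightarrow> (\<exists>a. R0 (case_nat a e) Z)"
    using assms(1) by (rule SigE)
  show ?thesis unfolding Sig_def using R0(2) assms(2)
    by (intro exI[of _ "\<lambda>e Z. R0 e A"] conjI Bdd_fix[OF R0(1)]) auto
qed

text \<open>\<open>ok c t\<close> says that \<open>c\<close> codes a computation up to
  \<open>t\<close>. Computations exist by Sigma_1 induction and agree where both are defined, which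
  gives \<open>f\<close> a Sigma_1 graph; totality then makes the graph a set.\<close>

lemma iteration:
  assumes g: "Fn (\<lambda>e Z. g (e 0))"
  shows "\<exists>f. f \<zero> = p \<and> (\<forall>n. f (n \<oplus> \<one>) = g (f n)) \<and> {pr n (f n) | n. True} \<in> Sets"
proof -
  define ok where "ok c t \<longleftrightarrow> (\<forall>i. i \<preceq> t \<longrightarrow> (\<exists>q. q \<prec> c \<and> pr i q \<in> decode c)) \<and>
    (\<forall>q. q \<prec> c \<longrightarrow> pr \<zero> q \<in> decode c \<longrightarrow> q = p) \<and>
    (\<forall>i. i \<prec> t \<longrightarrow> (\<forall>q. q \<prec> c \<longrightarrow> pr (i \<oplus> \<one>) q \<in> decode c \<longrightarrow>
      (\<exists>q'. q' \<prec> c \<and> pr i q' \<in> decode c \<and> q = g q')))" for c t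
  have Del_ok: "Del (\<lambda>e Z. ok (e 0) (e 1))" unfolding ok_def
    by (intro Del_intros Fn_var Fn_const Fn_pair Fn_add Del_decode Fn_app1[OF g])
  have less: "q \<prec> c" if "pr i q \<in> decode c" for i q c
    using decode_less[OF that] le_pair2 ar.le_less_trans by blast
  have ok1: "\<exists>q. pr i q \<in> decode c" if "ok c t" "i \<preceq> t" for c t i
    using that unfolding ok_def by blast
  have ok2: "q = p" if "ok c t" "pr \<zero> q \<in> decode c" for c t q
    using that less[OF that(2)] unfolding ok_def by blast
  have ok3: "\<exists>q'. pr i q' \<in> decode c \<and> q = g q'" if "ok c t" "i \<prec> t" "pr (i \<oplus> \<one>) q \<in> decode c" for c t i q
    using that less[OF that(3)] unfolding ok_def by blast
  have uniq: "q = q'" if h: "ok c t" "ok c' t'" "i \<preceq> t" "i \<preceq> t'" "pr i q \<in> decode c" "pr i q' \<in> decode c'"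
    for c t c' t' i q q'
  proof -
    have "i \<preceq> t \<longrightarrow> i \<preceq> t' \<longrightarrow> (\<forall>q. q \<prec> c \<longrightarrow> (\<forall>q'. q' \<prec> c' \<longrightarrow> pr i q \<in> decode c \<longrightarrow> pr i q' \<in> decode c' \<longrightarrow> q = q'))"
    proof (rule Sig_ind[where P = "\<lambda>i. i \<preceq> t \<longrightarrow> i \<preceq> t' \<longrightarrow>
        (\<forall>q. q \<prec> c \<longrightarrow> (\<forall>q'. q' \<prec> c' \<longrightarrow> pr i q \<in> decode c \<longrightarrow> pr i q' \<in> decode c' \<longrightarrow> q = q'))"])
      show "Sig (\<lambda>e Z. e 0 \<preceq> t \<longrightarrow> e 0 \<preceq> t' \<longrightarrow>
        (\<forall>q. q \<prec> c \<longrightarrow> (\<forall>q'. q' \<prec> c' \<longrightarrow> pr (e 0) q \<in> decode c \<longrightarrow> pr (e 0) q' \<in> decode c' \<longrightarrow> q = q')))"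
        by (intro Del_Sig Del_intros Fn_var Fn_const Fn_pair Del_decode)
      show "\<zero> \<preceq> t \<longrightarrow> \<zero> \<preceq> t' \<longrightarrow>
        (\<forall>q. q \<prec> c \<longrightarrow> (\<forall>q'. q' \<prec> c' \<longrightarrow> pr \<zero> q \<in> decode c \<longrightarrow> pr \<zero> q' \<in> decode c' \<longrightarrow> q = q'))"
        using ok2 h by blast
    next
      fix i
      assume IH: "i \<preceq> t \<longrightarrow> i \<preceq> t' \<longrightarrow>
        (\<forall>q. q \<prec> c \<longrightarrow> (\<forall>q'. q' \<prec> c' \<longrightarrow> pr i q \<in> decode c \<longrightarrow> pr i q' \<in> decode c' \<longrightarrow> q = q'))"
      show "i \<oplus> \<one> \<preceq> t \<longrightarrow> i \<oplus> \<one> \<preceq> t' \<longrightarrow>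
        (\<forall>q. q \<prec> c \<longrightarrow> (\<forall>q'. q' \<prec> c' \<longrightarrow> pr (i \<oplus> \<one>) q \<in> decode c \<longrightarrow> pr (i \<oplus> \<one>) q' \<in> decode c' \<longrightarrow> q = q'))"
        unfolding Suc_le_iff
      proof (intro impI allI)
        fix q q' assume i: "i \<prec> t" "i \<prec> t'" and q: "pr (i \<oplus> \<one>) q \<in> decode c" "pr (i \<oplus> \<one>) q' \<in> decode c'"
        obtain r where r: "pr i r \<in> decode c" "q = g r" using ok3[OF h(1) i(1) q(1)] by blast
        obtain r' where r': "pr i r' \<in> decode c'" "q' = g r'" using ok3[OF h(2) i(2) q(2)] by blast
        have "r = r'" using IH less[OF r(1)] less[OF r'(1)] r(1) r'(1) i unfolding le_def by blast
        then show "q = q'" using r r' by simp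
      qed
    qed
    then show ?thesis using h less[OF h(5)] less[OF h(6)] by blast
  qed
  have ex: "\<exists>c. ok c t" for t
  proof (rule Sig_ind[where P = "\<lambda>t. \<exists>c. ok c t"])
    show "Sig (\<lambda>e Z. \<exists>c. ok c (e 0))"
      by (rule Sig_ex) (rule Del_Sig[OF Del_app2[OF Del_ok Fn_var Fn_var]])
  next
    obtain C where C: "\<forall>A\<in>Sets. (\<forall>i\<in>A. i \<prec> pr \<zero> p \<oplus> \<one>) \<longrightarrow> (\<exists>c. c \<preceq> C \<and> is_triple c \<and> decode c = A)"
      using finite_sets_bound by blast
    have "DelSet (\<lambda>e Z. {y. y = pr \<zero> p})" by (intro DelSet_Collect Del_intros Fn_intros)
    then have "{pr \<zero> p} \<in> Sets" using DelSet_Sets Sets_ex by fastforce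
    then obtain c where c: "decode c = {pr \<zero> p}" using C by (auto simp: le_def)
    then have "p \<prec> c" using less[of \<zero> p c] by simp
    then have "ok c \<zero>" unfolding ok_def using c by (auto simp: le_def)
    then show "\<exists>c. ok c \<zero>" by blast
  next
    fix t assume "\<exists>c. ok c t"
    then obtain c where c: "ok c t" by blast
    then obtain r where r: "pr t r \<in> decode c" using ok1[OF c] by (auto simp: le_def)
    \<comment> \<open>Only the entries up to \<open>t\<close> are kept, since \<open>c\<close> may
      contain stray values at \<open>t \<oplus> \<one>\<close>, where \<open>ok c t\<close> imposes
      nothing.\<close>
    define A where "A = {y. (y \<in> decode c \<and> (\<exists>i. i \<preceq> t \<and> (\<exists>q. q \<preceq> y \<and> y = pr i q))) \<or> y = pr (t \<oplus> \<one>) (g r)}"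
    have "DelSet (\<lambda>e Z. A)" unfolding A_def
      by (intro DelSet_Collect Del_intros Fn_var Fn_const Fn_pair Del_decode)
    then have "A \<in> Sets" using DelSet_Sets Sets_ex by blast
    moreover have A_less: "y \<prec> c \<oplus> pr (t \<oplus> \<one>) (g r) \<oplus> \<one>" if "y \<in> A" for y
      using that decode_less ar.less_le_trans[OF _ add_le1] less_Suc_add unfolding A_def
      by (metis (mono_tags, lifting) mem_Collect_eq less_trans)
    ultimately obtain c' where c': "decode c' = A"
      using finite_sets_bound[of "c \<oplus> pr (t \<oplus> \<one>) (g r) \<oplus> \<one>"] by blast
    have A_iff: "pr i q \<in> decode c' \<longleftrightarrow> pr i q \<in> decode c \<and> i \<preceq> t \<or> i = t \<oplus> \<one> \<and> q = g r" for i q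
      unfolding c' A_def using le_pair2 by auto
    have "t \<oplus> \<one> \<noteq> \<zero>" "\<not> t \<oplus> \<one> \<preceq> t" using Suc_le_iff less_irrefl by auto
    have 1: "\<exists>q. q \<prec> c' \<and> pr i q \<in> decode c'" if "i \<preceq> t \<oplus> \<one>" for i
    proof -
      have "\<exists>q. pr i q \<in> decode c'"
      proof (cases "i = t \<oplus> \<one>")
        case True then show ?thesis unfolding A_iff by blast
      next
        case False
        then have "i \<preceq> t" using that unfolding le_def[of i "t \<oplus> \<one>"] by simp
        then show ?thesis using ok1[OF c] unfolding A_iff by blast
      qed
      then show ?thesis using less by blast
    qed
    have 2: "q = p" if "pr \<zero> q \<in> decode c'" for q
      using that ok2[OF c] \<open>t \<oplus> \<one> \<noteq> \<zero>\<close> unfolding A_iff by metis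
    have 3: "\<exists>q'. q' \<prec> c' \<and> pr i q' \<in> decode c' \<and> q = g q'"
      if i: "i \<prec> t \<oplus> \<one>" "pr (i \<oplus> \<one>) q \<in> decode c'" for i q
    proof (cases "i = t")
      case True
      then have "q = g r" using i(2) \<open>\<not> t \<oplus> \<one> \<preceq> t\<close> unfolding A_iff by blast
      moreover have "pr t r \<in> decode c'" using r unfolding A_iff by (simp add: le_def)
      ultimately show ?thesis using True less by blast
    next
      case False
      then have it: "i \<prec> t" using i(1) unfolding arith_axioms le_def by blast
      then have "pr (i \<oplus> \<one>) q \<in> decode c" using i(2) False unfolding A_iff by simp
      then obtain q' where "pr i q' \<in> decode c" "q = g q'" using ok3[OF c it] by blast
      moreover then have "pr i q' \<in> decode c'" using it unfolding A_iff le_def by blast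
      ultimately show ?thesis using less by blast
    qed
    have "ok c' (t \<oplus> \<one>)" unfolding ok_def using 1 2 3 by blast
    then show "\<exists>c. ok c (t \<oplus> \<one>)" by blast
  qed
  define f where "f t = (THE q. \<exists>c. ok c t \<and> pr t q \<in> decode c)" for t
  have f_eq: "f t = q \<longleftrightarrow> (\<exists>c. ok c t \<and> pr t q \<in> decode c)" for t q
  proof -
    have *: "\<exists>!q. \<exists>c. ok c t \<and> pr t q \<in> decode c"
      using ex[of t] ok1[of _ t t] uniq[of _ t _ t t] unfolding le_def by metis
    show ?thesis unfolding f_def using the1_equality[OF *] theI'[OF *] by blast
  qed
  have f0: "f \<zero> = p"
  proof -
    obtain c q where "ok c \<zero>" "pr \<zero> q \<in> decode c" using ex[of \<zero>] ok1 by (metis zero_le)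
    then show ?thesis using f_eq ok2 by blast
  qed
  have fS: "f (n \<oplus> \<one>) = g (f n)" for n
  proof -
    obtain c q where c: "ok c (n \<oplus> \<one>)" "pr (n \<oplus> \<one>) q \<in> decode c"
      using ex[of "n \<oplus> \<one>"] ok1[of _ "n \<oplus> \<one>" "n \<oplus> \<one>"] unfolding le_def by blast
    have n: "n \<prec> n \<oplus> \<one>" by (simp add: le_def)
    obtain q' where q': "pr n q' \<in> decode c" "q = g q'" using ok3[OF c(1) n c(2)] by blast
    obtain c' where c': "ok c' n" "pr n (f n) \<in> decode c'" using f_eq[of n "f n"] by blast
    have "q' = f n" using uniq[OF c(1) c'(1) _ _ q'(1) c'(2)] n unfolding le_def by blast
    then show ?thesis using f_eq[of "n \<oplus> \<one>" q] c q'(2) by blast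
  qed
  have "Sig (\<lambda>e Z. \<exists>c. ok c (e 1) \<and> pr (e 1) (e 0) \<in> decode c)"
    by (intro Sig_ex Del_Sig Del_conj Del_decode Fn_var Fn_pair Del_app2[OF Del_ok])
  then have "Sig (\<lambda>e Z. f (e 1) = e 0)" unfolding f_eq .
  then have Fn_f: "Fn (\<lambda>e Z. f (e 0))" unfolding Fn_def by simp
  have "DelSet (\<lambda>e Z. {y. \<exists>n. n \<preceq> y \<and> y = pr n (f n)})"
    by (intro DelSet_Collect Del_intros Fn_var Fn_pair Fn_app1[OF Fn_f])
  then have "{y. \<exists>n. n \<preceq> y \<and> y = pr n (f n)} \<in> Sets" using DelSet_Sets Sets_ex by blast
  moreover have "{y. \<exists>n. n \<preceq> y \<and> y = pr n (f n)} = {pr n (f n) | n. True}" using le_pair1 by blast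
  ultimately show ?thesis using f0 fS by auto
qed

section \<open>From decidable relations back to formulas\<close>

lemma Del_formulas:
  assumes "Del (\<lambda>e Z. R (e 0) (e 1) Z)"
  shows "\<exists>\<phi> \<psi> e s. Sigma01 \<phi> \<and> Sigma01 \<psi> \<and> range s \<subseteq> Sets \<and>
    (\<forall>n x. \<forall>Z\<in>Sets. (inst M e s \<phi> n x Z \<longleftrightarrow> R n x Z) \<and> (inst M e s \<psi> n x Z \<longleftrightarrow> \<not> R n x Z))"
proof -
  obtain R1 where R1: "Bdd R1" "\<forall>e Z. Z \<in> Sets \<longrightarrow> R (e 0) (e 1) Z \<longleftrightarrow> (\<exists>a. R1 (case_nat a e) Z)"
    using Del_Sig[OF assms] by (rule SigE)
  obtain R2 where R2: "Bdd R2" "\<forall>e Z. Z \<in> Sets \<longrightarrow> \<not> R (e 0) (e 1) Z \<longleftrightarrow> (\<exists>a. R2 (case_nat a e) Z)"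
    using Del_Sig[OF Del_neg[OF assms]] by (rule SigE)
  obtain p q par sp where p: "bounded_fm p" "bounded_fm q" "range sp \<subseteq> Sets"
    "\<forall>e. \<forall>Z\<in>Sets. sat M (interleave e par) (case_nat Z sp) p \<longleftrightarrow> R1 e Z"
    "\<forall>e. \<forall>Z\<in>Sets. sat M (interleave e par) (case_nat Z sp) q \<longleftrightarrow> R2 e Z"
    using Bdd_pair[OF R1(1) R2(1)] by (elim exE conjE) (rule that)
  \<comment> \<open>\<open>R\<close> reads only the first two positions of the context, so all later
    ones may repeat variable 1; the parameters start at variable 2.\<close>
  define \<tau> where "\<tau> i = (if i = 0 then Var 0 else Var 1)" for i :: nat
  define \<pi> where "\<pi> i = Var (Suc (Suc i))" for i :: nat
  obtain j p' where p': "bounded_fm p'" "\<forall>e s a. sat M (e(j := a)) s p' \<longleftrightarrow>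
      sat M (interleave (case_nat a (\<lambda>i. tm_val M e (\<tau> i))) (\<lambda>i. tm_val M e (\<pi> i))) s p"
    using bounded_quantify_interleave[OF p(1), of "{}" M \<tau> \<pi>] by auto
  obtain k q' where q': "bounded_fm q'" "\<forall>e s a. sat M (e(k := a)) s q' \<longleftrightarrow>
      sat M (interleave (case_nat a (\<lambda>i. tm_val M e (\<tau> i))) (\<lambda>i. tm_val M e (\<pi> i))) s q"
    using bounded_quantify_interleave[OF p(2), of "{}" M \<tau> \<pi>] by auto
  obtain A where A: "A \<in> Sets" using Sets_ex by blast
  \<comment> \<open>The values at 0 and 1 are placeholders, overwritten by \<open>n\<close> and
    \<open>x\<close>; likewise the set \<open>A\<close> at position 0 of \<open>s\<close> gives way
    to \<open>Z\<close>.\<close>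
  define E where "E i = par (i - 2)" for i
  define s where "s = case_nat A sp"
  define c where "c n x i = (if i = 0 then n else x)" for n x :: 'm and i :: nat
  have c: "(\<lambda>i. tm_val M (E(0 := n, 1 := x)) (\<tau> i)) = c n x"
    "(\<lambda>i. tm_val M (E(0 := n, 1 := x)) (\<pi> i)) = par" for n x
    by (auto simp: \<tau>_def \<pi>_def E_def c_def)
  have s: "s(0 := Z) = case_nat Z sp" for Z
    by (rule ext) (simp add: s_def split: nat.split)
  have "inst M E s (ExN j p') n x Z \<longleftrightarrow> R n x Z" if "Z \<in> Sets" for n x Z
    unfolding inst_def sat.simps p'(2)[rule_format] c s
    using p(4) R1(2)[rule_format, OF that, of "c n x"] that by (simp add: c_def)
  moreover have "inst M E s (ExN k q') n x Z \<longleftrightarrow> \<not> R n x Z" if "Z \<in> Sets" for n x Z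
    unfolding inst_def sat.simps q'(2)[rule_format] c s
    using p(5) R2(2)[rule_format, OF that, of "c n x"] that by (simp add: c_def)
  moreover have "range s \<subseteq> Sets" unfolding s_def
    using A p(3) by (auto split: nat.splits simp: subset_iff)
  moreover have "Sigma01 (ExN j p')" "Sigma01 (ExN k q')" using p'(1) q'(1) unfolding Sigma01_def by auto
  ultimately show ?thesis by blast
qed

end

section \<open>Well-foundedness for Sigma_1 properties\<close>

context rca0_order
begin

text \<open>A well-order of the model only excludes descending sequences that are sets of the model,
  while \<open>V\<close> need not be a set. The descent therefore runs through pairs of a witness
  for \<open>V\<close> and an element, for which the search is decidable and can be
  iterated.\<close>

lemma well_founded:
  assumes wo: "well_orderM M X" and V: "Sig (\<lambda>e Z. V (e 0))"
    and step: "\<And>x. x \<in> field \<Longrightarrow> V x \<Longrightarrow> \<exists>y. y \<sqsubset> x \<and> V y"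
    and x: "x \<in> field"
  shows "\<not> V x"
proof
  assume Vx: "V x"
  obtain A where A: "A \<in> Sets" using Sets_ex by blast
  obtain R0 where R0: "Bdd R0" "\<forall>e Z. Z \<in> Sets \<longrightarrow> V (e 0) \<longleftrightarrow> (\<exists>a. R0 (case_nat a e) Z)"
    using V by (rule SigE)
  \<comment> \<open>\<open>V\<close> depends only on the front of the context and not on the set, so
    a constant stream and an arbitrary fixed set may be inserted.\<close>
  define V0 where "V0 a x = R0 (case_nat a (\<lambda>_. x)) A" for a x
  have V_iff: "V x \<longleftrightarrow> (\<exists>a. V0 a x)" for x
    using R0(2)[rule_format, OF A, of "\<lambda>_. x"] unfolding V0_def by simp
  have Del_V0: "Del (\<lambda>e Z. V0 (e 0) (e 1))"
    unfolding V0_def by (intro Del_Bdd Bdd_fix Bdd_rename1 R0(1) A)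
  \<comment> \<open>The second component of a pair. The alternative \<open>p \<preceq> x\<close>
    ends the search at numbers that are not pairs and never before the component of a genuine
    pair.\<close>
  define sn where "sn p = leastM (\<lambda>x. p \<preceq> x \<or> (\<exists>a. a \<preceq> p \<and> p = pr a x))" for p
  have Fn_sn: "Fn (\<lambda>e Z. sn (e 0))" unfolding sn_def
    by (rule Fn_leastM) (intro Del_intros Fn_var Fn_pair, auto simp: le_def)
  have sn: "sn (pr a x) = x" for a x
    unfolding sn_def
  proof (rule leastM_eq)
    show "pr a x \<preceq> x \<or> (\<exists>b. b \<preceq> pr a x \<and> pr a x = pr b x)" using le_pair1 by blast
    fix k assume k: "k \<prec> x"
    then have "\<not> pr a x \<preceq> k" using le_pair2[of x a] ar.le_less_trans less_irrefl ar.order.trans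
      by (meson ar.leD)
    then show "\<not> (pr a x \<preceq> k \<or> (\<exists>b. b \<preceq> pr a x \<and> pr a x = pr b k))"
      using k less_irrefl by auto
  qed
  define inv where "inv p \<longleftrightarrow> (\<exists>a. a \<preceq> p \<and> p = pr a (sn p) \<and> sn p \<in> field \<and> V0 a (sn p))" for p
  have Del_inv: "Del (\<lambda>e Z. inv (e 0))" unfolding inv_def
    by (intro Del_intros Fn_var Fn_pair Fn_app1[OF Fn_sn] Del_field Del_app2[OF Del_V0])
  have inv: "inv (pr a x) \<longleftrightarrow> x \<in> field \<and> V0 a x" for a x
    unfolding inv_def sn using le_pair1 by auto
  \<comment> \<open>The disjunct \<open>\<not> inv p\<close> makes the search total; starting from a
    pair that satisfies \<open>inv\<close>, it is never the reason for stopping.\<close>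
  define g where "g p = leastM (\<lambda>q. \<not> inv p \<or> inv q \<and> sn q \<sqsubset> sn p)" for p
  have ex: "\<exists>q. \<not> inv p \<or> inv q \<and> sn q \<sqsubset> sn p" for p
  proof (cases "inv p")
    case True
    then have "sn p \<in> field" "V (sn p)" unfolding inv_def V_iff by auto
    then obtain y b where "y \<sqsubset> sn p" "V0 b y" using step V_iff by blast
    then show ?thesis using inv sn order_facts(7) by (intro exI[of _ "pr b y"]) simp
  qed simp
  have Del_g: "Del (\<lambda>e Z. \<not> inv (e 1) \<or> inv (e 0) \<and> sn (e 0) \<sqsubset> sn (e 1))"
    by (intro Del_intros Fn_var Fn_app1[OF Fn_sn] Del_order Del_app1[OF Del_inv])
  have Fn_g: "Fn (\<lambda>e Z. g (e 0))" unfolding g_def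
    by (rule Fn_leastM) (use Del_g ex in simp_all)
  have g: "inv (g p) \<and> sn (g p) \<sqsubset> sn p" if "inv p" for p
  proof -
    have D: "Del (\<lambda>e Z. \<not> inv p \<or> inv (e 0) \<and> sn (e 0) \<sqsubset> sn p)"
      by (rule Del_app2[OF Del_g, of "\<lambda>e Z. e 0" "\<lambda>e Z. p"]) (intro Fn_intros)+
    obtain q where "\<not> inv p \<or> inv q \<and> sn q \<sqsubset> sn p" using ex by blast
    from leastM(1)[where P = "\<lambda>q e Z. \<not> inv p \<or> inv q \<and> sn q \<sqsubset> sn p", OF D this A]
    show ?thesis using that unfolding g_def by blast
  qed
  obtain a where a: "V0 a x" using Vx V_iff by blast
  obtain f where f: "f \<zero> = pr a x" "\<forall>n. f (n \<oplus> \<one>) = g (f n)" "{pr n (f n) | n. True} \<in> Sets"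
    using iteration[OF Fn_g] by blast
  have Del_f: "Del (\<lambda>e Z. pr (e 0) (e 1) \<in> {pr n (f n) | n. True})"
    by (intro Del_memA f(3) Fn_intros)
  then have Fn_f: "Fn (\<lambda>e Z. f (e 0))"
    unfolding Fn_def using Del_Sig[OF Del_rename[OF Del_f, of "\<lambda>k. if k = 0 then 1 else 0"]]
    by (auto elim!: Sig_cong)
  have inv_f: "inv (f n)" for n
  proof (rule Sig_ind[where P = "\<lambda>n. inv (f n)"])
    show "Sig (\<lambda>e Z. inv (f (e 0)))" by (intro Del_Sig Del_app1[OF Del_inv] Fn_f)
    show "inv (f \<zero>)" using inv a x f(1) by simp
    show "inv (f (n \<oplus> \<one>))" if "inv (f n)" for n using g[OF that] f(2) by simp
  qed
  define h where "h n = sn (f n)" for n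
  have Fn_h: "Fn (\<lambda>e Z. h (e 0))" unfolding h_def by (rule Fn_app1[OF Fn_sn Fn_f])
  have "DelSet (\<lambda>e Z. {y. \<exists>n. n \<preceq> y \<and> y = pr n (h n)})"
    by (intro DelSet_Collect Del_intros Fn_var Fn_pair Fn_app1[OF Fn_h])
  then have "{y. \<exists>n. n \<preceq> y \<and> y = pr n (h n)} \<in> Sets" using DelSet_Sets A by blast
  moreover have "{y. \<exists>n. n \<preceq> y \<and> y = pr n (h n)} = {pr n (h n) | n. True}" using le_pair1 by blast
  ultimately have "internal_fun M h" unfolding internal_fun_def by simp
  moreover have "h n \<in> field" for n using inv_f[of n] unfolding inv_def h_def by blast
  moreover have "h (n \<oplus> \<one>) \<sqsubset> h n" for n using g[OF inv_f[of n]] f(2) unfolding h_def by simp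
  ultimately show False using wo unfolding well_orderM_def by blast
qed

section \<open>Recursion without Weak Koenig's Lemma\<close>

context
  fixes T :: "'m set"
  assumes T: "T \<in> SetsOf M" "binary_tree M T" "infiniteM M T" and no_path: "\<And>g. \<not> is_path M T g"
begin

section \<open>Exits from a tree without paths\<close>

lemma off_tree: "B \<in> Sets \<Longrightarrow> \<exists>l. seq_code B l \<notin> T"
proof (rule ccontr)
  assume B: "B \<in> Sets" and neg: "\<nexists>l. seq_code B l \<notin> T"
  have "seg B l = {pr i (chi B i) | i. i \<prec> l}" for l unfolding seg_def ..
  then have "\<forall>l. \<exists>c\<in>T. codes_seq M c l {pr i (chi B i) | i. i \<prec> l}"
    using codes_seq_seq_code[OF B] neg by metis
  moreover have "internal_fun M (chi B)" unfolding internal_fun_def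
  proof -
    have "DelSet (\<lambda>e Z. {y. \<exists>n. n \<preceq> y \<and> y = pr n (chi B n)})"
      by (intro DelSet_Collect Del_intros Fn_var Fn_pair Fn_chi DelSet_const B)
    then have "{y. \<exists>n. n \<preceq> y \<and> y = pr n (chi B n)} \<in> Sets" using DelSet_Sets B by blast
    moreover have "{y. \<exists>n. n \<preceq> y \<and> y = pr n (chi B n)} = {pr n (chi B n) | n. True}" using le_pair1 by blast
    ultimately show "{pr n (chi B n) | n. True} \<in> Sets" by simp
  qed
  ultimately show False using no_path[of "chi B"] unfolding is_path_def by blast
qed

text \<open>The shortest initial segment of \<open>B\<close> outside \<open>T\<close>. Recording its
  code rather than its length allows the segment to be recovered from the number.\<close>

definition exit_code where "exit_code B = seq_code B (leastM (\<lambda>l. seq_code B l \<notin> T))"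

text \<open>A sequence is a minimal one outside \<open>T\<close> iff its extension by zeros exits there.\<close>

definition exits where "exits = {d. exit_code (seq_set d) = d}"

lemma Fn_exit:
  assumes "DelSet B"
  shows "Fn (\<lambda>e Z. exit_code (B e Z))"
  unfolding exit_code_def
proof (intro Fn_seq_code assms Fn_leastM)
  show "Del (\<lambda>e Z. seq_code (B (\<lambda>i. e (Suc i)) Z) (e 0) \<notin> T)"
    by (intro Del_neg Del_memA T(1) Fn_seq_code DelSet_rename[OF assms] Fn_var)
  show "\<exists>l. seq_code (B e Z) l \<notin> T" if "Z \<in> Sets" for e Z
    using off_tree DelSet_Sets[OF assms that] .
qed

lemma Del_exits: "Fn f \<Longrightarrow> Del (\<lambda>e Z. f e Z \<in> exits)"
  unfolding exits_def mem_Collect_eq by (intro Del_eq Fn_exit DelSet_seq_set)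

lemma exit_props:
  assumes B: "B \<in> Sets"
  shows "\<exists>l. exit_code B = seq_code B l \<and> seq_code B l \<notin> T \<and> (\<forall>k. k \<prec> l \<longrightarrow> seq_code B k \<in> T)"
proof -
  have D: "Del (\<lambda>e Z. seq_code B (e 0) \<notin> T)"
    by (intro Del_neg Del_memA T(1) Fn_seq_code DelSet_const B Fn_var)
  obtain l where "seq_code B l \<notin> T" using off_tree[OF B] by blast
  from leastM[where P = "\<lambda>l e Z. seq_code B l \<notin> T", OF D this B] show ?thesis
    unfolding exit_code_def by blast
qed

lemma exit_code_exits:
  assumes B: "B \<in> Sets"
  shows "exit_code B \<in> exits"
proof -
  obtain l where l: "exit_code B = seq_code B l" "seq_code B l \<notin> T" "\<And>k. k \<prec> l \<Longrightarrow> seq_code B k \<in> T"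
    using exit_props[OF B] by blast
  have eq: "seq_code (seq_set (seq_code B l)) k = seq_code B k" if "k \<preceq> l" for k
    unfolding seq_code_eq[OF seq_set_Sets B] seq_set_seq_code[OF B] using that ar.less_le_trans by blast
  have "leastM (\<lambda>k. seq_code (seq_set (seq_code B l)) k \<notin> T) = l"
    by (rule leastM_eq) (use eq l in \<open>auto simp: le_def\<close>)
  then have "exit_code (seq_set (seq_code B l)) = seq_code B l" unfolding exit_code_def using eq by (simp add: le_def)
  then show ?thesis unfolding exits_def l(1) by simp
qed

text \<open>A member of \<open>T\<close> beyond all codes of length at most \<open>b\<close> must be
  longer than \<open>b\<close>. Its defining set leaves \<open>T\<close> no earlier than at that
  length, because \<open>T\<close> is closed under initial segments, and codes dominate
  lengths.\<close>

lemma exits_unbounded: "\<exists>d\<in>exits. b \<preceq> d"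
proof -
  obtain C where C: "\<forall>B\<in>Sets. \<forall>l'. l' \<preceq> b \<longrightarrow> seq_code B l' \<preceq> C" using seq_code_bound by blast
  obtain c where c: "c \<in> T" "C \<prec> c" using T(3) unfolding infiniteM_def by blast
  obtain l A where "codes_binseq M c l A" using T(2) c(1) unfolding binary_tree_def by blast
  then obtain B where B: "B \<in> Sets" "c = seq_code B l" unfolding codes_binseq_iff by blast
  have "\<not> l \<preceq> b" using C B c(2) ar.leD by blast
  then have bl: "b \<preceq> l" using less_linear unfolding le_def by blast
  obtain k where k: "exit_code B = seq_code B k" "seq_code B k \<notin> T" using exit_props[OF B(1)] by blast
  have "seq_code B k \<in> T" if "k \<preceq> l"
  proof -
    have "codes_binseq M (seq_code B k) k (seg B k)" "codes_binseq M c l (seg B l)" "seg B k \<subseteq> seg B l"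
      using that B unfolding codes_binseq_iff seg_subset by blast+
    then show ?thesis using T(2) c(1) unfolding binary_tree_def by blast
  qed
  then have "l \<preceq> k" using k(2) less_linear unfolding le_def by blast
  then have "b \<preceq> exit_code B" using bl le_seq_code[OF B(1), of k] ar.order.trans unfolding k(1) by blast
  then show ?thesis using exit_code_exits[OF B(1)] by blast
qed

text \<open>The number to be stored for a bound \<open>s\<close>: rounding up to an exit gives a
  number whose continuation by zeros is read back by \<open>exit_code\<close> as exactly that
  number.\<close>

definition next_exit where "next_exit s = leastM (\<lambda>d. d \<in> exits \<and> s \<preceq> d)"

lemma next_exit: "next_exit s \<in> exits" "s \<preceq> next_exit s"
proof -
  obtain A where A: "A \<in> Sets" using Sets_ex by blast
  have D: "Del (\<lambda>e Z. e 0 \<in> exits \<and> s \<preceq> e 0)" by (intro Del_intros Del_exits Fn_intros)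
  obtain d where "d \<in> exits \<and> s \<preceq> d" using exits_unbounded by blast
  from leastM(1)[where P = "\<lambda>d e Z. d \<in> exits \<and> s \<preceq> d", OF D this A]
  show "next_exit s \<in> exits" "s \<preceq> next_exit s" unfolding next_exit_def by auto
qed

lemma Fn_next_exit: "Fn f \<Longrightarrow> Fn (\<lambda>e Z. next_exit (f e Z))"
proof (rule Fn_app1[where F = "\<lambda>x Z. next_exit x"])
  show "Fn (\<lambda>e Z. next_exit (e 0))" unfolding next_exit_def
    by (intro Fn_leastM Del_intros Del_exits Fn_var) (use exits_unbounded in blast)
qed

section \<open>Hierarchies that carry bounds for their witnesses\<close>

context
  fixes \<theta>1 \<theta>2 :: "'m \<Rightarrow> 'm \<Rightarrow> 'm \<Rightarrow> 'm set \<Rightarrow> bool" and u1 u2 :: "'m \<Rightarrow> 'm \<Rightarrow> 'm \<Rightarrow> 'm"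
  assumes matrix1: "matrix \<theta>1 u1" and matrix2: "matrix \<theta>2 u2"
    and compl: "\<And>n x Z. x \<in> field \<Longrightarrow> Z \<in> SetsOf M \<Longrightarrow>
      recH M (\<lambda>n x Z. \<exists>k. \<theta>1 k n x Z) (suborder M X x) Z \<Longrightarrow>
      (\<exists>k. \<theta>1 k n x Z) \<longleftrightarrow> \<not> (\<exists>k. \<theta>2 k n x Z)"
begin

text \<open>A set \<open>Z\<close> stores at \<open>(x, (n, 0))\<close> the value of the recursion at \<open>(x, n)\<close> and at the
  places \<open>(x, (n, i + 1))\<close> a binary sequence whose exit from \<open>T\<close> bounds a witness for that
  value.\<close>

definition vals where
  "vals Z x = {y. \<exists>x'. x' \<preceq> y \<and> (\<exists>n. n \<preceq> y \<and> y = pr x' n \<and> x' \<sqsubset> x \<and> pr x' (pr n \<zero>) \<in> Z)}"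

definition bits where "bits Z x n = {i. pr x (pr n (i \<oplus> \<one>)) \<in> Z}"

text \<open>The first two clauses concern a stored value without a witness within the stored bound,
  and are decidable outright. The third detects a failure of complementarity; only this one needs
  the search bound \<open>s\<close>.\<close>

definition wrong_at where
  "wrong_at s Z x n \<longleftrightarrow>
    pr x (pr n \<zero>) \<in> Z \<and> \<not> (\<exists>k. k \<preceq> exit_code (bits Z x n) \<and> \<theta>1 k n x (vals Z x)) \<or>
    pr x (pr n \<zero>) \<notin> Z \<and> \<not> (\<exists>k. k \<preceq> exit_code (bits Z x n) \<and> \<theta>2 k n x (vals Z x)) \<or>
    (\<exists>k. k \<preceq> s \<and> \<theta>1 k n x (vals Z x)) \<and> (\<exists>k. k \<preceq> s \<and> \<theta>2 k n x (vals Z x))"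

definition bad where
  "bad s Z x \<longleftrightarrow> (\<exists>y. y \<preceq> s \<and> y \<sqsubset> x \<and> (\<exists>n. n \<preceq> s \<and> wrong_at s Z y n))"

text \<open>Each disjunct covers one way in which the search may end; the first keeps it total
  outside the field, where \<open>compl\<close> gives nothing.\<close>

definition hit where
  "hit s n x Z \<longleftrightarrow> x \<notin> field \<or> \<theta>1 s n x (vals Z x) \<or> \<theta>2 s n x (vals Z x) \<or> bad s Z x"

definition stage where "stage n x Z = leastM (\<lambda>s. hit s n x Z)"

text \<open>If an error ended the search, the result has no meaning but is still defined, as
  \<open>WETR\<close> requires.\<close>

definition next_bits where
  "next_bits m x Z \<longleftrightarrow>
    (\<exists>n. n \<preceq> m \<and> m = pr n \<zero> \<and> \<theta>1 (stage n x Z) n x (vals Z x)) \<or>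
    (\<exists>n. n \<preceq> m \<and> (\<exists>i. i \<preceq> m \<and> m = pr n (i \<oplus> \<one>) \<and> i \<in> seq_set (next_exit (stage n x Z))))"

lemma mem_vals [simp]: "pr y n \<in> vals Z x \<longleftrightarrow> y \<sqsubset> x \<and> pr y (pr n \<zero>) \<in> Z"
  unfolding vals_def using le_pair1 le_pair2 by auto

lemma vals_pair: "y \<in> vals Z x \<Longrightarrow> \<exists>a n. y = pr a n"
  unfolding vals_def by blast

lemma DelSet_vals: "DelSet A \<Longrightarrow> Fn f \<Longrightarrow> DelSet (\<lambda>e Z. vals (A e Z) (f e Z))"
  unfolding vals_def
  by (intro DelSet_Collect Del_intros Fn_var Fn_const Fn_pair Del_order Del_mem) (rule Fn_rename DelSet_rename; assumption)+

lemma DelSet_bits: "DelSet A \<Longrightarrow> Fn f \<Longrightarrow> Fn g \<Longrightarrow> DelSet (\<lambda>e Z. bits (A e Z) (f e Z) (g e Z))"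
  unfolding bits_def
  by (intro DelSet_Collect Fn_var Fn_const Fn_pair Fn_add Del_mem) (rule Fn_rename DelSet_rename; assumption)+

lemma DelSet_Z: "DelSet (\<lambda>e Z. Z)"
  unfolding DelSet_def by (intro Del_memZ Fn_var)

lemma Del_wrong_at: "Fn f \<Longrightarrow> Fn g \<Longrightarrow> Fn h \<Longrightarrow> Del (\<lambda>e Z. wrong_at (f e Z) Z (g e Z) (h e Z))"
proof (rule Del_app3[of "\<lambda>s x n Z. wrong_at s Z x n"])
  show "Del (\<lambda>e Z. wrong_at (e 0) Z (e 1) (e 2))" unfolding wrong_at_def
    by (intro Del_intros Fn_var Fn_const Fn_pair Fn_exit DelSet_bits DelSet_Z DelSet_vals
        matrixD(1)[OF matrix1] matrixD(1)[OF matrix2])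
qed

lemma Del_bad: "Fn f \<Longrightarrow> Fn g \<Longrightarrow> Del (\<lambda>e Z. bad (f e Z) Z (g e Z))"
proof (rule Del_app2[of "\<lambda>s x Z. bad s Z x"])
  show "Del (\<lambda>e Z. bad (e 0) Z (e 1))" unfolding bad_def
    by (intro Del_intros Fn_var Del_order Del_wrong_at)
qed

lemma Del_hit: "Del (\<lambda>e Z. hit (e 0) (e 1) (e 2) Z)"
  unfolding hit_def
  by (intro Del_intros Fn_var Del_field Del_bad DelSet_Z DelSet_vals matrixD(1)[OF matrix1] matrixD(1)[OF matrix2])

lemma wrong_mono: "s \<preceq> s' \<Longrightarrow> wrong_at s Z x n \<Longrightarrow> wrong_at s' Z x n"
  unfolding wrong_at_def using ar.order.trans by blast

lemma bad_iff: "(\<exists>s. bad s Z x) \<longleftrightarrow> (\<exists>y n s. y \<sqsubset> x \<and> wrong_at s Z y n)"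
proof
  assume "\<exists>y n s. y \<sqsubset> x \<and> wrong_at s Z y n"
  then obtain y n s where h: "y \<sqsubset> x" "wrong_at s Z y n" by blast
  have "s \<preceq> s \<oplus> (y \<oplus> n)" "y \<preceq> s \<oplus> (y \<oplus> n)" "n \<preceq> s \<oplus> (y \<oplus> n)"
    using add_le1 add_le2 ar.order.trans by blast+
  then have "bad (s \<oplus> (y \<oplus> n)) Z x" unfolding bad_def using h wrong_mono by blast
  then show "\<exists>s. bad s Z x" by blast
qed (auto simp: bad_def)

lemma vals_Sets: "Z \<in> Sets \<Longrightarrow> vals Z x \<in> Sets"
  using DelSet_Sets[OF DelSet_vals[OF DelSet_const Fn_const]] by blast

lemma not_wrong_correct:
  assumes "\<And>s. \<not> wrong_at s Z x n"
  shows "pr x (pr n \<zero>) \<in> Z \<longleftrightarrow> (\<exists>k. \<theta>1 k n x (vals Z x))"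
proof -
  have nb: "\<not> ((\<exists>k. \<theta>1 k n x (vals Z x)) \<and> (\<exists>k. \<theta>2 k n x (vals Z x)))"
  proof
    assume "(\<exists>k. \<theta>1 k n x (vals Z x)) \<and> (\<exists>k. \<theta>2 k n x (vals Z x))"
    then obtain k k' where k: "\<theta>1 k n x (vals Z x)" "\<theta>2 k' n x (vals Z x)" by blast
    have "k \<preceq> k \<oplus> k'" "k' \<preceq> k \<oplus> k'" using add_le1 add_le2 by blast+
    then have "wrong_at (k \<oplus> k') Z x n" unfolding wrong_at_def using k by blast
    then show False using assms by blast
  qed
  \<comment> \<open>The stage is irrelevant for the first two clauses, so any instance will do for
    them; the third has been excluded above.\<close>
  then show ?thesis using assms[of \<zero>] unfolding wrong_at_def by blast
qed

text \<open>This is the premise under which \<open>compl\<close> may be applied, here obtained for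
  an arbitrary \<open>Z\<close> from the mere absence of errors in the earlier rows.\<close>

lemma vals_recH:
  assumes "\<And>y n s. y \<sqsubset> x \<Longrightarrow> \<not> wrong_at s Z y n"
  shows "recH M (\<lambda>n x Z. \<exists>k. \<theta>1 k n x Z) (suborder M X x) (vals Z x)"
proof -
  have sub: "leX M (suborder M X x) a b \<longleftrightarrow> a \<sqsubseteq> b \<and> a \<sqsubset> x \<and> b \<sqsubset> x" for a b
    unfolding suborder_def leX_def[of M "{_. _}"] by (auto simp: leX_def)
  have fld: "a \<in> fieldX M (suborder M X x) \<longleftrightarrow> a \<sqsubset> x" for a
    unfolding fieldX_def mem_Collect_eq sub using order_facts(1,7) by blast
  have restr: "restr M (suborder M X x) (vals Z x) y = vals Z y" if "y \<sqsubset> x" for y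
  proof -
    have "lessX M (suborder M X x) a y \<longleftrightarrow> a \<sqsubset> y" for a
      unfolding lessX_def[of M "suborder M X x"] sub using that order_facts(9)
      by (auto simp: lessX_def[of M X a y]) (metis lessX_def order_facts(9))
    then have "pr a n \<in> restr M (suborder M X x) (vals Z x) y \<longleftrightarrow> pr a n \<in> vals Z y" for a n
      unfolding restr_def using that order_facts(9) by auto
    moreover have "\<exists>a n. z = pr a n" if "z \<in> restr M (suborder M X x) (vals Z x) y" for z
      using that unfolding restr_def by blast
    ultimately show ?thesis using vals_pair by blast
  qed
  show ?thesis unfolding recH_def
  proof (rule set_eqI)
    fix z
    have "pr y n \<in> vals Z x \<longleftrightarrow> y \<in> fieldX M (suborder M X x) \<and>
      (\<exists>k. \<theta>1 k n y (restr M (suborder M X x) (vals Z x) y))" for y n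
      using not_wrong_correct[OF assms, of y n] restr[of y] unfolding fld by auto
    then show "z \<in> vals Z x \<longleftrightarrow> z \<in> {pr y n | y n. y \<in> fieldX M (suborder M X x) \<and>
      (\<exists>k. \<theta>1 k n y (restr M (suborder M X x) (vals Z x) y))}"
      using vals_pair[of z Z x] by auto
  qed
qed

text \<open>Totality at every set is what makes \<open>stage\<close> computable, and with it
  \<open>next_bits\<close> decidable without any condition on \<open>Z\<close>.\<close>

lemma hit_ex:
  assumes "Z \<in> Sets"
  shows "\<exists>s. hit s n x Z"
proof (cases "x \<in> field \<and> (\<forall>s. \<not> bad s Z x)")
  case True
  then have "recH M (\<lambda>n x Z. \<exists>k. \<theta>1 k n x Z) (suborder M X x) (vals Z x)"
    using bad_iff by (intro vals_recH) blast
  then have "(\<exists>k. \<theta>1 k n x (vals Z x)) \<or> (\<exists>k. \<theta>2 k n x (vals Z x))"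
    using compl[OF _ vals_Sets[OF assms]] True by blast
  then show ?thesis unfolding hit_def by blast
qed (auto simp: hit_def)

lemma Fn_stage: "Fn f \<Longrightarrow> Fn g \<Longrightarrow> Fn (\<lambda>e Z. stage (f e Z) (g e Z) Z)"
proof (rule Fn_app2[where F = stage])
  show "Fn (\<lambda>e Z. stage (e 0) (e 1) Z)" unfolding stage_def
  proof (rule Fn_leastM)
    show "Del (\<lambda>e Z. hit (e 0) (e (Suc 0)) (e (Suc 1)) Z)" using Del_hit by (simp add: numeral_2_eq_2)
  qed (rule hit_ex)
qed

lemma hit_stage:
  assumes "Z \<in> Sets"
  shows "hit (stage n x Z) n x Z"
proof -
  have D: "Del (\<lambda>e Z. hit (e 0) n x Z)"
    using Del_app3[OF Del_hit, of "\<lambda>e Z. e 0" "\<lambda>e Z. n" "\<lambda>e Z. x"] Fn_var Fn_const by blast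
  obtain s where "hit s n x Z" using hit_ex[OF assms] by blast
  from leastM(1)[where P = "\<lambda>s e Z. hit s n x Z", OF D this assms] show ?thesis
    unfolding stage_def .
qed

lemma Del_next_bits: "Del (\<lambda>e Z. next_bits (e 0) (e 1) Z)"
  unfolding next_bits_def
  by (intro Del_intros Fn_var Fn_const Fn_pair Fn_add Fn_stage Fn_next_exit Del_mem DelSet_seq_set
      DelSet_Z DelSet_vals matrixD(1)[OF matrix1])

lemma noWKL_recursion:
  assumes wo: "well_orderM M X" and wetr: "WETR M X"
  shows "\<exists>Y\<in>Sets. recH M (\<lambda>n x Z. \<exists>k. \<theta>1 k n x Z) X Y"
proof -
  obtain \<phi> \<psi> e s where f: "Sigma01 \<phi>" "Sigma01 \<psi>" "range s \<subseteq> Sets"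
    "\<forall>n x. \<forall>Z\<in>Sets. (inst M e s \<phi> n x Z \<longleftrightarrow> next_bits n x Z) \<and> (inst M e s \<psi> n x Z \<longleftrightarrow> \<not> next_bits n x Z)"
    using Del_formulas[OF Del_next_bits] by (elim exE conjE) (rule that)
  have "\<forall>n. \<forall>x\<in>field. \<forall>Z\<in>Sets. inst M e s \<phi> n x Z \<longleftrightarrow> \<not> inst M e s \<psi> n x Z"
    using f(4) by simp
  then obtain W where W: "W \<in> Sets" "recH M (inst M e s \<phi>) X W"
    using wetr f(1-3) unfolding WETR_def by blast
  have W_iff: "pr x m \<in> W \<longleftrightarrow> next_bits m x (below W x)" if "x \<in> field" for x m
  proof -
    have "pr x m \<in> W \<longleftrightarrow> inst M e s \<phi> m x (below W x)"
      using arg_cong[OF W(2)[unfolded recH_def], of "\<lambda>S. pr x m \<in> S"] that by simp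
    then show ?thesis using f(4) below_Sets[OF W(1)] by blast
  qed
  define S where "S n x = stage n x (below W x)" for n x
  \<comment> \<open>The recursion sees only \<open>below W x\<close>, whereas errors are judged in
    \<open>W\<close>; for the rows before \<open>x\<close> both views agree.\<close>
  have vals_below: "vals (below W x) y = vals W y" if "y = x \<or> y \<sqsubset> x" for x y
  proof -
    have "pr a n \<in> vals (below W x) y \<longleftrightarrow> pr a n \<in> vals W y" for a n
      using that order_facts(9) by auto
    then show ?thesis using vals_pair by blast
  qed
  have wrong_below: "wrong_at t (below W x) y n \<longleftrightarrow> wrong_at t W y n" if "y \<sqsubset> x" for t x y n
  proof -
    have "bits (below W x) y n = bits W y n" unfolding bits_def using that by simp
    then show ?thesis unfolding wrong_at_def using that vals_below by simp
  qed
  have tag: "pr x (pr n \<zero>) \<in> W \<longleftrightarrow> \<theta>1 (S n x) n x (vals W x)" if "x \<in> field" for x n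
    unfolding W_iff[OF that] next_bits_def S_def using le_pair1 arith_axioms(1) vals_below by (auto dest: sym)
  have bits: "exit_code (bits W x n) = next_exit (S n x)" if "x \<in> field" for x n
  proof -
    have "i \<in> bits W x n \<longleftrightarrow> i \<in> seq_set (next_exit (S n x))" for i
    proof -
      have "i \<preceq> i \<oplus> \<one>" by (rule add_le1)
      then have "i \<preceq> pr n (i \<oplus> \<one>)" using le_pair2 ar.order.trans by blast
      then show ?thesis
        unfolding bits_def mem_Collect_eq W_iff[OF that] next_bits_def S_def using le_pair1 arith_axioms(1) by auto
    qed
    then have "bits W x n = seq_set (next_exit (S n x))" by blast
    then show ?thesis using next_exit(1) unfolding exits_def by simp
  qed
  \<comment> \<open>Errors of the fixed set \<open>W\<close> are a Sigma_1 property; they need not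
    form a set, and \<open>well_founded\<close> does not ask for one.\<close>
  define V where "V x \<longleftrightarrow> (\<exists>n s. wrong_at s W x n)" for x
  have "Sig (\<lambda>e Z. \<exists>n s. wrong_at s Z (e 0) n)"
    by (intro Sig_ex Del_Sig Del_wrong_at Fn_var)
  then have Sig_V: "Sig (\<lambda>e Z. V (e 0))" unfolding V_def by (rule Sig_fix) (rule W(1))
  have "\<exists>y. y \<sqsubset> x \<and> V y" if x: "x \<in> field" "V x" for x
  proof (rule ccontr)
    assume "\<not> ?thesis"
    then have nw: "\<not> wrong_at t W y n" if "y \<sqsubset> x" for y n t using that unfolding V_def by blast
    obtain n t where w: "wrong_at t W x n" using x(2) unfolding V_def by blast
    have "\<not> bad (S n x) (below W x) x" using nw wrong_below unfolding bad_def by blast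
    then have hit: "\<theta>1 (S n x) n x (vals W x) \<or> \<theta>2 (S n x) n x (vals W x)"
      using hit_stage[OF below_Sets[OF W(1)], of n x x] x(1) vals_below
      unfolding hit_def S_def by auto
    \<comment> \<open>The search ended at a witness within the stored bound, and the stored value
      says of which formula. This rules out the first two clauses of \<open>wrong_at\<close>; the
      third contradicts \<open>compl\<close> at the correct hierarchy
      \<open>vals W x\<close>.\<close>
    have "S n x \<preceq> exit_code (bits W x n)" unfolding bits[OF x(1)] by (rule next_exit(2))
    then have "(\<exists>k. \<theta>1 k n x (vals W x)) \<and> (\<exists>k. \<theta>2 k n x (vals W x))"
      using w hit tag[OF x(1)] unfolding wrong_at_def by blast
    then show False
      using compl[OF x(1) vals_Sets[OF W(1)] vals_recH[OF nw]] by blast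
  qed
  from well_founded[OF wo Sig_V this] have nV: "\<not> V x" if "x \<in> field" for x using that by blast
  \<comment> \<open>The stored bounds are dropped and only the values remain.\<close>
  define Y where "Y = {y. \<exists>x. x \<preceq> y \<and> (\<exists>n. n \<preceq> y \<and> y = pr x n \<and> x \<in> field \<and> pr x (pr n \<zero>) \<in> W)}"
  have "DelSet (\<lambda>e Z. Y)" unfolding Y_def
    by (intro DelSet_Collect Del_intros Fn_var Fn_const Fn_pair Del_field Del_memA W(1))
  then have Y: "Y \<in> Sets" using DelSet_Sets Sets_ex by blast
  have Y_iff: "pr x n \<in> Y \<longleftrightarrow> x \<in> field \<and> pr x (pr n \<zero>) \<in> W" for x n
    unfolding Y_def using le_pair1 le_pair2 by auto
  have Y_pair: "\<exists>x n. y = pr x n" if "y \<in> Y" for y using that unfolding Y_def by blast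
  have below_Y: "below Y x = vals W x" for x
  proof -
    have "pr a n \<in> below Y x \<longleftrightarrow> pr a n \<in> vals W x" for a n
      using order_facts(7) by (auto simp: Y_iff)
    moreover have "\<exists>a n. z = pr a n" if "z \<in> below Y x" for z using that unfolding restr_def by blast
    ultimately show ?thesis using vals_pair by blast
  qed
  have "pr x n \<in> Y \<longleftrightarrow> x \<in> field \<and> (\<exists>k. \<theta>1 k n x (below Y x))" for x n
    unfolding Y_iff below_Y using not_wrong_correct nV unfolding V_def by blast
  then have "recH M (\<lambda>n x Z. \<exists>k. \<theta>1 k n x Z) X Y"
    unfolding recH_def using Y_pair by blast
  then show ?thesis using Y by blast
qed

end

end

lemma WETR_imp_SETR:
  assumes "well_orderM M X" "WETR M X" "\<not> WKL M"
  shows "SETR M X"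
  unfolding SETR_def
proof (intro allI impI)
  fix \<phi> \<psi> e s
  assume "Sigma01 \<phi> \<and> Sigma01 \<psi> \<and> range s \<subseteq> Sets"
    and compl: "\<forall>n. \<forall>x\<in>field. \<forall>Z\<in>Sets. recH M (inst M e s \<phi>) (suborder M X x) Z \<longrightarrow>
      (inst M e s \<phi> n x Z \<longleftrightarrow> \<not> inst M e s \<psi> n x Z)"
  then have s: "Sigma01 \<phi>" "Sigma01 \<psi>" "range s \<subseteq> Sets" by auto
  obtain \<theta>1 u1 where 1: "matrix \<theta>1 u1" "\<And>n x W. inst M e s \<phi> n x W \<longleftrightarrow> (\<exists>k. \<theta>1 k n x W)"
    using Sigma01_matrix[OF s(1,3), of e] by blast
  obtain \<theta>2 u2 where 2: "matrix \<theta>2 u2" "\<And>n x W. inst M e s \<psi> n x W \<longleftrightarrow> (\<exists>k. \<theta>2 k n x W)"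
    using Sigma01_matrix[OF s(2,3), of e] by blast
  obtain T where T: "T \<in> Sets" "binary_tree M T" "infiniteM M T" "\<And>g. \<not> is_path M T g"
    using assms(3) unfolding WKL_def by blast
  have eq: "inst M e s \<phi> = (\<lambda>n x Z. \<exists>k. \<theta>1 k n x Z)" by (intro ext) (rule 1(2))
  show "\<exists>Y\<in>Sets. recH M (inst M e s \<phi>) X Y"
    unfolding eq
    by (rule noWKL_recursion[OF T 1(1) 2(1) _ assms(1,2)])
      (use compl[unfolded eq] in \<open>simp only: 2(2)\<close>)
qed

end

theorem theorem15:
  fixes M :: "'m l2_structure" and X :: "'m set"
  assumes "RCA0 M" and "well_orderM M X"
  shows "WETR M X \<longleftrightarrow> WKL M \<or> SETR M X"
proof -
  interpret rca0_order M X
    using assms by unfold_locales (simp_all add: well_orderM_def)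
  \<comment> \<open>Complementarity at all sets includes complementarity at correct hierarchies, so
    the premise of \<open>WETR\<close> is the stronger one.\<close>
  have "WETR M X" if S: "SETR M X"
    unfolding WETR_def
  proof (intro allI impI)
    fix \<phi> \<psi> e s
    assume f: "Sigma01 \<phi> \<and> Sigma01 \<psi> \<and> range s \<subseteq> Sets"
      and c: "\<forall>n. \<forall>x\<in>field. \<forall>Z\<in>Sets. inst M e s \<phi> n x Z \<longleftrightarrow> \<not> inst M e s \<psi> n x Z"
    show "\<exists>Y\<in>Sets. recH M (inst M e s \<phi>) X Y"
      by (rule S[unfolded SETR_def, rule_format, OF f]) (use c in simp)
  qed
  then show ?thesis
    using WKL_imp_WETR WETR_imp_SETR[OF assms(2)] by blast
qed

end
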